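(* Fix an integer $d\ge1$, $s>0$ and $L>0$. There is a constant $C(s,d,L)>0$ such that for all integers $2\le n_1\le n_2$, all $\alpha\in(0,1)$, $\beta\in(0,1-\alpha)$ and all $$\epsilon_{n_1,n_2}\ \ge\ \frac{C(s,d,L)}{\alpha^{1/4}\beta^{1/2}}\Big(\frac1{n_1}+\frac1{n_2}\Big)^{\frac{2s}{4s+d}},$$ the following holds. For testing $\mathcal{P}_0=\{(P_Y,P_Z)\in\mathcal{P}^{(d,s)}_{\text{Hölder}}:f_Y=f_Z\}$ against $\mathcal{P}_1=\{(P_Y,P_Z)\in\mathcal{P}^{(d,s)}_{\text{Hölder}}:\|f_Y-f_Z\|_{L_2}\ge\epsilon_{n_1,n_2}\}$, the permutation test based on the binned $U$-statistic $U_{n_1,n_2}$ described in the context, with bins of side length $1/\kappa_{(1)}$, $\kappa_{(1)}=\lfloor n_1^{2/(4s+d)}\rfloor$, satisfies $$\sup_{P\in\mathcal{P}_0}\mathbb{P}_P(U_{n_1,n_2}>c_{1-\alpha})\le\alpha\quad\text{and}\quad\sup_{P\in\mathcal{P}_1}\mathbb{P}_P(U_{n_1,n_2}\le c_{1-\alpha})\le\beta .$$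
   Context: Hölder class: $\mathcal{H}^d_s(L)$ is the class of functions $f:[0,1]^d\to\mathbb{R}$ with (1) $|f^{(\lfloor s\rfloor)}(x)-f^{(\lfloor s\rfloor)}(x')|\le L\|x-x'\|^{s-\lfloor s\rfloor}$ for all $x,x'\in[0,1]^d$, and (2) $\|f^{(s')}\|_\infty\le L$ for each $s'\in\{1,\dots,\lfloor s\rfloor\}$, where $f^{(k)}$ denotes the $k$-th order derivative (the array of all order-$k$ partial derivatives). $\mathcal{P}^{(d,s)}_{\text{Hölder}}$ is the set of pairs $(P_Y,P_Z)$ of distributions on $[0,1]^d$ whose Lebesgue densities $f_Y,f_Z$ both belong to $\mathcal{H}^d_s(L)$. $\|f\|_{L_2}^2=\int f^2(x)\,dx$. Data: $Y_1,\dots,Y_{n_1}$ i.i.d. from $P_Y$ and, independently, $Z_1,\dots,Z_{n_2}$ i.i.d. from $P_Z$. Binned statistic: partition $[0,1]^d$ into $K=\kappa_{(1)}^d$ hypercubes $B_1,\dots,B_K$ of side length $\kappa_{(1)}^{-1}$, and let $Q(x)=k$ iff $x\in B_k$. Replace each observation by its $Q$-value. With $g(x,y):=\sum_{k=1}^K\mathbb{1}(x=k)\mathbb{1}(y=k)$ and $h_{\rm ts}(y_1,y_2;z_1,z_2):=g(y_1,y_2)+g(z_1,z_2)-g(y_1,z_2)-g(y_2,z_1)$, $$U_{n_1,n_2}:=\frac{1}{n_1(n_1-1)n_2(n_2-1)}\sum_{i_1\ne i_2}\sum_{j_1\ne j_2}h_{\rm ts}(Q(Y_{i_1}),Q(Y_{i_2});Q(Z_{j_1}),Q(Z_{j_2})).$$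 Permutation critical value: let $n=n_1+n_2$ and $(X_1,\dots,X_n)=(Y_1,\dots,Y_{n_1},Z_1,\dots,Z_{n_2})$. For a permutation $\pi$ of $\{1,\dots,n\}$, $U^\pi_{n_1,n_2}$ is the statistic recomputed with $(X_{\pi_1},\dots,X_{\pi_{n_1}})$ as first sample and $(X_{\pi_{n_1+1}},\dots,X_{\pi_n})$ as second sample. Then $c_{1-\alpha}:=\inf\{t:\frac1{n!}\sum_\pi\mathbb{1}(U^\pi_{n_1,n_2}\le t)\ge1-\alpha\}$, and the test rejects when $U_{n_1,n_2}>c_{1-\alpha}$. *)

theory Defs
  imports "HOL-Probability.Probability" "HOL-Combinatorics.Permutations"
begin

section \<open>Hoelder densities on the unit cube\<close>

definition unit_cube :: "(real ^ 'd) set" where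
  "unit_cube = {x. \<forall>i. 0 \<le> x $ i \<and> x $ i \<le> 1}"

text \<open>The parameters \<open>t\<close> for which \<open>x + t e\<^sub>i\<close> stays in the cube. Partial derivatives are taken at
  \<open>t = 0\<close> within this set, so they are one-sided on the faces of the cube.\<close>

definition cube_line :: "real ^ 'd \<Rightarrow> 'd \<Rightarrow> real set" where
  "cube_line x i = {t. x + t *\<^sub>R axis i 1 \<in> unit_cube}"

definition cube_partial :: "(real ^ 'd \<Rightarrow> real) \<Rightarrow> 'd \<Rightarrow> real ^ 'd \<Rightarrow> real" where
  "cube_partial f i x =
     vector_derivative (\<lambda>t. f (x + t *\<^sub>R axis i 1)) (at 0 within cube_line x i)"

fun iter_partial :: "(real ^ 'd \<Rightarrow> real) \<Rightarrow> 'd list \<Rightarrow> real ^ 'd \<Rightarrow> real" where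
  "iter_partial f [] = f"
| "iter_partial f (i # is) = cube_partial (iter_partial f is) i"

definition partials_exist :: "nat \<Rightarrow> (real ^ 'd \<Rightarrow> real) \<Rightarrow> bool" where
  "partials_exist k f \<longleftrightarrow>
     (\<forall>is. length is < k \<longrightarrow> (\<forall>i. \<forall>x\<in>unit_cube.
        (\<lambda>t. iter_partial f is (x + t *\<^sub>R axis i 1)) differentiable (at 0 within cube_line x i)))"

text \<open>The \<open>k\<close>-th order derivative is the array of all partial derivatives of order \<open>k\<close>, indexed by the
  sequences of \<open>k\<close> coordinates; arrays carry the Euclidean norm.\<close>

definition array_norm :: "nat \<Rightarrow> ('d::finite list \<Rightarrow> real) \<Rightarrow> real" where
  "array_norm k a = L2_set a {is. length is = k}"

text \<open>For \<open>s\<close> an integer the exponent in the first bound is \<open>0\<close>; since \<open>0 powr 0 = 0\<close>, this is the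
  bound \<open>L\<close> for \<open>x \<noteq> x'\<close> and the triviality \<open>0 \<le> 0\<close> for \<open>x = x'\<close>.\<close>

definition holder_class :: "real \<Rightarrow> real \<Rightarrow> (real ^ 'd::finite \<Rightarrow> real) set" where
  "holder_class s L = {f. let m = nat \<lfloor>s\<rfloor> in
     partials_exist m f \<and>
     (\<forall>x\<in>unit_cube. \<forall>x'\<in>unit_cube.
        array_norm m (\<lambda>is. iter_partial f is x - iter_partial f is x')
          \<le> L * norm (x - x') powr (s - real_of_int \<lfloor>s\<rfloor>)) \<and>
     (\<forall>k\<in>{1..m}. \<forall>x\<in>unit_cube. array_norm k (\<lambda>is. iter_partial f is x) \<le> L)}"

definition cube_density :: "(real ^ 'd::finite) measure \<Rightarrow> (real ^ 'd \<Rightarrow> real) \<Rightarrow> bool" where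
  "cube_density P f \<longleftrightarrow> prob_space P \<and> (\<forall>x\<in>unit_cube. 0 \<le> f x) \<and>
     set_borel_measurable lborel unit_cube f \<and>
     P = density lborel (\<lambda>x. ennreal (f x) * indicator unit_cube x)"

text \<open>Functions in the Hoelder class are continuous on the cube, so a distribution has at most one
  density there that belongs to the class; existential quantification over this density below
  therefore means the density.\<close>

definition holder_density :: "real \<Rightarrow> real \<Rightarrow> (real ^ 'd::finite) measure \<Rightarrow> (real ^ 'd \<Rightarrow> real) \<Rightarrow> bool" where
  "holder_density s L P f \<longleftrightarrow> cube_density P f \<and> f \<in> holder_class s L"

definition L2_norm_cube :: "(real ^ 'd::finite \<Rightarrow> real) \<Rightarrow> real" where
  "L2_norm_cube f = sqrt (LINT x:unit_cube|lborel. (f x)\<^sup>2)"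

definition null_class :: "real \<Rightarrow> real \<Rightarrow> ((real ^ 'd::finite) measure \<times> (real ^ 'd) measure) set" where
  "null_class s L = {(P\<^sub>Y, P\<^sub>Z). \<exists>f\<^sub>Y f\<^sub>Z. holder_density s L P\<^sub>Y f\<^sub>Y \<and> holder_density s L P\<^sub>Z f\<^sub>Z \<and>
     (\<forall>x\<in>unit_cube. f\<^sub>Y x = f\<^sub>Z x)}"

definition alt_class ::
  "real \<Rightarrow> real \<Rightarrow> real \<Rightarrow> ((real ^ 'd::finite) measure \<times> (real ^ 'd) measure) set" where
  "alt_class s L \<epsilon> = {(P\<^sub>Y, P\<^sub>Z). \<exists>f\<^sub>Y f\<^sub>Z. holder_density s L P\<^sub>Y f\<^sub>Y \<and> holder_density s L P\<^sub>Z f\<^sub>Z \<and>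
     L2_norm_cube (\<lambda>x. f\<^sub>Y x - f\<^sub>Z x) \<ge> \<epsilon>}"

section \<open>Binning\<close>

text \<open>The bins are labelled by multi-indices in \<open>{0..<\<kappa>}\<^sup>d\<close> rather than by \<open>1..\<kappa>\<^sup>d\<close>. They are half-open,
  and closed on the faces of the cube where a coordinate equals 1, so that they partition the cube.\<close>

definition bin_indices :: "nat \<Rightarrow> (nat ^ 'd) set" where
  "bin_indices \<kappa> = {k. \<forall>i. k $ i < \<kappa>}"

definition bin :: "nat \<Rightarrow> nat ^ 'd \<Rightarrow> (real ^ 'd) set" where
  "bin \<kappa> k = {x\<in>unit_cube. \<forall>i. real (k $ i) / real \<kappa> \<le> x $ i \<and>
     (x $ i < real (k $ i + 1) / real \<kappa> \<or> k $ i + 1 = \<kappa>)}"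

definition bin_of :: "nat \<Rightarrow> real ^ 'd \<Rightarrow> nat ^ 'd" where
  "bin_of \<kappa> x = (THE k. k \<in> bin_indices \<kappa> \<and> x \<in> bin \<kappa> k)"

lemma bin_unique:
  assumes "k \<in> bin_indices \<kappa>" "l \<in> bin_indices \<kappa>" "x \<in> bin \<kappa> k" "x \<in> bin \<kappa> l"
  shows "k = l"
proof -
  have le: "a $ i \<le> b $ i"
    if "a \<in> bin_indices \<kappa>" "b \<in> bin_indices \<kappa>" "x \<in> bin \<kappa> a" "x \<in> bin \<kappa> b" for a b i
  proof (cases "b $ i + 1 = \<kappa>")
    case True
    have "a $ i < \<kappa>" using that(1) by (simp add: bin_indices_def)
    then show ?thesis using True by linarith
  next
    case False
    have "real (a $ i) / real \<kappa> \<le> x $ i" using that(3) by (simp add: bin_def)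
    also have "x $ i < real (b $ i + 1) / real \<kappa>" using that(4) False by (auto simp: bin_def)
    finally have "real (a $ i) < real (b $ i + 1)"
      by (simp add: divide_less_cancel)
    then show ?thesis by linarith
  qed
  show ?thesis unfolding vec_eq_iff using le assms by (meson order_antisym)
qed

lemma bin_cover:
  assumes "x \<in> unit_cube" "\<kappa> \<ge> 1"
  shows "\<exists>k\<in>bin_indices \<kappa>. x \<in> bin \<kappa> k"
proof -
  define k where "k = (\<chi> i. min (nat \<lfloor>real \<kappa> * x $ i\<rfloor>) (\<kappa> - 1))"
  have "real (k $ i) / real \<kappa> \<le> x $ i \<and> (x $ i < real (k $ i + 1) / real \<kappa> \<or> k $ i + 1 = \<kappa>)" for i
  proof
    have x: "0 \<le> x $ i" using assms(1) by (simp add: unit_cube_def)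
    have "real (k $ i) \<le> real (nat \<lfloor>real \<kappa> * x $ i\<rfloor>)" by (simp add: k_def)
    also have "\<dots> \<le> real \<kappa> * x $ i" using x by (simp add: of_nat_floor)
    finally show "real (k $ i) / real \<kappa> \<le> x $ i" using assms(2) by (simp add: field_simps)
    show "x $ i < real (k $ i + 1) / real \<kappa> \<or> k $ i + 1 = \<kappa>"
    proof (cases "nat \<lfloor>real \<kappa> * x $ i\<rfloor> \<le> \<kappa> - 1")
      case True
      then have "real (k $ i) = of_int \<lfloor>real \<kappa> * x $ i\<rfloor>" using x by (simp add: k_def)
      then have "real \<kappa> * x $ i < real (k $ i) + 1" by linarith
      then show ?thesis using assms(2) by (simp add: field_simps)
    next
      case False
      then show ?thesis using assms(2) by (simp add: k_def)
    qed
  qed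
  moreover have "k \<in> bin_indices \<kappa>" using assms(2) by (auto simp: k_def bin_indices_def)
  ultimately show ?thesis using assms(1) by (auto simp: bin_def)
qed

lemma bin_of_eq_iff:
  assumes "x \<in> unit_cube" "k \<in> bin_indices \<kappa>" "\<kappa> \<ge> 1"
  shows "bin_of \<kappa> x = k \<longleftrightarrow> x \<in> bin \<kappa> k"
proof -
  obtain l where l: "l \<in> bin_indices \<kappa>" "x \<in> bin \<kappa> l" using bin_cover assms by blast
  then have "bin_of \<kappa> x = l" unfolding bin_of_def by (intro the_equality) (auto intro: bin_unique)
  then show ?thesis using l assms(2) bin_unique by blast
qed

section \<open>The U-statistic and the permutation critical value\<close>

definition bin_kernel :: "nat \<Rightarrow> nat ^ 'd::finite \<Rightarrow> nat ^ 'd \<Rightarrow> real" where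
  "bin_kernel \<kappa> x y = (\<Sum>k\<in>bin_indices \<kappa>. of_bool (x = k) * of_bool (y = k))"

definition h_ts ::
  "nat \<Rightarrow> nat ^ 'd::finite \<Rightarrow> nat ^ 'd \<Rightarrow> nat ^ 'd \<Rightarrow> nat ^ 'd \<Rightarrow> real" where
  "h_ts \<kappa> y1 y2 z1 z2 =
     bin_kernel \<kappa> y1 y2 + bin_kernel \<kappa> z1 z2 - bin_kernel \<kappa> y1 z2 - bin_kernel \<kappa> y2 z1"

definition U_stat ::
  "nat \<Rightarrow> nat \<Rightarrow> nat \<Rightarrow> (nat \<Rightarrow> real ^ 'd::finite) \<Rightarrow> (nat \<Rightarrow> real ^ 'd) \<Rightarrow> real" where
  "U_stat \<kappa> n1 n2 Y Z =
     1 / (real n1 * (real n1 - 1) * real n2 * (real n2 - 1)) *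
     (\<Sum>(i1, i2)\<in>{(i1, i2). i1 \<in> {1..n1} \<and> i2 \<in> {1..n1} \<and> i1 \<noteq> i2}.
      \<Sum>(j1, j2)\<in>{(j1, j2). j1 \<in> {1..n2} \<and> j2 \<in> {1..n2} \<and> j1 \<noteq> j2}.
        h_ts \<kappa> (bin_of \<kappa> (Y i1)) (bin_of \<kappa> (Y i2)) (bin_of \<kappa> (Z j1)) (bin_of \<kappa> (Z j2)))"

text \<open>The pooled sample \<open>X\<close> is indexed by \<open>{1..n1 + n2}\<close>: \<open>X 1, \<dots>, X n1\<close> is the first sample and
  \<open>X (n1 + 1), \<dots>, X (n1 + n2)\<close> the second.\<close>

definition perm_stat :: "nat \<Rightarrow> nat \<Rightarrow> nat \<Rightarrow> (nat \<Rightarrow> real ^ 'd::finite) \<Rightarrow> (nat \<Rightarrow> nat) \<Rightarrow> real" where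
  "perm_stat \<kappa> n1 n2 X \<pi> = U_stat \<kappa> n1 n2 (\<lambda>i. X (\<pi> i)) (\<lambda>j. X (\<pi> (n1 + j)))"

definition test_stat :: "nat \<Rightarrow> nat \<Rightarrow> nat \<Rightarrow> (nat \<Rightarrow> real ^ 'd::finite) \<Rightarrow> real" where
  "test_stat \<kappa> n1 n2 X = U_stat \<kappa> n1 n2 X (\<lambda>j. X (n1 + j))"

definition crit_value :: "nat \<Rightarrow> nat \<Rightarrow> nat \<Rightarrow> real \<Rightarrow> (nat \<Rightarrow> real ^ 'd::finite) \<Rightarrow> real" where
  "crit_value \<kappa> n1 n2 \<alpha> X = Inf {t.
     1 / fact (n1 + n2) *
       (\<Sum>\<pi> | \<pi> permutes {1..n1 + n2}. of_bool (perm_stat \<kappa> n1 n2 X \<pi> \<le> t)) \<ge> 1 - \<alpha>}"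

definition sample_law ::
  "nat \<Rightarrow> nat \<Rightarrow> (real ^ 'd::finite) measure \<Rightarrow> (real ^ 'd) measure \<Rightarrow> (nat \<Rightarrow> real ^ 'd) measure" where
  "sample_law n1 n2 P\<^sub>Y P\<^sub>Z = PiM {1..n1 + n2} (\<lambda>i. if i \<le> n1 then P\<^sub>Y else P\<^sub>Z)"

definition bins_per_axis :: "nat \<Rightarrow> real \<Rightarrow> nat \<Rightarrow> nat" where
  "bins_per_axis d s n1 = nat \<lfloor>real n1 powr (2 / (4 * s + real d))\<rfloor>"

end

(*
The statistic is a quadratic form U = sum w(a,b) G(X_a, X_b) in the pooled sample, where G indicates
that two points share a bin and the weights w have vanishing row sums. Under the null hypothesis the
sample is exchangeable, so the permutation test has level alpha.

Given the sample, the row sums force the mixed moments of a randomly permuted form to be negative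
(one shared index) or of order n^-2 (no shared index), so the permutation average of U^2 is at most
four times sum w^2 times the average of G. Hence the critical value is at most
sqrt (const * max bin probability / (alpha n1^2)) on average, while U itself concentrates around
D = sum_k (p_k - q_k)^2 by the Hoeffding decomposition; Markov's inequality bounds the type II error
as soon as D is large.

It remains to bound D from below by h^d (|g|^2 / 2 - C h^(2s)) with g = f_Y - f_Z and h the side
length of the bins, that is, to show that the increments of g at distance at most h have L2 norm at
most a small multiple of |g| plus O(h^s). Taylor's formula gives this: there are weights a_j of
arbitrarily small total mass with p(t) - p(0) = sum_j a_j p(jt) for all polynomials p of degree at
most floor(s), so an increment of g is controlled by distant values of g with a small factor.
*)
theory Submission
  imports Defs "HOL-Computational_Algebra.Polynomial"
begin

text \<open>The obstacle is smoothness \<open>s > 1\<close>: averaging over a bin of side h loses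
  the gradient of g, an error of order h rather than h^s. The loss must therefore be charged to
  |g|^2 itself, and the mass of the weights has to beat 4^d, the price of passing from shifts along
  the axes to all pairs of points in a bin. As the weights look J steps ahead, at least 2 J bins per
  axis are required. With fewer bins, the constant C is so large that the alternative is empty,
  since the densities are bounded. This bound is not part of the class; it follows from bounded
  oscillation and mass one, and it also makes every bin probability O(h^d). Chebyshev's inequality
  for a random permutation puts alpha^(-1/2) into the requirement on D, hence alpha^(-1/4) into
  \<epsilon>, because D scales with the squared distance; beta^(-1/2) comes from Markov's inequality
  in the same way. With h of order n1^(-2/(4s+d)), the noise level h^(d/2) / n1 of U matches
  h^(d+2s), the size of D at separation h^s.\<close>

section \<open>Moments of a randomly permuted quadratic form\<close>

locale zero_sum_weights =
  fixes I :: "nat set" and w :: "nat \<Rightarrow> nat \<Rightarrow> real"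
  assumes fin: "finite I" and card_ge: "card I \<ge> 4"
    and w_sym: "\<And>a b. w a b = w b a"
    and w_diag: "\<And>a. w a a = 0"
    and w_row: "\<And>a. a \<in> I \<Longrightarrow> (\<Sum>b\<in>I. w a b) = 0"
begin

text \<open>Up to the factor \<open>fact (card I)\<close>, the mixed moment of two matrix entries
  under a uniformly random relabelling. Symmetry and the row sums reduce all of these moments to the
  single value \<open>H a b a b\<close>.\<close>

definition H :: "nat \<Rightarrow> nat \<Rightarrow> nat \<Rightarrow> nat \<Rightarrow> real" where
  "H a b c d = (\<Sum>\<pi> | \<pi> permutes I. w (\<pi> a) (\<pi> b) * w (\<pi> c) (\<pi> d))"

lemma H_invariant:
  assumes "\<sigma> permutes I"
  shows "H (\<sigma> a) (\<sigma> b) (\<sigma> c) (\<sigma> d) = H a b c d"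
proof -
  have "H a b c d = (\<Sum>\<pi> | \<pi> permutes I. w ((\<pi> \<circ> \<sigma>) a) ((\<pi> \<circ> \<sigma>) b) * w ((\<pi> \<circ> \<sigma>) c) ((\<pi> \<circ> \<sigma>) d))"
    unfolding H_def by (rule sum_permutations_compose_right[OF assms])
  then show ?thesis by (simp add: H_def)
qed

lemma H_diag: "H a b c c = 0"
  by (simp add: H_def w_diag)

lemma H_swap: "H a b d c = H a b c d" "H b a c d = H a b c d" "H c d a b = H a b c d"
  by (simp_all add: H_def w_sym mult.commute)

lemma H_square_nonneg: "H a b a b \<ge> 0"
  by (simp add: H_def sum_nonneg)

text \<open>Each permutation carries \<open>I\<close> onto itself, so the sum over \<open>d\<close>
  runs through a full row of \<open>w\<close>.\<close>

lemma H_row: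
  assumes "c \<in> I"
  shows "(\<Sum>d\<in>I. H a b c d) = 0"
proof -
  have "(\<Sum>d\<in>I. H a b c d) = (\<Sum>\<pi> | \<pi> permutes I. w (\<pi> a) (\<pi> b) * (\<Sum>d\<in>I. w (\<pi> c) (\<pi> d)))"
    unfolding H_def by (subst sum.swap) (simp add: sum_distrib_left)
  also have "\<dots> = 0"
  proof (rule sum.neutral, safe)
    fix \<pi> assume p: "\<pi> permutes I"
    have "(\<Sum>d\<in>I. w (\<pi> c) (\<pi> d)) = (\<Sum>d\<in>I. w (\<pi> c) d)"
      using sum.permute[OF p, of "w (\<pi> c)"] by (simp add: comp_def)
    also have "\<dots> = 0" using assms p by (simp add: w_row permutes_in_image)
    finally show "w (\<pi> a) (\<pi> b) * (\<Sum>d\<in>I. w (\<pi> c) (\<pi> d)) = 0" by simp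
  qed
  finally show ?thesis .
qed

text \<open>The transposition of \<open>d\<close> and \<open>d'\<close> fixes the other three
  indices.\<close>

lemma H_last:
  assumes "d \<in> I" "d' \<in> I" "d \<notin> {a, b, c}" "d' \<notin> {a, b, c}"
  shows "H a b c d = H a b c d'"
  using H_invariant[OF permutes_swap_id[OF assms(1,2)], of a b c d] assms(3,4)
  by (auto simp: Transposition.transpose_def)

lemma H_three:
  assumes "a \<in> I" "b \<in> I" "d \<in> I" "a \<noteq> b" "d \<noteq> a" "d \<noteq> b"
  shows "(real (card I) - 2) * H a b a d = - H a b a b"
proof -
  have "0 = (\<Sum>e\<in>I. H a b a e)" using H_row assms by simp
  also have "\<dots> = (\<Sum>e\<in>I - {a, b}. H a b a e) + (\<Sum>e\<in>{a, b}. H a b a e)"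
    using assms fin by (intro sum.subset_diff) auto
  also have "(\<Sum>e\<in>I - {a, b}. H a b a e) = (\<Sum>e\<in>I - {a, b}. H a b a d)"
    using assms by (intro sum.cong H_last) auto
  also have "\<dots> = (real (card I) - 2) * H a b a d"
    using assms fin card_ge by (simp add: card_Diff_subset)
  finally show ?thesis using assms(4) by (simp add: H_diag)
qed

text \<open>The same row sum argument, in which the terms at \<open>a\<close> and \<open>b\<close>
  are now moments with one shared index, known from \<open>H_three\<close>.\<close>

lemma H_four:
  assumes "a \<in> I" "b \<in> I" "c \<in> I" "d \<in> I" "distinct [a, b, c, d]"
  shows "(real (card I) - 2) * (real (card I) - 3) * H a b c d = 2 * H a b a b"
proof -
  have "0 = (\<Sum>e\<in>I. H a b c e)" using H_row assms by simp
  also have "\<dots> = (\<Sum>e\<in>I - {a, b, c}. H a b c e) + (\<Sum>e\<in>{a, b, c}. H a b c e)"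
    using assms fin by (intro sum.subset_diff) auto
  also have "(\<Sum>e\<in>I - {a, b, c}. H a b c e) = (\<Sum>e\<in>I - {a, b, c}. H a b c d)"
    using assms by (intro sum.cong H_last) auto
  also have "\<dots> = (real (card I) - 3) * H a b c d"
    using assms fin card_ge by (simp add: card_Diff_subset)
  finally have 1: "(real (card I) - 3) * H a b c d = - H a b a c - H a b b c"
    using assms(5) by (simp add: H_diag H_swap)
  have 2: "(real (card I) - 2) * H a b a c = - H a b a b"
    using H_three[of a b c] assms by auto
  have 3: "(real (card I) - 2) * H a b b c = - H a b a b"
    using H_three[of b a c] assms by (auto simp: H_swap)
  have "(real (card I) - 2) * ((real (card I) - 3) * H a b c d)
      = - ((real (card I) - 2) * H a b a c) - (real (card I) - 2) * H a b b c"
    unfolding 1 by (simp add: algebra_simps)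
  then show ?thesis using 2 3 by (simp add: mult.assoc)
qed

lemma sum_of_bool_point:
  assumes "finite A" "a \<in> A"
  shows "(\<Sum>c\<in>A. of_bool (c = a)) = (1::real)"
  using assms by (simp add: of_bool_def sum.delta)

lemma card_offdiag:
  assumes "finite A"
  shows "(\<Sum>c\<in>A. \<Sum>d\<in>A. of_bool (c \<noteq> d)) = real (card A) * (real (card A) - 1)"
proof -
  have "(\<Sum>d\<in>A. of_bool (c \<noteq> d)) = real (card A) - 1" if "c \<in> A" for c
  proof -
    have "(\<Sum>d\<in>A. of_bool (c \<noteq> d)) = (\<Sum>d\<in>A. (1::real)) - (\<Sum>d\<in>A. if d = c then 1 else 0)"
      unfolding sum_subtractf[symmetric] by (intro sum.cong) auto
    then show ?thesis using assms that by simp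
  qed
  then show ?thesis by simp
qed

text \<open>The symmetric group is transitive on ordered pairs of distinct points: one transposition
  brings \<open>a\<close> to \<open>a'\<close>, a second one, fixing \<open>a'\<close>, takes care
  of \<open>b'\<close>.\<close>

lemma H_pair_transitive:
  assumes "a \<in> I" "b \<in> I" "a \<noteq> b" "a' \<in> I" "b' \<in> I" "a' \<noteq> b'"
  shows "H a b a b = H a' b' a' b'"
proof -
  define \<tau> where "\<tau> = Transposition.transpose a a'"
  have t: "\<tau> permutes I" using assms by (simp add: \<tau>_def permutes_swap_id)
  have \<tau>b: "\<tau> b \<in> I" "\<tau> b \<noteq> a'"
    using assms by (auto simp: \<tau>_def Transposition.transpose_def)
  define \<sigma> where "\<sigma> = Transposition.transpose (\<tau> b) b'"
  have s: "\<sigma> permutes I" using assms \<tau>b by (simp add: \<sigma>_def permutes_swap_id)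
  have "H a b a b = H (\<sigma> (\<tau> a)) (\<sigma> (\<tau> b)) (\<sigma> (\<tau> a)) (\<sigma> (\<tau> b))"
    by (simp add: H_invariant s t)
  moreover have "\<tau> a = a'" by (simp add: \<tau>_def)
  moreover have "\<sigma> a' = a'" "\<sigma> (\<tau> b) = b'" using assms \<tau>b by (auto simp: \<sigma>_def Transposition.transpose_def)
  ultimately show ?thesis by simp
qed

text \<open>Double counting: the sum of \<open>H x y x y\<close> over all pairs has
  \<open>card I * (card I - 1)\<close> equal terms off the diagonal, while every single permutation
  just rearranges the full sum of squares.\<close>

lemma H_square_value:
  assumes "a \<in> I" "b \<in> I" "a \<noteq> b"
  shows "real (card I) * (real (card I) - 1) * H a b a b = fact (card I) * (\<Sum>x\<in>I. \<Sum>y\<in>I. (w x y)\<^sup>2)"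
proof -
  have "(\<Sum>x\<in>I. \<Sum>y\<in>I. H x y x y) = (\<Sum>x\<in>I. \<Sum>y\<in>I. of_bool (x \<noteq> y) * H a b a b)"
    using H_pair_transitive[OF _ _ _ assms] by (intro sum.cong) (auto simp: H_diag)
  also have "\<dots> = real (card I) * (real (card I) - 1) * H a b a b"
    unfolding sum_distrib_right[symmetric] card_offdiag[OF fin] ..
  finally have 1: "real (card I) * (real (card I) - 1) * H a b a b = (\<Sum>x\<in>I. \<Sum>y\<in>I. H x y x y)" ..
  have "(\<Sum>x\<in>I. \<Sum>y\<in>I. H x y x y)
      = (\<Sum>\<pi> | \<pi> permutes I. \<Sum>x\<in>I. \<Sum>y\<in>I. (w (\<pi> x) (\<pi> y))\<^sup>2)"
  proof -
    have "(\<Sum>x\<in>I. \<Sum>y\<in>I. H x y x y)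
        = (\<Sum>x\<in>I. \<Sum>\<pi> | \<pi> permutes I. \<Sum>y\<in>I. (w (\<pi> x) (\<pi> y))\<^sup>2)"
      unfolding H_def power2_eq_square by (intro sum.cong refl sum.swap)
    also have "\<dots> = (\<Sum>\<pi> | \<pi> permutes I. \<Sum>x\<in>I. \<Sum>y\<in>I. (w (\<pi> x) (\<pi> y))\<^sup>2)"
      by (rule sum.swap)
    finally show ?thesis .
  qed
  also have "\<dots> = (\<Sum>\<pi> | \<pi> permutes I. \<Sum>x\<in>I. \<Sum>y\<in>I. (w x y)\<^sup>2)"
  proof (rule sum.cong[OF refl], safe)
    fix \<pi> assume p: "\<pi> permutes I"
    have "(\<Sum>x\<in>I. \<Sum>y\<in>I. (w (\<pi> x) (\<pi> y))\<^sup>2) = (\<Sum>x\<in>I. \<Sum>y\<in>I. (w (\<pi> x) y)\<^sup>2)"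
      using sum.permute[OF p, of "\<lambda>y. (w (\<pi> _) y)\<^sup>2"] by (simp add: comp_def)
    also have "\<dots> = (\<Sum>x\<in>I. \<Sum>y\<in>I. (w x y)\<^sup>2)"
      using sum.permute[OF p, of "\<lambda>x. \<Sum>y\<in>I. (w x y)\<^sup>2"] by (simp add: comp_def)
    finally show "(\<Sum>x\<in>I. \<Sum>y\<in>I. (w (\<pi> x) (\<pi> y))\<^sup>2) = (\<Sum>x\<in>I. \<Sum>y\<in>I. (w x y)\<^sup>2)" .
  qed
  also have "\<dots> = fact (card I) * (\<Sum>x\<in>I. \<Sum>y\<in>I. (w x y)\<^sup>2)"
    using card_permutations[OF refl fin] by simp
  finally show ?thesis using 1 by simp
qed

text \<open>After expanding the square, fix the first pair \<open>(a, b)\<close> and let h be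
  \<open>H a b a b\<close>. The second pair contributes at most h for each of \<open>(a, b)\<close>
  and \<open>(b, a)\<close>, nothing positive if exactly one index is shared, and at most 2 h in
  total over all disjoint pairs. This is the factor 4.\<close>

lemma sum_permuted_squares_le:
  fixes G :: "nat \<Rightarrow> nat \<Rightarrow> real"
  assumes G0: "\<And>a b. 0 \<le> G a b" and G1: "\<And>a b. G a b \<le> 1"
  shows "real (card I) * (real (card I) - 1) *
      (\<Sum>\<pi> | \<pi> permutes I. (\<Sum>a\<in>I. \<Sum>b\<in>I. w (\<pi> a) (\<pi> b) * G a b)\<^sup>2)
    \<le> 4 * fact (card I) * (\<Sum>x\<in>I. \<Sum>y\<in>I. (w x y)\<^sup>2) * (\<Sum>a\<in>I. \<Sum>b\<in>I - {a}. G a b)"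
proof -
  define N where "N = real (card I)"
  have N: "N \<ge> 4" using card_ge by (simp add: N_def)
  have row: "(\<Sum>c\<in>I. \<Sum>d\<in>I. H a b c d * G c d) \<le> 4 * H a b a b"
    if ab: "a \<in> I" "b \<in> I" "a \<noteq> b" for a b
  proof -
    define h where "h = H a b a b"
    have h: "h \<ge> 0" by (simp add: h_def H_square_nonneg)
    \<comment> \<open>The common value of the moments with four distinct indices, by
      \<open>H_four\<close>.\<close>
    define u where "u = 2 * h / ((N - 2) * (N - 3))"
    have u: "u \<ge> 0" using h N by (simp add: u_def)
    \<comment> \<open>Coincidences are written with \<open>of_bool\<close> so that the double sum of
      the right-hand side factors and can be counted.\<close>
    have "H a b c d * G c d \<le> (of_bool (c = a) * of_bool (d = b) + of_bool (c = b) * of_bool (d = a)) * h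
        + of_bool (c \<in> I - {a, b}) * (of_bool (d \<in> I - {a, b}) * of_bool (c \<noteq> d)) * u"
      if cd: "c \<in> I" "d \<in> I" for c d
    proof -
      have neg: "H x y x z \<le> 0" if "x \<in> I" "y \<in> I" "z \<in> I" "x \<noteq> y" "z \<noteq> x" "z \<noteq> y" for x y z
      proof -
        have "(N - 2) * H x y x z \<le> 0" using H_three[OF that] H_square_nonneg[of x y] by (simp add: N_def)
        then show ?thesis using N by (simp add: mult_le_0_iff)
      qed
      consider "c = d" | "c = a" "d = b" | "c = b" "d = a" | "c \<noteq> d" "c \<notin> {a, b}" "d \<notin> {a, b}"
        | "c = a" "d \<noteq> a" "d \<noteq> b" | "c = b" "d \<noteq> a" "d \<noteq> b" | "d = a" "c \<noteq> a" "c \<noteq> b"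
        | "d = b" "c \<noteq> a" "c \<noteq> b"
        by blast
      then show ?thesis
      proof cases
        case 1 then show ?thesis using ab h by (auto simp: H_diag)
      next
        case 2 then show ?thesis using ab mult_left_mono[OF G1 h, of a b] by (auto simp: h_def)
      next
        case 3 then show ?thesis using ab mult_left_mono[OF G1 h, of b a] by (auto simp: h_def H_swap)
      next
        case 4
        then have "(N - 2) * (N - 3) * H a b c d = 2 * h"
          using H_four[of a b c d] ab cd by (auto simp: N_def h_def)
        then have "H a b c d = u" using N by (auto simp: u_def eq_divide_eq mult.commute)
        then show ?thesis using 4 cd mult_left_mono[OF G1 u, of c d] by auto
      next
        \<comment> \<open>In this and the remaining cases exactly one index is shared: the
          right-hand side is 0, the moment nonpositive and \<open>G\<close> nonnegative.\<close>
        case 5 then show ?thesis using ab cd neg[of a b d] G0 h u by (auto simp: mult_nonpos_nonneg)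
      next
        case 6 then show ?thesis using ab cd neg[of b a d] G0 h u by (auto simp: mult_nonpos_nonneg H_swap)
      next
        case 7 then show ?thesis using ab cd neg[of a b c] G0 h u by (auto simp: mult_nonpos_nonneg H_swap)
      next
        case 8 then show ?thesis using ab cd neg[of b a c] G0 h u by (auto simp: mult_nonpos_nonneg H_swap)
      qed
    qed
    then have "(\<Sum>c\<in>I. \<Sum>d\<in>I. H a b c d * G c d) \<le> (\<Sum>c\<in>I. \<Sum>d\<in>I.
        (of_bool (c = a) * of_bool (d = b) + of_bool (c = b) * of_bool (d = a)) * h
        + of_bool (c \<in> I - {a, b}) * (of_bool (d \<in> I - {a, b}) * of_bool (c \<noteq> d)) * u)"
      by (intro sum_mono) auto
    also have "\<dots> = (\<Sum>c\<in>I. \<Sum>d\<in>I. of_bool (c = a) * of_bool (d = b)) * h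
        + (\<Sum>c\<in>I. \<Sum>d\<in>I. of_bool (c = b) * of_bool (d = a)) * h
        + (\<Sum>c\<in>I. \<Sum>d\<in>I. of_bool (c \<in> I - {a, b}) * (of_bool (d \<in> I - {a, b}) * of_bool (c \<noteq> d))) * u"
      by (simp add: sum.distrib sum_distrib_right distrib_right)
    also have "(\<Sum>c\<in>I. \<Sum>d\<in>I. of_bool (c = a) * of_bool (d = b)) = (1::real)"
      unfolding sum_product[symmetric] using ab fin by (simp add: sum_of_bool_point)
    also have "(\<Sum>c\<in>I. \<Sum>d\<in>I. of_bool (c = b) * of_bool (d = a)) = (1::real)"
      unfolding sum_product[symmetric] using ab fin by (simp add: sum_of_bool_point)
    also have "(\<Sum>c\<in>I. \<Sum>d\<in>I. of_bool (c \<in> I - {a, b}) * (of_bool (d \<in> I - {a, b}) * of_bool (c \<noteq> d)))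
        = (\<Sum>c\<in>I - {a, b}. \<Sum>d\<in>I - {a, b}. of_bool (c \<noteq> d) :: real)"
    proof -
      have "(\<Sum>d\<in>I. of_bool (c \<in> I - {a, b}) * (of_bool (d \<in> I - {a, b}) * of_bool (c \<noteq> d)))
          = of_bool (c \<in> I - {a, b}) * (\<Sum>d\<in>I - {a, b}. of_bool (c \<noteq> d) :: real)" for c
        unfolding sum_distrib_left using fin by (intro sum.mono_neutral_cong_right) auto
      note inner = this
      show ?thesis
        unfolding inner using fin by (intro sum.mono_neutral_cong_right) (auto simp del: sum_of_bool_eq)
    qed
    also have "\<dots> = (N - 2) * (N - 3)"
      using ab fin card_ge by (subst card_offdiag) (auto simp: N_def card_Diff_subset)
    also have "1 * h + 1 * h + (N - 2) * (N - 3) * u = 4 * h" using N by (simp add: u_def)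
    finally show ?thesis by (simp add: h_def)
  qed
  have "(\<Sum>\<pi> | \<pi> permutes I. (\<Sum>a\<in>I. \<Sum>b\<in>I. w (\<pi> a) (\<pi> b) * G a b)\<^sup>2)
      = (\<Sum>\<pi> | \<pi> permutes I. \<Sum>a\<in>I. \<Sum>b\<in>I. \<Sum>c\<in>I. \<Sum>d\<in>I.
          G a b * (w (\<pi> a) (\<pi> b) * w (\<pi> c) (\<pi> d) * G c d))"
    unfolding power2_eq_square sum_distrib_right
    unfolding sum_distrib_left by (intro sum.cong refl) simp
  also have "\<dots> = (\<Sum>a\<in>I. \<Sum>\<pi> | \<pi> permutes I. \<Sum>b\<in>I. \<Sum>c\<in>I. \<Sum>d\<in>I.
          G a b * (w (\<pi> a) (\<pi> b) * w (\<pi> c) (\<pi> d) * G c d))"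
    by (rule sum.swap)
  also have "\<dots> = (\<Sum>a\<in>I. \<Sum>b\<in>I. \<Sum>\<pi> | \<pi> permutes I. \<Sum>c\<in>I. \<Sum>d\<in>I.
          G a b * (w (\<pi> a) (\<pi> b) * w (\<pi> c) (\<pi> d) * G c d))"
    by (intro sum.cong refl sum.swap)
  also have "\<dots> = (\<Sum>a\<in>I. \<Sum>b\<in>I. \<Sum>c\<in>I. \<Sum>\<pi> | \<pi> permutes I. \<Sum>d\<in>I.
          G a b * (w (\<pi> a) (\<pi> b) * w (\<pi> c) (\<pi> d) * G c d))"
    by (intro sum.cong refl sum.swap)
  also have "\<dots> = (\<Sum>a\<in>I. \<Sum>b\<in>I. \<Sum>c\<in>I. \<Sum>d\<in>I. \<Sum>\<pi> | \<pi> permutes I.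
          G a b * (w (\<pi> a) (\<pi> b) * w (\<pi> c) (\<pi> d) * G c d))"
    by (intro sum.cong refl sum.swap)
  also have "\<dots> = (\<Sum>a\<in>I. \<Sum>b\<in>I. G a b * (\<Sum>c\<in>I. \<Sum>d\<in>I. H a b c d * G c d))"
    by (simp add: H_def sum_distrib_left sum_distrib_right)
  also have "\<dots> \<le> (\<Sum>a\<in>I. \<Sum>b\<in>I. G a b * (4 * H a b a b))"
  proof (intro sum_mono)
    fix a b assume ab: "a \<in> I" "b \<in> I"
    show "G a b * (\<Sum>c\<in>I. \<Sum>d\<in>I. H a b c d * G c d) \<le> G a b * (4 * H a b a b)"
    proof (cases "a = b")
      case True
      then show ?thesis by (simp add: H_def w_diag)
    next
      case False
      then show ?thesis using row[OF ab] G0 by (intro mult_left_mono) auto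
    qed
  qed
  also have "\<dots> = (\<Sum>a\<in>I. \<Sum>b\<in>I - {a}. G a b * (4 * H a b a b))"
    using fin by (intro sum.cong refl sum.mono_neutral_right) (auto simp: H_diag)
  finally have "N * (N - 1) * (\<Sum>\<pi> | \<pi> permutes I. (\<Sum>a\<in>I. \<Sum>b\<in>I. w (\<pi> a) (\<pi> b) * G a b)\<^sup>2)
      \<le> N * (N - 1) * (\<Sum>a\<in>I. \<Sum>b\<in>I - {a}. G a b * (4 * H a b a b))"
    using N by (intro mult_left_mono) auto
  also have "\<dots> = (\<Sum>a\<in>I. \<Sum>b\<in>I - {a}. 4 * G a b * (N * (N - 1) * H a b a b))"
    by (simp add: sum_distrib_left mult_ac)
  also have "\<dots> = (\<Sum>a\<in>I. \<Sum>b\<in>I - {a}. 4 * G a b * (fact (card I) * (\<Sum>x\<in>I. \<Sum>y\<in>I. (w x y)\<^sup>2)))"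
    using H_square_value unfolding N_def by (intro sum.cong refl) auto
  also have "\<dots> = 4 * fact (card I) * (\<Sum>x\<in>I. \<Sum>y\<in>I. (w x y)\<^sup>2) * (\<Sum>a\<in>I. \<Sum>b\<in>I - {a}. G a b)"
    unfolding sum_distrib_right[symmetric] sum_distrib_left[symmetric] by (simp add: mult_ac)
  finally show ?thesis by (simp add: N_def)
qed

end

section \<open>The test statistic as a quadratic form\<close>

text \<open>Coefficients over ordered pairs. The statistic subtracts twice the mean over mixed
  pairs, and the two orders of a mixed pair share this equally.\<close>

definition pair_weight :: "nat \<Rightarrow> nat \<Rightarrow> nat \<Rightarrow> nat \<Rightarrow> real" where
  "pair_weight n1 n2 a b = (if a = b then 0
     else if a \<le> n1 \<and> b \<le> n1 then 1 / (real n1 * (real n1 - 1))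
     else if a > n1 \<and> b > n1 then 1 / (real n2 * (real n2 - 1))
     else - 1 / (real n1 * real n2))"

lemma sum_offdiag_pairs:
  "(\<Sum>(i, j)\<in>{(i, j). i \<in> {1..n::nat} \<and> j \<in> {1..n} \<and> i \<noteq> j}. F i j)
    = (\<Sum>i\<in>{1..n}. \<Sum>j\<in>{1..n}. of_bool (i \<noteq> j) * (F i j :: real))"
proof -
  have "(\<Sum>i\<in>{1..n}. \<Sum>j\<in>{1..n}. of_bool (i \<noteq> j) * F i j)
      = (\<Sum>(i, j)\<in>{1..n} \<times> {1..n}. of_bool (i \<noteq> j) * F i j)"
    by (rule sum.cartesian_product)
  also have "\<dots> = (\<Sum>(i, j)\<in>{(i, j). i \<in> {1..n} \<and> j \<in> {1..n} \<and> i \<noteq> j}. F i j)"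
    by (rule sum.mono_neutral_cong_right) auto
  finally show ?thesis ..
qed

lemma sum_of_bool_neq:
  assumes "i \<in> {1..n::nat}"
  shows "(\<Sum>j\<in>{1..n}. of_bool (i \<noteq> j)) = real n - 1" "(\<Sum>j\<in>{1..n}. of_bool (j \<noteq> i)) = real n - 1"
proof -
  have "(\<Sum>j\<in>{1..n}. of_bool (i \<noteq> j)) = (\<Sum>j\<in>{1..n}. (1::real)) - (\<Sum>j\<in>{1..n}. if j = i then 1 else 0)"
    unfolding sum_subtractf[symmetric] by (intro sum.cong) auto
  then show "(\<Sum>j\<in>{1..n}. of_bool (i \<noteq> j)) = real n - 1" using assms by simp
  moreover have "(\<Sum>j\<in>{1..n}. of_bool (j \<noteq> i)) = (\<Sum>j\<in>{1..n}. of_bool (i \<noteq> j) :: real)"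
    by (intro sum.cong) auto
  ultimately show "(\<Sum>j\<in>{1..n}. of_bool (j \<noteq> i)) = real n - 1" by (rule trans[rotated])
qed

lemma sum_offdiag_fst:
  "(\<Sum>i\<in>{1..n}. \<Sum>j\<in>{1..n}. of_bool (i \<noteq> j) * (\<phi> i :: real)) = (real n - 1) * (\<Sum>i\<in>{1..n}. \<phi> i)"
  unfolding sum_distrib_right[symmetric] sum_distrib_left
  by (intro sum.cong refl, subst sum_of_bool_neq) auto

lemma sum_offdiag_snd:
  "(\<Sum>i\<in>{1..n}. \<Sum>j\<in>{1..n}. of_bool (i \<noteq> j) * (\<phi> j :: real)) = (real n - 1) * (\<Sum>i\<in>{1..n}. \<phi> i)"
  unfolding sum.swap[of "\<lambda>i j. of_bool (i \<noteq> j) * \<phi> j"]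
  unfolding sum_distrib_right[symmetric] sum_distrib_left
  by (intro sum.cong refl, subst sum_of_bool_neq) auto

lemma sum_pooled:
  fixes f :: "nat \<Rightarrow> real"
  shows "(\<Sum>a\<in>{1..n1 + n2}. f a) = (\<Sum>i\<in>{1..n1}. f i) + (\<Sum>j\<in>{1..n2}. f (n1 + j))"
  using sum.ub_add_nat[where m = 1 and n = n1 and g = f and p = n2]
    sum.shift_bounds_cl_nat_ivl[where g = f and m = 1 and k = n1 and n = n2] by (simp add: add.commute)

lemma sum_two_samples:
  fixes F :: "nat \<Rightarrow> nat \<Rightarrow> real"
  shows "(\<Sum>a\<in>{1..n1 + n2}. \<Sum>b\<in>{1..n1 + n2}. F a b) =
     (\<Sum>i\<in>{1..n1}. \<Sum>j\<in>{1..n1}. F i j) + (\<Sum>i\<in>{1..n1}. \<Sum>j\<in>{1..n2}. F i (n1 + j))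
     + (\<Sum>i\<in>{1..n1}. \<Sum>j\<in>{1..n2}. F (n1 + j) i) + (\<Sum>i\<in>{1..n2}. \<Sum>j\<in>{1..n2}. F (n1 + i) (n1 + j))"
  unfolding sum_pooled sum.distrib
  by (subst sum.swap[where g = "\<lambda>i j. F (n1 + i) j"]) simp

text \<open>Each term of \<open>h_ts\<close> involves only two of the four summation indices; the
  others merely count and cancel part of the normalisation. Both cross terms yield the same mean
  over mixed pairs.\<close>

lemma test_stat_quadratic:
  assumes "2 \<le> n1" "2 \<le> n2"
  shows "test_stat \<kappa> n1 n2 X = (\<Sum>a\<in>{1..n1 + n2}. \<Sum>b\<in>{1..n1 + n2}.
    pair_weight n1 n2 a b * bin_kernel \<kappa> (bin_of \<kappa> (X a)) (bin_of \<kappa> (X b)))"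
proof -
  define g where "g a b = bin_kernel \<kappa> (bin_of \<kappa> (X a)) (bin_of \<kappa> (X b))" for a b
  have g_sym: "g a b = g b a" for a b by (simp add: g_def bin_kernel_def mult.commute)
  let ?A = "\<Sum>i\<in>{1..n1}. \<Sum>j\<in>{1..n1}. of_bool (i \<noteq> j) * g i j"
  let ?B = "\<Sum>i\<in>{1..n2}. \<Sum>j\<in>{1..n2}. of_bool (i \<noteq> j) * g (n1 + i) (n1 + j)"
  let ?C = "\<Sum>i\<in>{1..n1}. \<Sum>j\<in>{1..n2}. g i (n1 + j)"
  let ?m1 = "real n1 * (real n1 - 1)" and ?m2 = "real n2 * (real n2 - 1)"
  let ?o = "\<lambda>i j. of_bool (i \<noteq> j) :: real"
  have n: "real n1 \<ge> 2" "real n2 \<ge> 2" using assms by auto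
  have inner: "(\<Sum>(j1, j2)\<in>{(j1, j2). j1 \<in> {1..n2} \<and> j2 \<in> {1..n2} \<and> j1 \<noteq> j2}.
        h_ts \<kappa> (bin_of \<kappa> (X i1)) (bin_of \<kappa> (X i2)) (bin_of \<kappa> (X (n1 + j1))) (bin_of \<kappa> (X (n1 + j2))))
      = ?m2 * g i1 i2 + ?B - (real n2 - 1) * (\<Sum>j\<in>{1..n2}. g i1 (n1 + j)) - (real n2 - 1) * (\<Sum>j\<in>{1..n2}. g i2 (n1 + j))"
    (is "?L = _") for i1 i2
  proof -
    have "?L = (\<Sum>i\<in>{1..n2}. \<Sum>j\<in>{1..n2}. ?o i j * (g i1 i2 + g (n1 + i) (n1 + j) - g i1 (n1 + j) - g i2 (n1 + i)))"
      unfolding sum_offdiag_pairs h_ts_def g_def ..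
    also have "\<dots> = (\<Sum>i\<in>{1..n2}. \<Sum>j\<in>{1..n2}. ?o i j * g i1 i2) + ?B
        - (\<Sum>i\<in>{1..n2}. \<Sum>j\<in>{1..n2}. ?o i j * g i1 (n1 + j)) - (\<Sum>i\<in>{1..n2}. \<Sum>j\<in>{1..n2}. ?o i j * g i2 (n1 + i))"
      unfolding sum.distrib[symmetric] sum_subtractf[symmetric]
      by (intro sum.cong refl) (simp only: distrib_left right_diff_distrib)
    also have "(\<Sum>i\<in>{1..n2}. \<Sum>j\<in>{1..n2}. ?o i j * g i1 i2) = ?m2 * g i1 i2"
      unfolding sum_offdiag_fst by simp
    finally show ?thesis unfolding sum_offdiag_snd sum_offdiag_fst .
  qed
  have "test_stat \<kappa> n1 n2 X = 1 / (?m1 * real n2 * (real n2 - 1)) *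
      (\<Sum>i\<in>{1..n1}. \<Sum>j\<in>{1..n1}. ?o i j * (?m2 * g i j + ?B
        - (real n2 - 1) * (\<Sum>l\<in>{1..n2}. g i (n1 + l)) - (real n2 - 1) * (\<Sum>l\<in>{1..n2}. g j (n1 + l))))"
    unfolding test_stat_def U_stat_def inner sum_offdiag_pairs by (simp only: mult.assoc)
  also have "(\<Sum>i\<in>{1..n1}. \<Sum>j\<in>{1..n1}. ?o i j * (?m2 * g i j + ?B
        - (real n2 - 1) * (\<Sum>l\<in>{1..n2}. g i (n1 + l)) - (real n2 - 1) * (\<Sum>l\<in>{1..n2}. g j (n1 + l))))
      = (\<Sum>i\<in>{1..n1}. \<Sum>j\<in>{1..n1}. ?m2 * (?o i j * g i j)) + (\<Sum>i\<in>{1..n1}. \<Sum>j\<in>{1..n1}. ?o i j * ?B)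
        - (\<Sum>i\<in>{1..n1}. \<Sum>j\<in>{1..n1}. ?o i j * ((real n2 - 1) * (\<Sum>l\<in>{1..n2}. g i (n1 + l))))
        - (\<Sum>i\<in>{1..n1}. \<Sum>j\<in>{1..n1}. ?o i j * ((real n2 - 1) * (\<Sum>l\<in>{1..n2}. g j (n1 + l))))"
    unfolding sum.distrib[symmetric] sum_subtractf[symmetric]
    by (intro sum.cong refl) (simp only: distrib_left right_diff_distrib mult.left_commute)
  also have "\<dots> = ?m2 * ?A + ?m1 * ?B - 2 * (real n1 - 1) * (real n2 - 1) * ?C"
  proof -
    have B: "(\<Sum>i\<in>{1..n1}. ?B) = real n1 * ?B" unfolding sum_constant by simp
    have alg: "p * A + (x - 1) * (x * B) - (x - 1) * ((y - 1) * C) - (x - 1) * ((y - 1) * C)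
        = p * A + x * (x - 1) * B - 2 * (x - 1) * (y - 1) * C" for p x y A B C :: real
      by (simp add: algebra_simps)
    show ?thesis unfolding sum_offdiag_fst sum_offdiag_snd B sum_distrib_left[symmetric] by (rule alg)
  qed
  finally have 1: "test_stat \<kappa> n1 n2 X = 1 / (?m1 * real n2 * (real n2 - 1)) *
    (?m2 * ?A + ?m1 * ?B - 2 * (real n1 - 1) * (real n2 - 1) * ?C)" .
  have "(\<Sum>a\<in>{1..n1 + n2}. \<Sum>b\<in>{1..n1 + n2}. pair_weight n1 n2 a b * g a b)
      = (\<Sum>i\<in>{1..n1}. \<Sum>j\<in>{1..n1}. 1 / ?m1 * (?o i j * g i j))
        + (\<Sum>i\<in>{1..n1}. \<Sum>j\<in>{1..n2}. (- 1 / (real n1 * real n2)) * g i (n1 + j))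
        + (\<Sum>i\<in>{1..n1}. \<Sum>j\<in>{1..n2}. (- 1 / (real n1 * real n2)) * g i (n1 + j))
        + (\<Sum>i\<in>{1..n2}. \<Sum>j\<in>{1..n2}. 1 / ?m2 * (?o i j * g (n1 + i) (n1 + j)))"
  proof -
    have w11: "pair_weight n1 n2 i j * c = 1 / ?m1 * (?o i j * c)"
      if "i \<in> {1..n1}" "j \<in> {1..n1}" for i j c
      using that by (simp add: pair_weight_def)
    have w12: "pair_weight n1 n2 i (n1 + j) = - 1 / (real n1 * real n2)"
        "pair_weight n1 n2 (n1 + j) i * g (n1 + j) i = - 1 / (real n1 * real n2) * g i (n1 + j)"
      if "i \<in> {1..n1}" "j \<in> {1..n2}" for i j
      using that by (auto simp: pair_weight_def g_sym[of i])
    have w22: "pair_weight n1 n2 (n1 + i) (n1 + j) * c = 1 / ?m2 * (?o i j * c)"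
      if "i \<in> {1..n2}" "j \<in> {1..n2}" for i j c
      using that by (simp add: pair_weight_def)
    show ?thesis
      unfolding sum_two_samples
      by (intro arg_cong2[where f = "(+)"] sum.cong refl) (simp_all only: w11 w12 w22)
  qed
  also have "\<dots> = 1 / ?m1 * ?A + (- 1 / (real n1 * real n2)) * ?C + (- 1 / (real n1 * real n2)) * ?C + 1 / ?m2 * ?B"
    unfolding sum_distrib_left ..
  finally have 2: "(\<Sum>a\<in>{1..n1 + n2}. \<Sum>b\<in>{1..n1 + n2}. pair_weight n1 n2 a b * g a b) = \<dots>" .
  have alg: "1 / (x * (x - 1) * y * (y - 1)) * (y * (y - 1) * A + x * (x - 1) * B - 2 * (x - 1) * (y - 1) * C)
      = 1 / (x * (x - 1)) * A + (- 1 / (x * y)) * C + (- 1 / (x * y)) * C + 1 / (y * (y - 1)) * B"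
    if "x \<ge> 2" "y \<ge> 2" for x y A B C :: real
  proof -
    have "x \<noteq> 0" "y \<noteq> 0" "x - 1 \<noteq> 0" "y - 1 \<noteq> 0" using that by auto
    then show ?thesis by (simp add: divide_simps) (simp add: algebra_simps)
  qed
  show ?thesis unfolding 1 g_def[symmetric] 2 by (rule alg[OF n])
qed

text \<open>For a point of the first sample, the \<open>n1 - 1\<close> weights within the sample add
  up to \<open>1 / n1\<close> and the \<open>n2\<close> mixed weights to \<open>- 1 / n1\<close>;
  for the second sample the roles are exchanged.\<close>

lemma pair_weight_zero_sum:
  assumes "2 \<le> n1" "2 \<le> n2"
  shows "zero_sum_weights {1..n1 + n2} (pair_weight n1 n2)"
proof (unfold_locales)
  show "card {1..n1 + n2} \<ge> 4" using assms by simp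
  show "pair_weight n1 n2 a b = pair_weight n1 n2 b a" for a b by (auto simp: pair_weight_def)
  show "pair_weight n1 n2 a a = 0" for a by (simp add: pair_weight_def)
  fix a assume a: "a \<in> {1..n1 + n2}"
  show "(\<Sum>b\<in>{1..n1 + n2}. pair_weight n1 n2 a b) = 0"
  proof (cases "a \<le> n1")
    case True
    have "(\<Sum>b\<in>{1..n1 + n2}. pair_weight n1 n2 a b)
        = (\<Sum>j\<in>{1..n1}. of_bool (a \<noteq> j) * (1 / (real n1 * (real n1 - 1)))) + (\<Sum>j\<in>{1..n2}. - 1 / (real n1 * real n2))"
      unfolding sum_pooled using True by (intro arg_cong2[where f = "(+)"] sum.cong) (auto simp: pair_weight_def)
    also have "\<dots> = 0"
      unfolding sum_distrib_right[symmetric] using a True assms by (subst sum_of_bool_neq) auto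
    finally show ?thesis .
  next
    case False
    then have a': "a - n1 \<in> {1..n2}" using a by auto
    have "(\<Sum>b\<in>{1..n1 + n2}. pair_weight n1 n2 a b)
        = (\<Sum>j\<in>{1..n1}. - 1 / (real n1 * real n2)) + (\<Sum>j\<in>{1..n2}. of_bool (a - n1 \<noteq> j) * (1 / (real n2 * (real n2 - 1))))"
      unfolding sum_pooled using False by (intro arg_cong2[where f = "(+)"] sum.cong) (auto simp: pair_weight_def)
    also have "\<dots> = 0"
      unfolding sum_distrib_right[symmetric] using a' assms by (subst sum_of_bool_neq) auto
    finally show ?thesis .
  qed
qed simp

text \<open>In units of \<open>1 / (real n1)\<^sup>2\<close>, the two blocks within a sample
  contribute at most 2 each, because x - 1 >= x / 2 for x >= 2, and the two mixed blocks at most 1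
  each, because \<open>n1 \<le> n2\<close>.\<close>

lemma sum_pair_weight_square_le:
  assumes "2 \<le> n1" "n1 \<le> n2"
  shows "(\<Sum>a\<in>{1..n1 + n2}. \<Sum>b\<in>{1..n1 + n2}. (pair_weight n1 n2 a b)\<^sup>2) \<le> 6 / (real n1)\<^sup>2"
proof -
  have n: "real n1 \<ge> 2" "real n2 \<ge> real n1" using assms by auto
  let ?o = "\<lambda>i j. of_bool (i \<noteq> j) :: real"
  have "(\<Sum>a\<in>{1..n1 + n2}. \<Sum>b\<in>{1..n1 + n2}. (pair_weight n1 n2 a b)\<^sup>2)
      = (\<Sum>i\<in>{1..n1}. \<Sum>j\<in>{1..n1}. ?o i j * (1 / (real n1 * (real n1 - 1)))\<^sup>2)
        + (\<Sum>i\<in>{1..n1}. \<Sum>j\<in>{1..n2}. (1 / (real n1 * real n2))\<^sup>2)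
        + (\<Sum>i\<in>{1..n1}. \<Sum>j\<in>{1..n2}. (1 / (real n1 * real n2))\<^sup>2)
        + (\<Sum>i\<in>{1..n2}. \<Sum>j\<in>{1..n2}. ?o i j * (1 / (real n2 * (real n2 - 1)))\<^sup>2)"
    unfolding sum_two_samples
    by (intro arg_cong2[where f = "(+)"] sum.cong refl) (auto simp: pair_weight_def)
  also have "\<dots> = (real n1 - 1) * (real n1 * (1 / (real n1 * (real n1 - 1)))\<^sup>2)
      + 2 * (real n1 * real n2 * (1 / (real n1 * real n2))\<^sup>2)
      + (real n2 - 1) * (real n2 * (1 / (real n2 * (real n2 - 1)))\<^sup>2)"
    unfolding sum_offdiag_fst by simp
  also have "\<dots> = 1 / (real n1 * (real n1 - 1)) + 2 * (1 / (real n1 * real n2)) + 1 / (real n2 * (real n2 - 1))"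
    using n by (simp add: power2_eq_square)
  also have "\<dots> \<le> 2 / (real n1)\<^sup>2 + 2 * (1 / (real n1)\<^sup>2) + 2 / (real n1)\<^sup>2"
  proof -
    have key: "1 / (x * (x - 1)) \<le> 2 / x\<^sup>2" if "x \<ge> 2" for x :: real
      using that by (simp add: divide_simps power2_eq_square)
    have "1 / (real n1 * (real n1 - 1)) \<le> 2 / (real n1)\<^sup>2" using key n by simp
    moreover have "1 / (real n1 * real n2) \<le> 1 / (real n1)\<^sup>2"
      unfolding power2_eq_square using n by (intro frac_le mult_left_mono mult_pos_pos) simp_all
    moreover have "1 / (real n2 * (real n2 - 1)) \<le> 2 / (real n2)\<^sup>2" using key n by simp
    moreover have "2 / (real n2)\<^sup>2 \<le> 2 / (real n1)\<^sup>2"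
      using n by (intro frac_le power_mono zero_less_power) simp_all
    ultimately show ?thesis by linarith
  qed
  finally show ?thesis by simp
qed

section \<open>Empirical quantiles\<close>

text \<open>Separates the critical value from permutations and samples. \<open>K\<close> is a
  parameter of its own so that \<open>fact (n1 + n2)\<close> can stand for the number of
  permutations.\<close>

locale empirical_quantile =
  fixes A :: "'a set" and u :: "'a \<Rightarrow> real" and \<alpha> K :: real
  assumes fin_A: "finite A" and A_ne: "A \<noteq> {}" and alpha: "0 < \<alpha>" "\<alpha> < 1" and K: "K = real (card A)"
begin

definition T :: "real set" where
  "T = {t. 1 / K * (\<Sum>x\<in>A. of_bool (u x \<le> t)) \<ge> 1 - \<alpha>}"

lemma K_pos: "K > 0"
  using fin_A A_ne by (simp add: K card_gt_0_iff)

lemma T_bdd: "bdd_below T"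
proof (rule bdd_belowI)
  fix t assume t: "t \<in> T"
  have "\<exists>x\<in>A. u x \<le> t"
  proof (rule ccontr)
    assume "\<not> ?thesis"
    then have "(\<Sum>x\<in>A. of_bool (u x \<le> t)) = (0::real)" by (intro sum.neutral) auto
    then show False using t alpha by (simp add: T_def)
  qed
  then show "Min (u ` A) \<le> t" using fin_A by (meson Min_le finite_imageI imageI order_trans)
qed

lemma Inf_T_le: "t \<in> T \<Longrightarrow> Inf T \<le> t"
  by (rule cInf_lower[OF _ T_bdd])

text \<open>The empirical distribution function is a right-continuous step function: it does not
  change between the infimum and the next larger value of \<open>u\<close>.\<close>

lemma Inf_T_mem: "Inf T \<in> T"
proof -
  have "(\<Sum>x\<in>A. of_bool (u x \<le> Max (u ` A))) = (\<Sum>x\<in>A. 1::real)"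
    using fin_A by (intro sum.cong) auto
  then have "Max (u ` A) \<in> T" using K_pos alpha by (simp add: T_def flip: K)
  then have ne: "T \<noteq> {}" by blast
  define c where "c = Inf T"
  \<comment> \<open>The element \<open>c + 1\<close> keeps \<open>E\<close> nonempty when no value
    exceeds \<open>c\<close>.\<close>
  define E where "E = insert (c + 1) {v \<in> u ` A. v > c}"
  have fE: "finite E" "E \<noteq> {}" using fin_A by (auto simp: E_def)
  have "c < Min E" using fE by (simp add: Min_gr_iff E_def)
  then obtain t where t: "t \<in> T" "t < Min E" unfolding c_def using cInf_lessD[OF ne] by blast
  have ct: "c \<le> t" unfolding c_def by (rule Inf_T_le[OF t(1)])
  have "(\<Sum>x\<in>A. of_bool (u x \<le> t)) = (\<Sum>x\<in>A. of_bool (u x \<le> c) :: real)"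
  proof (intro sum.cong refl arg_cong[where f = of_bool] iffI)
    fix x assume x: "x \<in> A" "u x \<le> t"
    show "u x \<le> c"
    proof (rule ccontr)
      assume "\<not> u x \<le> c"
      then have "u x \<in> E" using x by (auto simp: E_def)
      then have "Min E \<le> u x" using fE by simp
      then show False using x t by linarith
    qed
  qed (use ct in auto)
  then have "c \<in> T" using t(1) by (simp add: T_def del: sum_of_bool_eq)
  then show ?thesis by (simp add: c_def)
qed

lemma sum_exceed_le: "(\<Sum>x\<in>A. of_bool (u x > Inf T)) \<le> \<alpha> * K"
proof -
  have "(\<Sum>x\<in>A. of_bool (u x > Inf T)) = (\<Sum>x\<in>A. 1 - of_bool (u x \<le> Inf T) :: real)"
    by (intro sum.cong) auto
  also have "\<dots> = K - (\<Sum>x\<in>A. of_bool (u x \<le> Inf T))"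
    unfolding sum_subtractf by (simp add: K)
  finally have "(\<Sum>x\<in>A. of_bool (u x > Inf T)) = K - (\<Sum>x\<in>A. of_bool (u x \<le> Inf T))" .
  moreover have "(1 - \<alpha>) * K \<le> (\<Sum>x\<in>A. of_bool (u x \<le> Inf T))"
    using Inf_T_mem K_pos by (simp add: T_def le_divide_eq del: sum_of_bool_eq)
  ultimately show ?thesis by (simp add: left_diff_distrib del: sum_of_bool_eq)
qed

text \<open>Chebyshev's inequality for the uniform distribution on \<open>A\<close>: at most a
  fraction \<alpha> of the values lies above the root of the mean square divided by
  \<alpha>.\<close>

lemma Inf_T_le_sqrt: "Inf T \<le> sqrt ((\<Sum>x\<in>A. (u x)\<^sup>2) / K / \<alpha>)"
proof (rule Inf_T_le)
  define V where "V = (\<Sum>x\<in>A. (u x)\<^sup>2) / K"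
  define t where "t = sqrt (V / \<alpha>)"
  have V0: "V \<ge> 0" using K_pos by (simp add: V_def sum_nonneg)
  have t0: "t \<ge> 0" "t\<^sup>2 = V / \<alpha>" using V0 alpha by (auto simp: t_def)
  have exceed: "(\<Sum>x\<in>A. of_bool (u x > t)) \<le> \<alpha> * K"
  proof (cases "V = 0")
    \<comment> \<open>Here \<open>t = 0\<close>, so its square cannot be cancelled; but then all
      values vanish and none exceeds \<open>t\<close>.\<close>
    case True
    then have "(\<Sum>x\<in>A. (u x)\<^sup>2) = 0" using K_pos by (simp add: V_def)
    then have "\<forall>x\<in>A. u x = 0" using fin_A by (simp add: sum_nonneg_eq_0_iff)
    then have "(\<Sum>x\<in>A. of_bool (u x > t)) = (0::real)" using t0 by (intro sum.neutral) auto
    then show ?thesis using alpha K_pos by (simp del: sum_of_bool_eq)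
  next
    case False
    have "t\<^sup>2 * (\<Sum>x\<in>A. of_bool (u x > t)) \<le> (\<Sum>x\<in>A. (u x)\<^sup>2)"
      unfolding sum_distrib_left using t0(1) by (intro sum_mono) (auto intro!: power_mono)
    also have "\<dots> = t\<^sup>2 * (\<alpha> * K)" using alpha K_pos by (simp add: t0(2) V_def)
    finally have le: "t\<^sup>2 * (\<Sum>x\<in>A. of_bool (u x > t)) \<le> t\<^sup>2 * (\<alpha> * K)" .
    have "t\<^sup>2 > 0" using False V0 alpha t0(2) by simp
    then show ?thesis by (rule mult_left_le_imp_le[OF le])
  qed
  have "(\<Sum>x\<in>A. of_bool (u x \<le> t)) = (\<Sum>x\<in>A. 1 - of_bool (u x > t) :: real)"
    by (intro sum.cong) auto
  also have "\<dots> = K - (\<Sum>x\<in>A. of_bool (u x > t))"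
    unfolding sum_subtractf by (simp add: K)
  finally have "(\<Sum>x\<in>A. of_bool (u x \<le> t)) \<ge> (1 - \<alpha>) * K" using exceed by (simp add: algebra_simps)
  then have "t \<in> T" using K_pos by (simp add: T_def field_simps del: sum_of_bool_eq)
  then show "sqrt ((\<Sum>x\<in>A. (u x)\<^sup>2) / K / \<alpha>) \<in> T" by (simp add: t_def V_def)
qed

end

section \<open>Second moments of binned quadratic forms\<close>

text \<open>The bound holds everywhere, so it survives composition with coordinate maps. Closure
  under arithmetic makes the integrability conditions of the moment computations automatic.\<close>

definition bounded_measurable :: "'a measure \<Rightarrow> ('a \<Rightarrow> real) \<Rightarrow> bool" where
  "bounded_measurable M f \<longleftrightarrow> f \<in> borel_measurable M \<and> (\<exists>B. \<forall>x. \<bar>f x\<bar> \<le> B)"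

named_theorems bm_intros

lemma bm_const [bm_intros]: "bounded_measurable M (\<lambda>_. c)"
  by (auto simp: bounded_measurable_def)

lemma bm_add [bm_intros]:
  assumes "bounded_measurable M f" "bounded_measurable M g"
  shows "bounded_measurable M (\<lambda>x. f x + g x)"
proof -
  obtain A B where "\<forall>x. \<bar>f x\<bar> \<le> A" "\<forall>x. \<bar>g x\<bar> \<le> B" using assms by (auto simp: bounded_measurable_def)
  then have "\<forall>x. \<bar>f x + g x\<bar> \<le> A + B" by (metis abs_triangle_ineq add_mono order_trans)
  then show ?thesis using assms by (auto simp: bounded_measurable_def)
qed

lemma bm_mult [bm_intros]:
  assumes "bounded_measurable M f" "bounded_measurable M g"
  shows "bounded_measurable M (\<lambda>x. f x * g x)"
proof -
  obtain A B where "\<forall>x. \<bar>f x\<bar> \<le> A" "\<forall>x. \<bar>g x\<bar> \<le> B" using assms by (auto simp: bounded_measurable_def)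
  then have "\<forall>x. \<bar>f x * g x\<bar> \<le> A * B"
    by (metis abs_ge_zero abs_mult mult_mono order_trans)
  then show ?thesis using assms by (auto simp: bounded_measurable_def)
qed

lemma bm_diff [bm_intros]:
  assumes "bounded_measurable M f" "bounded_measurable M g"
  shows "bounded_measurable M (\<lambda>x. f x - g x)"
  using bm_add[OF assms(1) bm_mult[OF bm_const[of M "-1"] assms(2)]] by simp

lemma bm_power2 [bm_intros]:
  "bounded_measurable M f \<Longrightarrow> bounded_measurable M (\<lambda>x. (f x)\<^sup>2)"
  unfolding power2_eq_square by (rule bm_mult)

lemma bm_sum [bm_intros]:
  assumes "\<And>i. i \<in> A \<Longrightarrow> bounded_measurable M (f i)"
  shows "bounded_measurable M (\<lambda>x. \<Sum>i\<in>A. f i x)"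
  using assms by (induction A rule: infinite_finite_induct) (auto intro: bm_intros)

lemma bm_if [bm_intros]:
  "bounded_measurable M f \<Longrightarrow> bounded_measurable M g \<Longrightarrow> bounded_measurable M (\<lambda>x. if b then f x else g x)"
  by (cases b) simp_all

lemma bm_measurable: "bounded_measurable M f \<Longrightarrow> f \<in> borel_measurable M"
  by (simp add: bounded_measurable_def)

lemma (in finite_measure) bm_integrable:
  assumes "bounded_measurable M f"
  shows "integrable M f"
proof -
  obtain B where "\<forall>x. \<bar>f x\<bar> \<le> B" using assms by (auto simp: bounded_measurable_def)
  then show ?thesis using assms by (intro integrable_const_bound[of _ B]) (auto simp: bounded_measurable_def)
qed

lemma bm_component [bm_intros]:
  assumes "a \<in> I" "bounded_measurable (M a) f"
  shows "bounded_measurable (PiM I M) (\<lambda>x. f (x a))"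
proof -
  have "(\<lambda>x. x a) \<in> measurable (PiM I M) (M a)" using assms(1) by (rule measurable_component_singleton)
  moreover have "f \<in> borel_measurable (M a)" using assms by (simp add: bounded_measurable_def)
  ultimately have "(\<lambda>x. f (x a)) \<in> borel_measurable (PiM I M)" by (rule measurable_compose)
  then show ?thesis using assms by (auto simp: bounded_measurable_def)
qed

text \<open>An abstract binning: \<open>\<phi> k\<close> is the indicator of bin \<open>k\<close>,
  and \<open>M a\<close> is the law of observation \<open>a\<close>. Points outside all bins are
  allowed, so the indicators sum to at most 1.\<close>

locale binned_sample = zero_sum_weights I w + product_prob_space M I
  for I :: "nat set" and w :: "nat \<Rightarrow> nat \<Rightarrow> real" and M :: "nat \<Rightarrow> 'a measure" +
  fixes K :: "'k set" and \<phi> :: "'k \<Rightarrow> 'a \<Rightarrow> real"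
  assumes fin_K: "finite K"
    and phi_measurable: "\<And>a k. \<phi> k \<in> borel_measurable (M a)"
    and phi_01: "\<And>k x. \<phi> k x = 0 \<or> \<phi> k x = 1"
    and phi_disjoint: "\<And>k l x. k \<noteq> l \<Longrightarrow> \<phi> k x * \<phi> l x = 0"
begin

abbreviation "P \<equiv> PiM I M"

text \<open>Vocabulary of the Hoeffding decomposition: \<open>\<xi>\<close> is a centred indicator,
  \<open>R\<close> the part of \<open>G\<close> that is degenerate in both arguments, and
  \<open>v a\<close> the weighted sum of bin probabilities seen from observation \<open>a\<close>.
  For distinct observations \<open>m a b\<close> is the probability of sharing a bin, and
  \<open>D\<close> is the mean of \<open>U\<close>.\<close>

definition G :: "'a \<Rightarrow> 'a \<Rightarrow> real" where "G x y = (\<Sum>k\<in>K. \<phi> k x * \<phi> k y)"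
definition \<mu> :: "nat \<Rightarrow> 'k \<Rightarrow> real" where "\<mu> a k = (\<integral>x. \<phi> k x \<partial>M a)"
definition \<xi> :: "nat \<Rightarrow> 'k \<Rightarrow> 'a \<Rightarrow> real" where "\<xi> a k y = \<phi> k y - \<mu> a k"
definition R :: "nat \<Rightarrow> nat \<Rightarrow> (nat \<Rightarrow> 'a) \<Rightarrow> real" where
  "R a b x = (\<Sum>k\<in>K. \<xi> a k (x a) * \<xi> b k (x b))"
definition v :: "nat \<Rightarrow> 'k \<Rightarrow> real" where "v a k = (\<Sum>b\<in>I. w a b * \<mu> b k)"
definition U :: "(nat \<Rightarrow> 'a) \<Rightarrow> real" where "U x = (\<Sum>a\<in>I. \<Sum>b\<in>I. w a b * G (x a) (x b))"
definition D :: real where "D = (\<Sum>a\<in>I. \<Sum>k\<in>K. \<mu> a k * v a k)"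
definition m :: "nat \<Rightarrow> nat \<Rightarrow> real" where "m a b = (\<Sum>k\<in>K. \<mu> a k * \<mu> b k)"

lemma phi_bounds: "0 \<le> \<phi> k x" "\<phi> k x \<le> 1" "\<phi> k x * \<phi> k x = \<phi> k x"
  using phi_01[of k x] by auto

lemma phi_bm [bm_intros]: "bounded_measurable (M a) (\<phi> k)"
  using phi_measurable[of k a] phi_bounds[of k] by (auto simp: bounded_measurable_def intro!: exI[of _ 1])

lemma xi_bm [bm_intros]: "bounded_measurable (M a) (\<xi> b k)"
  unfolding \<xi>_def by (intro bm_intros)

lemma phi_product: "\<phi> k x * \<phi> l x = (if k = l then \<phi> k x else 0)"
  using phi_disjoint phi_bounds by auto

lemma sum_phi_square:
  "(\<Sum>k\<in>K. c k * \<phi> k x)\<^sup>2 = (\<Sum>k\<in>K. (c k)\<^sup>2 * \<phi> k x)"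
proof -
  have "(\<Sum>k\<in>K. c k * \<phi> k x)\<^sup>2 = (\<Sum>k\<in>K. \<Sum>l\<in>K. (c k * c l) * (\<phi> k x * \<phi> l x))"
    unfolding power2_eq_square sum_product by (intro sum.cong refl) simp
  also have "\<dots> = (\<Sum>k\<in>K. (c k)\<^sup>2 * \<phi> k x)"
    unfolding phi_product using fin_K
    by (intro sum.cong refl) (simp add: if_distrib[where f = "\<lambda>y. _ * y"] power2_eq_square cong: if_cong)
  finally show ?thesis .
qed

text \<open>The sum equals its own square, hence is 0 or 1.\<close>

lemma sum_phi_le: "(\<Sum>k\<in>K. \<phi> k x) \<le> 1"
proof -
  define s where "s = (\<Sum>k\<in>K. \<phi> k x)"
  have "s\<^sup>2 = s" using sum_phi_square[of "\<lambda>_. 1" x] by (simp add: s_def)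
  then show ?thesis unfolding s_def[symmetric] by (auto simp: power2_eq_square)
qed

lemma G_bounds: "0 \<le> G x y" "G x y \<le> 1"
proof -
  show "0 \<le> G x y" unfolding G_def by (intro sum_nonneg mult_nonneg_nonneg phi_bounds)
  have "G x y \<le> (\<Sum>k\<in>K. \<phi> k x * 1)"
    unfolding G_def by (intro sum_mono mult_left_mono phi_bounds)
  then show "G x y \<le> 1" using sum_phi_le[of x] by simp
qed

lemma int_M: "bounded_measurable (M a) f \<Longrightarrow> integrable (M a) f"
  by (rule finite_measure.bm_integrable[OF prob_space.finite_measure[OF prob_space]])

lemma int_P: "bounded_measurable P f \<Longrightarrow> integrable P f"
  by (rule finite_measure.bm_integrable[OF prob_space.finite_measure[OF prob_space_PiM[OF prob_space]]])

lemma prob_M [simp]: "measure (M a) (space (M a)) = 1"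
  by (rule prob_space.prob_space[OF prob_space])

lemma integral_sum_P:
  assumes "\<And>i. bounded_measurable P (f i)"
  shows "(\<integral>x. (\<Sum>i\<in>A. f i x) \<partial>P) = (\<Sum>i\<in>A. \<integral>x. f i x \<partial>P)"
  by (intro Bochner_Integration.integral_sum int_P assms)

lemma mu_bounds: "0 \<le> \<mu> a k" "\<mu> a k \<le> 1"
proof -
  show "0 \<le> \<mu> a k" unfolding \<mu>_def by (intro Bochner_Integration.integral_nonneg phi_bounds)
  have "\<mu> a k \<le> (\<integral>x. 1 \<partial>M a)"
    unfolding \<mu>_def by (intro integral_mono int_M bm_intros phi_bounds)
  then show "\<mu> a k \<le> 1" by simp
qed

lemma sum_mu_le: "(\<Sum>k\<in>K. \<mu> a k) \<le> 1"
proof -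
  have "(\<Sum>k\<in>K. \<mu> a k) = (\<integral>x. (\<Sum>k\<in>K. \<phi> k x) \<partial>M a)"
    unfolding \<mu>_def by (intro Bochner_Integration.integral_sum[symmetric] int_M bm_intros)
  also have "\<dots> \<le> (\<integral>x. 1 \<partial>M a)"
    by (intro integral_mono int_M bm_intros sum_phi_le)
  finally show ?thesis by simp
qed

lemma xi_mean: "(\<integral>x. \<xi> a k x \<partial>M a) = 0"
  unfolding \<xi>_def by (subst Bochner_Integration.integral_diff) (auto intro!: int_M bm_intros simp: \<mu>_def)

text \<open>One formula covers all patterns of coincident indices: an \<open>if\<close> attaches
  each factor to its coordinate, and independence factors the product over \<open>I\<close>.
  Constant functions 1 give the cases with fewer factors.\<close>

lemma expectation_four:
  assumes I: "a \<in> I" "b \<in> I" "c \<in> I" "d \<in> I"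
    and bm: "\<And>i. bounded_measurable (M i) f1" "\<And>i. bounded_measurable (M i) f2"
      "\<And>i. bounded_measurable (M i) f3" "\<And>i. bounded_measurable (M i) f4"
  shows "(\<integral>x. f1 (x a) * f2 (x b) * (f3 (x c) * f4 (x d)) \<partial>P)
    = (\<Prod>i\<in>I. \<integral>y. (if i = a then f1 y else 1) * (if i = b then f2 y else 1)
        * ((if i = c then f3 y else 1) * (if i = d then f4 y else 1)) \<partial>M i)"
proof -
  have "f1 (x a) * f2 (x b) * (f3 (x c) * f4 (x d))
      = (\<Prod>i\<in>I. (if i = a then f1 (x i) else 1) * (if i = b then f2 (x i) else 1)
        * ((if i = c then f3 (x i) else 1) * (if i = d then f4 (x i) else 1)))" for x
    unfolding prod.distrib using I fin by simp
  then show ?thesis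
    by (simp only:) (intro product_integral_prod fin int_M bm_intros bm)
qed

text \<open>The coordinate \<open>a\<close> occurs in \<open>f1\<close> only, so its factor in the
  product is the mean 0.\<close>

lemma expectation_four_zero:
  assumes I: "a \<in> I" "b \<in> I" "c \<in> I" "d \<in> I" and "a \<notin> {b, c, d}"
    and bm: "\<And>i. bounded_measurable (M i) f1" "\<And>i. bounded_measurable (M i) f2"
      "\<And>i. bounded_measurable (M i) f3" "\<And>i. bounded_measurable (M i) f4"
    and mean: "(\<integral>y. f1 y \<partial>M a) = 0"
  shows "(\<integral>x. f1 (x a) * f2 (x b) * (f3 (x c) * f4 (x d)) \<partial>P) = 0"
  unfolding expectation_four[OF I bm]
  by (rule prod_zero[OF fin], rule bexI[of _ a]) (use assms in auto)

lemma expectation_pair: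
  assumes I: "a \<in> I" "b \<in> I" and "a \<noteq> b"
    and bm: "\<And>i. bounded_measurable (M i) f1" "\<And>i. bounded_measurable (M i) f2"
      "\<And>i. bounded_measurable (M i) f3" "\<And>i. bounded_measurable (M i) f4"
  shows "(\<integral>x. f1 (x a) * f2 (x b) * (f3 (x a) * f4 (x b)) \<partial>P)
    = (\<integral>y. f1 y * f3 y \<partial>M a) * (\<integral>y. f2 y * f4 y \<partial>M b)"
proof -
  have "(\<integral>x. f1 (x a) * f2 (x b) * (f3 (x a) * f4 (x b)) \<partial>P)
      = (\<Prod>i\<in>I. (if i = a then \<integral>y. f1 y * f3 y \<partial>M i else 1) * (if i = b then \<integral>y. f2 y * f4 y \<partial>M i else 1))"
    unfolding expectation_four[OF I I bm] using assms(3) by (intro prod.cong refl) auto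
  also have "\<dots> = (\<integral>y. f1 y * f3 y \<partial>M a) * (\<integral>y. f2 y * f4 y \<partial>M b)"
    unfolding prod.distrib using I fin by simp
  finally show ?thesis .
qed

lemma expectation_single:
  assumes "a \<in> I" and bm: "\<And>i. bounded_measurable (M i) f"
  shows "(\<integral>x. f (x a) \<partial>P) = (\<integral>y. f y \<partial>M a)"
proof -
  have "(\<integral>x. f (x a) * 1 * (1 * 1) \<partial>P) = (\<Prod>i\<in>I. if i = a then \<integral>y. f y \<partial>M i else 1)"
    by (subst expectation_four[where b = a and c = a and d = a])
      (use assms in \<open>auto intro!: bm_intros prod.cong\<close>)
  then show ?thesis using assms fin by simp
qed

lemma expectation_two_zero:
  assumes "a \<in> I" "b \<in> I" "a \<noteq> b"
    and bm: "\<And>i. bounded_measurable (M i) f" "\<And>i. bounded_measurable (M i) g"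
    and mean: "(\<integral>y. f y \<partial>M a) = 0"
  shows "(\<integral>x. f (x a) * g (x b) \<partial>P) = 0"
  using expectation_four_zero[of a b b b f g "\<lambda>_. 1" "\<lambda>_. 1"] assms by (simp add: bm_const)

lemma m_bounds: "0 \<le> m a b" "m a b \<le> 1"
proof -
  show "0 \<le> m a b" unfolding m_def by (intro sum_nonneg mult_nonneg_nonneg mu_bounds)
  have "m a b \<le> (\<Sum>k\<in>K. \<mu> a k * 1)"
    unfolding m_def by (intro sum_mono mult_left_mono mu_bounds)
  then show "m a b \<le> 1" using sum_mu_le[of a] by simp
qed

lemma expectation_G:
  assumes "a \<in> I" "b \<in> I" "a \<noteq> b"
  shows "(\<integral>x. G (x a) (x b) \<partial>P) = m a b"
proof -
  have "(\<integral>x. G (x a) (x b) \<partial>P) = (\<Sum>k\<in>K. \<integral>x. \<phi> k (x a) * \<phi> k (x b) \<partial>P)"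
    unfolding G_def using assms by (intro Bochner_Integration.integral_sum int_P bm_intros)
  also have "\<dots> = (\<Sum>k\<in>K. \<mu> a k * \<mu> b k)"
  proof (rule sum.cong[OF refl])
    fix k
    show "(\<integral>x. \<phi> k (x a) * \<phi> k (x b) \<partial>P) = \<mu> a k * \<mu> b k"
      using expectation_pair[OF assms, of "\<phi> k" "\<phi> k" "\<lambda>_. 1" "\<lambda>_. 1"] by (simp add: \<mu>_def bm_intros)
  qed
  finally show ?thesis by (simp add: m_def)
qed

text \<open>A single observation is a multinomial trial: different bins exclude each other, which
  leaves only the product of the means off the diagonal.\<close>

lemma covariance:
  "(\<integral>y. \<xi> a k y * \<xi> a l y \<partial>M a) = (if k = l then \<mu> a k else 0) - \<mu> a k * \<mu> a l"
proof -
  have "\<xi> a k y * \<xi> a l y = (if k = l then 1 else 0) * \<phi> k y - \<mu> a l * \<phi> k y - \<mu> a k * \<phi> l y + \<mu> a k * \<mu> a l" for y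
    using phi_product[of k y l] by (simp add: \<xi>_def algebra_simps)
  then have "(\<integral>y. \<xi> a k y * \<xi> a l y \<partial>M a)
      = (\<integral>y. (if k = l then 1 else 0) * \<phi> k y - \<mu> a l * \<phi> k y - \<mu> a k * \<phi> l y + \<mu> a k * \<mu> a l \<partial>M a)" by simp
  also have "\<dots> = (if k = l then 1 else 0) * \<mu> a k - \<mu> a l * \<mu> a k - \<mu> a k * \<mu> a l + \<mu> a k * \<mu> a l"
    by (subst Bochner_Integration.integral_add, (intro int_M bm_intros)+,
        subst Bochner_Integration.integral_diff, (intro int_M bm_intros)+,
        subst Bochner_Integration.integral_diff, (intro int_M bm_intros)+) (simp add: \<mu>_def)
  finally show ?thesis by simp
qed

lemma R_commute: "R a b x = R b a x"
  by (simp add: R_def mult.commute)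

lemma R_bm [bm_intros]: "a \<in> I \<Longrightarrow> b \<in> I \<Longrightarrow> bounded_measurable P (R a b)"
  unfolding R_def by (intro bm_intros)

lemma expectation_R_R:
  assumes "a \<in> I" "b \<in> I" "c \<in> I" "d \<in> I"
  shows "(\<integral>x. R a b x * R c d x \<partial>P)
    = (\<Sum>k\<in>K. \<Sum>l\<in>K. \<integral>x. \<xi> a k (x a) * \<xi> b k (x b) * (\<xi> c l (x c) * \<xi> d l (x d)) \<partial>P)"
proof -
  have "(\<integral>x. R a b x * R c d x \<partial>P)
      = (\<Sum>k\<in>K. \<integral>x. (\<Sum>l\<in>K. \<xi> a k (x a) * \<xi> b k (x b) * (\<xi> c l (x c) * \<xi> d l (x d))) \<partial>P)"
    unfolding R_def sum_product by (rule integral_sum_P) (intro bm_intros assms)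
  then show ?thesis
    by (simp only:) (intro sum.cong refl integral_sum_P bm_intros assms)
qed

text \<open>Since the unordered pairs differ, \<open>a\<close> or \<open>b\<close> occurs only once
  among the four indices, and its centred factor integrates to 0.\<close>

lemma expectation_R_R_zero:
  assumes I: "a \<in> I" "b \<in> I" "c \<in> I" "d \<in> I" and "a \<noteq> b" "c \<noteq> d"
    and "\<not> (c = a \<and> d = b)" "\<not> (c = b \<and> d = a)"
  shows "(\<integral>x. R a b x * R c d x \<partial>P) = 0"
proof -
  have *: "(\<integral>x. R a b x * R c d x \<partial>P) = 0"
    if "a \<in> I" "b \<in> I" "c \<in> I" "d \<in> I" "a \<notin> {b, c, d}" for a b c d
    unfolding expectation_R_R[OF that(1-4)]
    using that by (intro sum.neutral ballI expectation_four_zero bm_intros xi_mean) auto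
  consider "a \<notin> {b, c, d}" | "b \<notin> {a, c, d}" using assms by auto
  then show ?thesis
  proof cases
    case 1 then show ?thesis using * I by blast
  next
    case 2
    have "(\<integral>x. R a b x * R c d x \<partial>P) = (\<integral>x. R b a x * R c d x \<partial>P)" by (simp only: R_commute[of a b])
    then show ?thesis using * I 2 by simp
  qed
qed

lemma expectation_R_square_le:
  assumes "a \<in> I" "b \<in> I" "a \<noteq> b"
  shows "(\<integral>x. R a b x * R a b x \<partial>P) \<le> 2 * m a b"
proof -
  let ?C = "\<lambda>a k l. (if k = l then \<mu> a k else 0) - \<mu> a k * \<mu> a l"
  have "(\<integral>x. R a b x * R a b x \<partial>P) = (\<Sum>k\<in>K. \<Sum>l\<in>K. ?C a k l * ?C b k l)"
    unfolding expectation_R_R[OF assms(1,2,1,2)]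
    by (intro sum.cong refl, subst expectation_pair[OF assms]) (auto intro!: bm_intros simp: covariance)
  \<comment> \<open>On the diagonal a variance is at most the bin probability; off the diagonal both
    covariances are nonpositive and their product is exactly the second term.\<close>
  also have "\<dots> \<le> (\<Sum>k\<in>K. \<Sum>l\<in>K. (if k = l then \<mu> a k * \<mu> b k else 0) + (\<mu> a k * \<mu> b k) * (\<mu> a l * \<mu> b l))"
  proof (intro sum_mono)
    fix k l
    show "?C a k l * ?C b k l \<le> (if k = l then \<mu> a k * \<mu> b k else 0) + (\<mu> a k * \<mu> b k) * (\<mu> a l * \<mu> b l)"
    proof (cases "k = l")
      case True
      have "?C a k k \<le> \<mu> a k" "0 \<le> ?C b k k" "?C b k k \<le> \<mu> b k"
        using mu_bounds[of a k] mu_bounds[of b k] mult_left_le[of "\<mu> b k" "\<mu> b k"] by auto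
      then have 1: "?C a k k * ?C b k k \<le> \<mu> a k * \<mu> b k" using mu_bounds[of a k] by (intro mult_mono) auto
      have 2: "0 \<le> (\<mu> a k * \<mu> b k) * (\<mu> a k * \<mu> b k)" by simp
      from add_mono[OF 1 2] True show ?thesis by simp
    qed (simp add: mult_ac)
  qed
  also have "\<dots> = m a b + m a b * m a b"
    unfolding sum.distrib m_def sum_product[symmetric] using fin_K by simp
  also have "\<dots> \<le> 2 * m a b" using mult_left_le[OF m_bounds(2) m_bounds(1), of a b a b] by simp
  finally show ?thesis .
qed

text \<open>Orthogonality leaves for each \<open>(a, b)\<close> only the pair itself and
  \<open>(b, a)\<close>; with second moments at most \<open>2 * Mx\<close> this gives the factor
  4.\<close>

lemma quadratic_part_le:
  assumes Mx: "\<And>a b. m a b \<le> Mx"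
  shows "(\<integral>x. (\<Sum>a\<in>I. \<Sum>b\<in>I. w a b * R a b x)\<^sup>2 \<partial>P) \<le> 4 * (\<Sum>a\<in>I. \<Sum>b\<in>I. (w a b)\<^sup>2) * Mx"
proof -
  let ?e = "\<lambda>a b c d. \<integral>x. R a b x * R c d x \<partial>P"
  have sq: "(\<Sum>a\<in>I. \<Sum>b\<in>I. w a b * R a b x)\<^sup>2
      = (\<Sum>a\<in>I. \<Sum>b\<in>I. \<Sum>c\<in>I. \<Sum>d\<in>I. w a b * w c d * (R a b x * R c d x))" for x
    unfolding power2_eq_square sum_distrib_right unfolding sum_distrib_left by (intro sum.cong refl) simp
  have "(\<integral>x. (\<Sum>a\<in>I. \<Sum>b\<in>I. w a b * R a b x)\<^sup>2 \<partial>P)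
      = (\<Sum>a\<in>I. \<Sum>b\<in>I. \<Sum>c\<in>I. \<Sum>d\<in>I. w a b * w c d * ?e a b c d)"
    unfolding sq
    by (subst Bochner_Integration.integral_sum, (intro int_P bm_intros; assumption)?, intro sum.cong refl)+ simp
  also have "\<dots> \<le> (\<Sum>a\<in>I. \<Sum>b\<in>I. 4 * (w a b)\<^sup>2 * Mx)"
  proof (intro sum_mono)
    fix a b assume ab: "a \<in> I" "b \<in> I"
    show "(\<Sum>c\<in>I. \<Sum>d\<in>I. w a b * w c d * ?e a b c d) \<le> 4 * (w a b)\<^sup>2 * Mx"
    proof (cases "a = b")
      case True then show ?thesis by (simp add: w_diag)
    next
      case False
      have ba: "?e a b b a = ?e a b a b" by (simp only: R_commute[of b a])
      have "(\<Sum>c\<in>I. \<Sum>d\<in>I. w a b * w c d * ?e a b c d) = (\<Sum>c\<in>I. \<Sum>d\<in>I.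
          (of_bool (c = a) * of_bool (d = b) + of_bool (c = b) * of_bool (d = a)) * ((w a b)\<^sup>2 * ?e a b a b))"
      proof (intro sum.cong refl)
        fix c d assume cd: "c \<in> I" "d \<in> I"
        show "w a b * w c d * ?e a b c d
          = (of_bool (c = a) * of_bool (d = b) + of_bool (c = b) * of_bool (d = a)) * ((w a b)\<^sup>2 * ?e a b a b)"
          using expectation_R_R_zero[OF ab cd False] False ba w_sym[of b a]
          by (cases "c = d"; cases "c = a \<and> d = b"; cases "c = b \<and> d = a")
            (auto simp: w_diag power2_eq_square)
      qed
      also have "\<dots> = 2 * ((w a b)\<^sup>2 * ?e a b a b)"
        unfolding sum_distrib_right[symmetric] sum.distrib sum_product[symmetric]
        using ab fin by (simp add: sum_of_bool_point)
      also have "\<dots> \<le> 2 * ((w a b)\<^sup>2 * (2 * Mx))"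
        using expectation_R_square_le[OF ab False] Mx[of a b]
        by (intro mult_left_mono) auto
      finally show ?thesis by simp
    qed
  qed
  also have "\<dots> = 4 * (\<Sum>a\<in>I. \<Sum>b\<in>I. (w a b)\<^sup>2) * Mx"
    by (simp add: sum_distrib_left sum_distrib_right)
  finally show ?thesis .
qed

text \<open>Half of the first-order Hoeffding projection at observation \<open>a\<close>; the other
  half is equal to it by symmetry of \<open>w\<close>.\<close>

definition \<zeta> :: "nat \<Rightarrow> 'a \<Rightarrow> real" where "\<zeta> a y = (\<Sum>k\<in>K. v a k * \<xi> a k y)"

lemma zeta_bm [bm_intros]: "bounded_measurable (M b) (\<zeta> a)"
  unfolding \<zeta>_def by (intro bm_intros)

lemma zeta_mean: "(\<integral>y. \<zeta> a y \<partial>M a) = 0"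
  unfolding \<zeta>_def
  by (subst Bochner_Integration.integral_sum) (auto intro!: int_M bm_intros simp: xi_mean)

text \<open>A variance is at most the second moment, and the square of a step function has no cross
  terms because the bins are disjoint.\<close>

lemma zeta_square_le: "(\<integral>y. \<zeta> a y * \<zeta> a y \<partial>M a) \<le> (\<Sum>k\<in>K. \<mu> a k * (v a k)\<^sup>2)"
proof -
  define Z where "Z y = (\<Sum>k\<in>K. v a k * \<phi> k y)" for y
  define c where "c = (\<Sum>k\<in>K. v a k * \<mu> a k)"
  have Z_bm: "bounded_measurable (M a) Z" unfolding Z_def by (intro bm_intros)
  have EZ: "(\<integral>y. Z y \<partial>M a) = c"
    unfolding Z_def c_def \<mu>_def by (subst Bochner_Integration.integral_sum) (auto intro!: int_M bm_intros)
  have zeta: "\<zeta> a y = Z y - c" for y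
    by (simp add: \<zeta>_def \<xi>_def Z_def c_def right_diff_distrib sum_subtractf)
  have "\<zeta> a y * \<zeta> a y = (Z y)\<^sup>2 - 2 * c * Z y + c\<^sup>2" for y
    unfolding zeta by (simp add: power2_eq_square algebra_simps)
  then have "(\<integral>y. \<zeta> a y * \<zeta> a y \<partial>M a) = (\<integral>y. (Z y)\<^sup>2 - 2 * c * Z y + c\<^sup>2 \<partial>M a)"
    by simp
  also have "\<dots> = (\<integral>y. (Z y)\<^sup>2 \<partial>M a) - 2 * c * c + c\<^sup>2"
    by (subst Bochner_Integration.integral_add, (intro int_M bm_intros Z_bm)+,
        subst Bochner_Integration.integral_diff, (intro int_M bm_intros Z_bm)+) (simp add: EZ)
  also have "\<dots> \<le> (\<integral>y. (Z y)\<^sup>2 \<partial>M a)" by (simp add: power2_eq_square)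
  also have "\<dots> = (\<Sum>k\<in>K. \<mu> a k * (v a k)\<^sup>2)"
    unfolding Z_def sum_phi_square
    by (subst Bochner_Integration.integral_sum) (auto intro!: int_M bm_intros simp: \<mu>_def mult.commute)
  finally show ?thesis .
qed

lemma linear_part_le:
  "(\<integral>x. (\<Sum>a\<in>I. \<zeta> a (x a))\<^sup>2 \<partial>P) \<le> (\<Sum>a\<in>I. \<Sum>k\<in>K. \<mu> a k * (v a k)\<^sup>2)"
proof -
  have "(\<integral>x. (\<Sum>a\<in>I. \<zeta> a (x a))\<^sup>2 \<partial>P) = (\<Sum>a\<in>I. \<Sum>b\<in>I. \<integral>x. \<zeta> a (x a) * \<zeta> b (x b) \<partial>P)"
  proof -
    have "(\<integral>x. (\<Sum>a\<in>I. \<zeta> a (x a))\<^sup>2 \<partial>P) = (\<Sum>a\<in>I. \<integral>x. (\<Sum>b\<in>I. \<zeta> a (x a) * \<zeta> b (x b)) \<partial>P)"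
      unfolding power2_eq_square sum_product
      by (intro Bochner_Integration.integral_sum int_P bm_intros; assumption)
    also have "\<dots> = (\<Sum>a\<in>I. \<Sum>b\<in>I. \<integral>x. \<zeta> a (x a) * \<zeta> b (x b) \<partial>P)"
      by (intro sum.cong refl Bochner_Integration.integral_sum int_P bm_intros; assumption)
    finally show ?thesis .
  qed
  also have "\<dots> = (\<Sum>a\<in>I. \<Sum>b\<in>I. if b = a then \<integral>y. \<zeta> a y * \<zeta> a y \<partial>M a else 0)"
  proof (intro sum.cong refl)
    fix a b assume ab: "a \<in> I" "b \<in> I"
    show "(\<integral>x. \<zeta> a (x a) * \<zeta> b (x b) \<partial>P) = (if b = a then \<integral>y. \<zeta> a y * \<zeta> a y \<partial>M a else 0)"
    proof (cases "b = a")
      case True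
      then show ?thesis
        using expectation_single[OF ab(1), of "\<lambda>y. \<zeta> a y * \<zeta> a y"] by (simp add: bm_intros)
    next
      case False
      then show ?thesis using expectation_two_zero[OF ab, of "\<zeta> a" "\<zeta> b"] by (simp add: bm_intros zeta_mean)
    qed
  qed
  also have "\<dots> = (\<Sum>a\<in>I. \<integral>y. \<zeta> a y * \<zeta> a y \<partial>M a)" using fin by simp
  also have "\<dots> \<le> (\<Sum>a\<in>I. \<Sum>k\<in>K. \<mu> a k * (v a k)\<^sup>2)" by (intro sum_mono zeta_square_le)
  finally show ?thesis .
qed

text \<open>Insert \<open>\<phi> k = \<mu> a k + \<xi> a k\<close> into both arguments of
  \<open>G\<close>; the two mixed terms agree because \<open>w\<close> is symmetric.\<close>

lemma Hoeffding_decomposition: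
  "U x - D = 2 * (\<Sum>a\<in>I. \<zeta> a (x a)) + (\<Sum>a\<in>I. \<Sum>b\<in>I. w a b * R a b x)"
proof -
  have G: "G (x a) (x b) = (\<Sum>k\<in>K. \<mu> a k * \<mu> b k) + (\<Sum>k\<in>K. \<mu> b k * \<xi> a k (x a))
      + (\<Sum>k\<in>K. \<mu> a k * \<xi> b k (x b)) + R a b x" for a b
    unfolding G_def R_def \<xi>_def sum.distrib[symmetric] by (intro sum.cong refl) (simp add: algebra_simps)
  have z: "(\<Sum>b\<in>I. w a b * (\<Sum>k\<in>K. \<mu> b k * f k)) = (\<Sum>k\<in>K. v a k * f k)" for a and f :: "'k \<Rightarrow> real"
    unfolding v_def sum_distrib_left sum_distrib_right
    by (subst sum.swap) (intro sum.cong refl, simp)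
  have "U x = (\<Sum>a\<in>I. \<Sum>b\<in>I. w a b * (\<Sum>k\<in>K. \<mu> b k * \<mu> a k)) + (\<Sum>a\<in>I. \<Sum>b\<in>I. w a b * (\<Sum>k\<in>K. \<mu> b k * \<xi> a k (x a)))
      + (\<Sum>a\<in>I. \<Sum>b\<in>I. w a b * (\<Sum>k\<in>K. \<mu> a k * \<xi> b k (x b))) + (\<Sum>a\<in>I. \<Sum>b\<in>I. w a b * R a b x)"
    unfolding U_def G by (simp add: distrib_left sum.distrib mult.commute)
  also have "(\<Sum>a\<in>I. \<Sum>b\<in>I. w a b * (\<Sum>k\<in>K. \<mu> a k * \<xi> b k (x b)))
      = (\<Sum>b\<in>I. \<Sum>a\<in>I. w b a * (\<Sum>k\<in>K. \<mu> a k * \<xi> b k (x b)))"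
    by (subst sum.swap) (simp only: w_sym)
  finally show ?thesis unfolding z by (simp add: D_def \<zeta>_def mult.commute)
qed

lemma U_bm [bm_intros]: "bounded_measurable P U"
proof -
  have "U = (\<lambda>x. D + (2 * (\<Sum>a\<in>I. \<zeta> a (x a)) + (\<Sum>a\<in>I. \<Sum>b\<in>I. w a b * R a b x)))"
    using Hoeffding_decomposition by (intro ext) (smt (verit))
  then show ?thesis by (simp only:) (intro bm_intros; assumption)
qed

lemma expectation_U_deviation_le:
  assumes Mx: "\<And>a b. m a b \<le> Mx"
  shows "(\<integral>x. (U x - D)\<^sup>2 \<partial>P) \<le> 8 * (\<Sum>a\<in>I. \<Sum>k\<in>K. \<mu> a k * (v a k)\<^sup>2)
    + 8 * (\<Sum>a\<in>I. \<Sum>b\<in>I. (w a b)\<^sup>2) * Mx"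
proof -
  let ?L = "\<lambda>x. \<Sum>a\<in>I. \<zeta> a (x a)" and ?Q = "\<lambda>x. \<Sum>a\<in>I. \<Sum>b\<in>I. w a b * R a b x"
  have L: "bounded_measurable P ?L" and Q: "bounded_measurable P ?Q" by (intro bm_intros; assumption)+
  have "(\<integral>x. (U x - D)\<^sup>2 \<partial>P) \<le> (\<integral>x. 8 * (?L x)\<^sup>2 + 2 * (?Q x)\<^sup>2 \<partial>P)"
  proof (intro integral_mono int_P bm_intros L Q)
    fix x
    have "(2 * l + q)\<^sup>2 \<le> 8 * l\<^sup>2 + 2 * q\<^sup>2" for l q :: real
      using zero_le_power2[of "2 * l - q"] by (simp add: power2_eq_square algebra_simps)
    then show "(U x - D)\<^sup>2 \<le> 8 * (?L x)\<^sup>2 + 2 * (?Q x)\<^sup>2" unfolding Hoeffding_decomposition .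
  qed
  also have "\<dots> = 8 * (\<integral>x. (?L x)\<^sup>2 \<partial>P) + 2 * (\<integral>x. (?Q x)\<^sup>2 \<partial>P)"
    by (subst Bochner_Integration.integral_add) (auto intro!: int_P bm_intros L Q)
  finally show ?thesis using linear_part_le quadratic_part_le[OF Mx] by simp
qed

end

section \<open>Errors of the permutation test\<close>

context binned_sample
begin

text \<open>Bound from \<open>sum_permuted_squares_le\<close> for the mean square of the permuted
  statistics given the sample; it is still random.\<close>

definition V :: "(nat \<Rightarrow> 'a) \<Rightarrow> real" where
  "V x = 4 * (\<Sum>a\<in>I. \<Sum>b\<in>I. (w a b)\<^sup>2) / (real (card I) * (real (card I) - 1))
    * (\<Sum>a\<in>I. \<Sum>b\<in>I - {a}. G (x a) (x b))"

lemma V_nonneg: "V x \<ge> 0"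
  unfolding V_def using card_ge
  by (intro mult_nonneg_nonneg divide_nonneg_nonneg sum_nonneg G_bounds) auto

lemma V_bm [bm_intros]: "bounded_measurable P V"
  unfolding V_def G_def by (intro bm_intros; simp)

lemma expectation_V_le:
  assumes Mx: "\<And>a b. m a b \<le> Mx"
  shows "(\<integral>x. V x \<partial>P) \<le> 4 * (\<Sum>a\<in>I. \<Sum>b\<in>I. (w a b)\<^sup>2) * Mx"
proof -
  define N where "N = real (card I)"
  have N: "N \<ge> 4" using card_ge by (simp add: N_def)
  let ?S = "\<Sum>a\<in>I. \<Sum>b\<in>I. (w a b)\<^sup>2"
  have S: "?S \<ge> 0" by (intro sum_nonneg) auto
  have bm: "bounded_measurable P (\<lambda>x. G (x a) (x b))" if "a \<in> I" "b \<in> I" for a b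
    unfolding G_def using that by (intro bm_intros)
  have "(\<integral>x. (\<Sum>a\<in>I. \<Sum>b\<in>I - {a}. G (x a) (x b)) \<partial>P)
      = (\<Sum>a\<in>I. \<integral>x. (\<Sum>b\<in>I - {a}. G (x a) (x b)) \<partial>P)"
    by (intro Bochner_Integration.integral_sum int_P bm_intros bm) auto
  also have "\<dots> = (\<Sum>a\<in>I. \<Sum>b\<in>I - {a}. \<integral>x. G (x a) (x b) \<partial>P)"
    by (intro sum.cong refl Bochner_Integration.integral_sum int_P bm_intros bm) auto
  also have "\<dots> \<le> (\<Sum>a\<in>I. \<Sum>b\<in>I - {a}. Mx)"
    using Mx by (intro sum_mono) (simp add: expectation_G)
  also have "\<dots> = N * (N - 1) * Mx" using fin card_ge by (simp add: N_def)
  finally have le: "(\<integral>x. (\<Sum>a\<in>I. \<Sum>b\<in>I - {a}. G (x a) (x b)) \<partial>P) \<le> N * (N - 1) * Mx" .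
  have "(\<integral>x. V x \<partial>P) = 4 * ?S / (N * (N - 1)) * (\<integral>x. (\<Sum>a\<in>I. \<Sum>b\<in>I - {a}. G (x a) (x b)) \<partial>P)"
    unfolding V_def N_def[symmetric] by (rule integral_mult_right_zero)
  also have "\<dots> \<le> 4 * ?S / (N * (N - 1)) * (N * (N - 1) * Mx)"
    using S N by (intro mult_left_mono le divide_nonneg_nonneg mult_nonneg_nonneg) auto
  also have "\<dots> = 4 * ?S * Mx" using N by simp
  finally show ?thesis .
qed

text \<open>Acceptance forces \<open>U\<close> to miss \<open>D\<close> by at least
  \<open>D / 2\<close>, or the bound for the critical value to reach \<open>D / 2\<close>, that is,
  \<open>V\<close> to reach \<open>\<alpha> * D\<^sup>2 / 4\<close>. Markov's inequality treats both
  events.\<close>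

lemma acceptance_probability_le:
  assumes Mx: "\<And>a b. m a b \<le> Mx" and D: "D > 0" and alpha: "\<alpha> > 0"
    and crit: "\<And>x. c x \<le> sqrt (V x / \<alpha>)"
  shows "emeasure P {x \<in> space P. U x \<le> c x} \<le> ennreal
    (4 * (8 * (\<Sum>a\<in>I. \<Sum>k\<in>K. \<mu> a k * (v a k)\<^sup>2) + 8 * (\<Sum>a\<in>I. \<Sum>b\<in>I. (w a b)\<^sup>2) * Mx) / D\<^sup>2
      + 16 * (\<Sum>a\<in>I. \<Sum>b\<in>I. (w a b)\<^sup>2) * Mx / (\<alpha> * D\<^sup>2))"
proof -
  interpret P: prob_space P by (rule prob_space_PiM[OF prob_space])
  let ?A = "{x \<in> space P. (U x - D)\<^sup>2 \<ge> D\<^sup>2 / 4}" and ?B = "{x \<in> space P. V x \<ge> \<alpha> * D\<^sup>2 / 4}"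
  have meas: "U \<in> borel_measurable P" "V \<in> borel_measurable P" by (intro bm_measurable bm_intros)+
  have AB: "?A \<in> sets P" "?B \<in> sets P" using meas by measurable
  \<comment> \<open>The covering events are measurable, which is enough for monotonicity although
    \<open>c\<close> is an arbitrary function.\<close>
  have "{x \<in> space P. U x \<le> c x} \<subseteq> ?A \<union> ?B"
  proof (rule subsetI, rule ccontr)
    fix x assume x: "x \<in> {x \<in> space P. U x \<le> c x}" "x \<notin> ?A \<union> ?B"
    then have 1: "(U x - D)\<^sup>2 < (D / 2)\<^sup>2" "V x < \<alpha> * D\<^sup>2 / 4" by (auto simp: power_divide)
    have "\<bar>U x - D\<bar> < D / 2" using abs_less_iff power_less_imp_less_base[of "\<bar>U x - D\<bar>" 2 "D / 2"] 1(1) D by simp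
    then have "U x > D / 2" by linarith
    moreover have "c x < D / 2"
    proof -
      have "V x / \<alpha> < (D / 2)\<^sup>2" using 1(2) alpha by (simp add: field_simps)
      then have "sqrt (V x / \<alpha>) < D / 2" using D by (intro real_less_lsqrt) (auto simp: V_nonneg alpha less_imp_le)
      then show ?thesis using crit[of x] by linarith
    qed
    ultimately show False using x by auto
  qed
  then have "emeasure P {x \<in> space P. U x \<le> c x} \<le> emeasure P (?A \<union> ?B)"
    using AB by (intro emeasure_mono) auto
  also have "\<dots> = ennreal (measure P (?A \<union> ?B))" by (rule P.emeasure_eq_measure)
  also have "\<dots> \<le> ennreal (measure P ?A + measure P ?B)"
    using AB by (intro ennreal_leI measure_Un_le)
  also have "\<dots> \<le> ennreal (4 * (8 * (\<Sum>a\<in>I. \<Sum>k\<in>K. \<mu> a k * (v a k)\<^sup>2) + 8 * (\<Sum>a\<in>I. \<Sum>b\<in>I. (w a b)\<^sup>2) * Mx) / D\<^sup>2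
      + 16 * (\<Sum>a\<in>I. \<Sum>b\<in>I. (w a b)\<^sup>2) * Mx / (\<alpha> * D\<^sup>2))"
  proof (intro ennreal_leI add_mono)
    have "measure P ?A \<le> (\<integral>x. (U x - D)\<^sup>2 \<partial>P) / (D\<^sup>2 / 4)"
      using D by (intro integral_Markov_inequality_measure[where A = "{}"] int_P bm_intros) auto
    also have "\<dots> \<le> (8 * (\<Sum>a\<in>I. \<Sum>k\<in>K. \<mu> a k * (v a k)\<^sup>2) + 8 * (\<Sum>a\<in>I. \<Sum>b\<in>I. (w a b)\<^sup>2) * Mx) / (D\<^sup>2 / 4)"
      by (intro divide_right_mono expectation_U_deviation_le Mx) auto
    finally show "measure P ?A \<le> 4 * (8 * (\<Sum>a\<in>I. \<Sum>k\<in>K. \<mu> a k * (v a k)\<^sup>2) + 8 * (\<Sum>a\<in>I. \<Sum>b\<in>I. (w a b)\<^sup>2) * Mx) / D\<^sup>2"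
      by (simp add: mult.commute)
    have "measure P ?B \<le> (\<integral>x. V x \<partial>P) / (\<alpha> * D\<^sup>2 / 4)"
      using D alpha by (intro integral_Markov_inequality_measure[where A = "{}"] int_P bm_intros) (auto simp: V_nonneg)
    also have "\<dots> \<le> (4 * (\<Sum>a\<in>I. \<Sum>b\<in>I. (w a b)\<^sup>2) * Mx) / (\<alpha> * D\<^sup>2 / 4)"
      using alpha by (intro divide_right_mono expectation_V_le Mx) auto
    finally show "measure P ?B \<le> 16 * (\<Sum>a\<in>I. \<Sum>b\<in>I. (w a b)\<^sup>2) * Mx / (\<alpha> * D\<^sup>2)"
      by simp
  qed
  finally show ?thesis .
qed

end

section \<open>Measurability and finiteness of the bins\<close>

lemma borel_measurable_vec_component [measurable]:
  "(\<lambda>x :: real ^ 'd::finite. x $ i) \<in> borel_measurable borel"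
  by (intro borel_measurable_continuous_onI continuous_intros)

lemma unit_cube_borel [measurable]: "(unit_cube :: (real ^ 'd::finite) set) \<in> sets borel"
proof -
  have "{x \<in> space borel. \<forall>i. 0 \<le> x $ i \<and> x $ i \<le> 1} \<in> sets (borel :: (real ^ 'd) measure)"
    by measurable
  then show ?thesis by (simp add: unit_cube_def)
qed

lemma bin_borel [measurable]: "(bin \<kappa> k :: (real ^ 'd::finite) set) \<in> sets borel"
proof -
  have "{x \<in> space borel. x \<in> unit_cube \<and> (\<forall>i. real (k $ i) / real \<kappa> \<le> x $ i \<and>
     (x $ i < real (k $ i + 1) / real \<kappa> \<or> k $ i + 1 = \<kappa>))} \<in> sets (borel :: (real ^ 'd) measure)"
    by measurable
  then show ?thesis by (simp add: bin_def)
qed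

text \<open>Outside the cube no bin contains the point, and \<open>bin_of\<close> takes the
  unspecified value \<open>THE k. False\<close>. If this happens to be \<open>k\<close>, the
  preimage also contains the complement of the cube.\<close>

lemma bin_of_borel:
  assumes "\<kappa> \<ge> 1" "k \<in> bin_indices \<kappa>"
  shows "{x :: real ^ 'd::finite. bin_of \<kappa> x = k} \<in> sets borel"
proof -
  have "bin_of \<kappa> x = (THE k. False)" if "x \<notin> unit_cube" for x :: "real ^ 'd"
    using that by (simp add: bin_of_def bin_def)
  moreover have bin_subset: "bin \<kappa> k \<subseteq> unit_cube" by (auto simp: bin_def)
  ultimately have "{x. bin_of \<kappa> x = k} = bin \<kappa> k \<union> (if (THE k. False) = k then - unit_cube else {})"
  proof (intro set_eqI)
    fix x :: "real ^ 'd"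
    assume *: "\<And>x :: real ^ 'd. x \<notin> unit_cube \<Longrightarrow> bin_of \<kappa> x = (THE k. False)" "bin \<kappa> k \<subseteq> unit_cube"
    show "x \<in> {x. bin_of \<kappa> x = k} \<longleftrightarrow> x \<in> bin \<kappa> k \<union> (if (THE k. False) = k then - unit_cube else {})"
    proof (cases "x \<in> unit_cube")
      case True
      then show ?thesis using bin_of_eq_iff[OF True assms(2,1)] by simp
    next
      case False
      then have "x \<notin> bin \<kappa> k" using *(2) by blast
      then show ?thesis using False *(1)[OF False] by simp
    qed
  qed
  then show ?thesis by simp
qed

lemma finite_bin_indices: "finite (bin_indices \<kappa> :: (nat ^ 'd::finite) set)"
proof -
  have "bin_indices \<kappa> \<subseteq> vec_lambda ` (PiE (UNIV :: 'd set) (\<lambda>_. {..<\<kappa>}))"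
  proof
    fix k :: "nat ^ 'd" assume "k \<in> bin_indices \<kappa>"
    then have "vec_nth k \<in> PiE UNIV (\<lambda>_. {..<\<kappa>})" by (auto simp: bin_indices_def)
    then show "k \<in> vec_lambda ` (PiE (UNIV :: 'd set) (\<lambda>_. {..<\<kappa>}))"
      by (metis image_eqI vec_nth_inverse)
  qed
  then show ?thesis by (rule finite_subset) (intro finite_imageI finite_PiE; simp)
qed

abbreviation in_bin :: "nat \<Rightarrow> nat ^ 'd \<Rightarrow> real ^ 'd \<Rightarrow> real" where
  "in_bin \<kappa> k x \<equiv> of_bool (bin_of \<kappa> x = k)"

section \<open>Error probabilities of the test in terms of bin probabilities\<close>

lemma crit_value_quantile:
  assumes "0 < \<alpha>" "\<alpha> < 1"
  shows "empirical_quantile {\<pi>. \<pi> permutes {1..n1 + n2}} \<alpha> (fact (n1 + n2))"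
    and "crit_value \<kappa> n1 n2 \<alpha> X = Inf (empirical_quantile.T {\<pi>. \<pi> permutes {1..n1 + n2}}
      (perm_stat \<kappa> n1 n2 X) \<alpha> (fact (n1 + n2)))"
proof -
  have "card {\<pi>. \<pi> permutes {1..n1 + n2}} = fact (n1 + n2)"
    by (rule card_permutations) auto
  then show q: "empirical_quantile {\<pi>. \<pi> permutes {1..n1 + n2}} \<alpha> (fact (n1 + n2))"
    using assms by unfold_locales (auto intro: finite_permutations permutes_id)
  show "crit_value \<kappa> n1 n2 \<alpha> X = Inf (empirical_quantile.T {\<pi>. \<pi> permutes {1..n1 + n2}}
      (perm_stat \<kappa> n1 n2 X) \<alpha> (fact (n1 + n2)))"
    unfolding crit_value_def empirical_quantile.T_def[OF q] by simp
qed

lemma perm_stat_eq_test_stat: "perm_stat \<kappa> n1 n2 X \<pi> = test_stat \<kappa> n1 n2 (\<lambda>i. X (\<pi> i))"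
  by (simp add: perm_stat_def test_stat_def)

text \<open>By exchangeability the events \<open>B \<pi>\<close> all have the probability of
  rejection, and for every sample at most a fraction \<alpha> of them occurs. Averaging over the
  permutations gives the level.\<close>

lemma type_one_error:
  fixes Q :: "(real ^ 'd::finite) measure"
  assumes Q: "prob_space Q" and alpha: "0 < \<alpha>" "\<alpha> < 1"
  shows "emeasure (sample_law n1 n2 Q Q)
    {X \<in> space (sample_law n1 n2 Q Q). test_stat \<kappa> n1 n2 X > crit_value \<kappa> n1 n2 \<alpha> X} \<le> ennreal \<alpha>"
proof -
  define I where "I = {1..n1 + n2}"
  define P where "P = PiM I (\<lambda>_. Q)"
  have law: "sample_law n1 n2 Q Q = P" by (simp add: sample_law_def P_def I_def)
  interpret P: prob_space P unfolding P_def by (rule prob_space_PiM[OF Q])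
  define A where "A = {X \<in> space P. test_stat \<kappa> n1 n2 X > crit_value \<kappa> n1 n2 \<alpha> X}"
  \<comment> \<open>Relabelling the sample only reorders the permuted statistics and leaves their
    quantile unchanged.\<close>
  have crit_invariant: "crit_value \<kappa> n1 n2 \<alpha> (\<lambda>i. X (\<pi> i)) = crit_value \<kappa> n1 n2 \<alpha> X"
    if perm: "\<pi> permutes I" for X :: "nat \<Rightarrow> real ^ 'd" and \<pi>
  proof -
    have "(\<Sum>\<sigma> | \<sigma> permutes I. of_bool (perm_stat \<kappa> n1 n2 (\<lambda>i. X (\<pi> i)) \<sigma> \<le> t))
        = (\<Sum>\<sigma> | \<sigma> permutes I. of_bool (perm_stat \<kappa> n1 n2 X \<sigma> \<le> t) :: real)" for t
    proof -
      have "(\<Sum>\<sigma> | \<sigma> permutes I. of_bool (perm_stat \<kappa> n1 n2 X \<sigma> \<le> t))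
          = (\<Sum>\<sigma> | \<sigma> permutes I. of_bool (perm_stat \<kappa> n1 n2 X (\<pi> \<circ> \<sigma>) \<le> t) :: real)"
        by (rule setum_permutations_compose_left[OF perm])
      then show ?thesis by (simp only: perm_stat_eq_test_stat comp_def)
    qed
    then show ?thesis by (simp only: crit_value_def I_def)
  qed
  show ?thesis
  proof (cases "A \<in> sets P")
    \<comment> \<open>By convention \<open>emeasure\<close> is 0 on nonmeasurable sets.\<close>
    case False
    then show ?thesis by (simp add: law A_def[symmetric] emeasure_notin_sets)
  next
    case True
    define B where "B \<pi> = {X \<in> space P. perm_stat \<kappa> n1 n2 X \<pi> > crit_value \<kappa> n1 n2 \<alpha> X}" for \<pi>
    have B: "B \<pi> \<in> sets P \<and> measure P (B \<pi>) = measure P A" if p: "\<pi> permutes I" for \<pi>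
    proof -
      let ?T = "\<lambda>X. \<lambda>n\<in>I. X (\<pi> n)"
      have T: "?T \<in> measurable P P"
        unfolding P_def using p by (intro measurable_restrict measurable_component_singleton) (simp add: permutes_in_image)
      have inj: "inj_on \<pi> I" "\<pi> \<in> I \<rightarrow> I" using p by (auto simp: permutes_in_image permutes_inj_on)
      have "distr P P ?T = P"
        unfolding P_def using distr_PiM_reindex[OF Q inj] by simp
      then have 1: "measure P A = measure P (?T -` A \<inter> space P)"
        using measure_distr[OF T True] by simp
      \<comment> \<open>Restriction to \<open>I\<close> changes nothing: outside \<open>I\<close>
        the permutation is the identity and sample points have the value
        \<open>undefined\<close>.\<close>
      have TX: "?T X = (\<lambda>i. X (\<pi> i))" if "X \<in> space P" for X
      proof
        fix i
        show "?T X i = X (\<pi> i)"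
        proof (cases "i \<in> I")
          case False
          then have "\<pi> i = i" using p by (simp add: permutes_def)
          moreover have "X i = undefined" using that False by (auto simp: P_def space_PiM PiE_def extensional_def)
          ultimately show ?thesis using False by simp
        qed simp
      qed
      have "?T -` A \<inter> space P = B \<pi>"
        using TX measurable_space[OF T] crit_invariant[OF p]
        by (auto simp: A_def B_def perm_stat_eq_test_stat)
      then show ?thesis using 1 measurable_sets[OF T True] by simp
    qed
    have "card {\<pi>. \<pi> permutes I} = fact (n1 + n2)"
      unfolding I_def by (rule card_permutations) auto
    then have "fact (n1 + n2) * measure P A = (\<Sum>\<pi> | \<pi> permutes I. measure P (B \<pi>))"
      using B by simp
    also have "\<dots> = (\<Sum>\<pi> | \<pi> permutes I. \<integral>X. indicator (B \<pi>) X \<partial>P)"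
      using B by (intro sum.cong refl) simp
    also have "\<dots> = (\<integral>X. (\<Sum>\<pi> | \<pi> permutes I. indicator (B \<pi>) X) \<partial>P)"
      using B by (intro Bochner_Integration.integral_sum[symmetric]) (simp add: P.emeasure_eq_measure)
    also have "\<dots> \<le> (\<integral>X. \<alpha> * fact (n1 + n2) \<partial>P)"
    proof (intro integral_mono Bochner_Integration.integrable_sum)
      fix X assume X: "X \<in> space P"
      have "(\<Sum>\<pi> | \<pi> permutes I. indicator (B \<pi>) X)
          = (\<Sum>\<pi> | \<pi> permutes I. of_bool (perm_stat \<kappa> n1 n2 X \<pi> > crit_value \<kappa> n1 n2 \<alpha> X) :: real)"
        using X by (intro sum.cong refl) (simp add: B_def indicator_def)
      also have "\<dots> \<le> \<alpha> * fact (n1 + n2)"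
        unfolding crit_value_quantile(2)[OF alpha] I_def
        by (rule empirical_quantile.sum_exceed_le[OF crit_value_quantile(1)[OF alpha]])
      finally show "(\<Sum>\<pi> | \<pi> permutes I. indicator (B \<pi>) X) \<le> \<alpha> * fact (n1 + n2)" .
    qed (use B in \<open>auto simp: P.emeasure_eq_measure\<close>)
    also have "\<dots> = \<alpha> * fact (n1 + n2)" by (simp add: P.prob_space)
    finally have "measure P A \<le> \<alpha>" by simp
    then show ?thesis by (simp add: law A_def[symmetric] P.emeasure_eq_measure ennreal_leI)
  qed
qed

text \<open>The row sums of the weights make \<open>v\<close> and \<open>D\<close> explicit. The
  constants are 64 = 4 * 8 * 2 from the linear part, 192 = 4 * 8 * 6 from the quadratic part and 96
  = 16 * 6 from the critical value, where 6 comes from the sum of squared weights.\<close>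

lemma type_two_error:
  fixes PY PZ :: "(real ^ 'd::finite) measure"
  assumes prob: "prob_space PY" "prob_space PZ" and borel: "sets PY = sets borel" "sets PZ = sets borel"
    and \<kappa>: "\<kappa> \<ge> 1" and n: "2 \<le> n1" "n1 \<le> n2" and alpha: "0 < \<alpha>" "\<alpha> < 1"
    and p: "\<And>k. k \<in> bin_indices \<kappa> \<Longrightarrow> p k = (\<integral>x. in_bin \<kappa> k x \<partial>PY)"
    and q: "\<And>k. k \<in> bin_indices \<kappa> \<Longrightarrow> q k = (\<integral>x. in_bin \<kappa> k x \<partial>PZ)"
    and Mx: "\<And>k. k \<in> bin_indices \<kappa> \<Longrightarrow> p k \<le> Mx" "\<And>k. k \<in> bin_indices \<kappa> \<Longrightarrow> q k \<le> Mx"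
    and D: "D = (\<Sum>k\<in>bin_indices \<kappa>. (p k - q k)\<^sup>2)" "D > 0"
  shows "emeasure (sample_law n1 n2 PY PZ)
    {X \<in> space (sample_law n1 n2 PY PZ). test_stat \<kappa> n1 n2 X \<le> crit_value \<kappa> n1 n2 \<alpha> X}
    \<le> ennreal (64 * Mx / (real n1 * D) + 192 * Mx / ((real n1)\<^sup>2 * D\<^sup>2) + 96 * Mx / ((real n1)\<^sup>2 * (\<alpha> * D\<^sup>2)))"
proof -
  define I where "I = {1..n1 + n2}"
  define w where "w = pair_weight n1 n2"
  define K where "K = (bin_indices \<kappa> :: (nat ^ 'd) set)"
  define M where "M = (\<lambda>i :: nat. if i \<le> n1 then PY else PZ)"
  have law: "sample_law n1 n2 PY PZ = PiM I M" by (simp add: sample_law_def I_def M_def)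
  have n': "2 \<le> n2" "real n1 \<ge> 2" "real n2 \<ge> real n1" using n by auto
  interpret zero_sum_weights I w unfolding I_def w_def by (rule pair_weight_zero_sum[OF n(1) n'(1)])
  \<comment> \<open>Set to 0 off \<open>K\<close>, since measurability of the bin events is
    established for indices in \<open>K\<close> only.\<close>
  define \<phi> where "\<phi> k = (if k \<in> K then in_bin \<kappa> k else (\<lambda>_. 0))" for k :: "nat ^ 'd"
  interpret Mi: prob_space "M i" for i using prob by (simp add: M_def)
  interpret product_prob_space M I by unfold_locales
  interpret binned_sample I w M K \<phi>
  proof unfold_locales
    show "finite K" by (simp add: K_def finite_bin_indices)
    show "\<phi> k \<in> borel_measurable (M a)" for k a
    proof (cases "k \<in> K")
      case True
      have "{x. bin_of \<kappa> x = k} \<in> sets (M a)"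
        using bin_of_borel[OF \<kappa>, of k] True borel by (simp add: M_def K_def)
      then have "indicat_real {x. bin_of \<kappa> x = k} \<in> borel_measurable (M a)" by simp
      moreover have "indicat_real {x. bin_of \<kappa> x = k} = \<phi> k" using True by (auto simp: \<phi>_def indicator_def)
      ultimately show ?thesis by simp
    qed (simp add: \<phi>_def)
    show "\<phi> k x = 0 \<or> \<phi> k x = 1" for k x by (simp add: \<phi>_def)
    show "\<phi> k x * \<phi> l x = 0" if "k \<noteq> l" for k l x using that by (simp add: \<phi>_def)
  qed
  have G: "G x y = bin_kernel \<kappa> (bin_of \<kappa> x) (bin_of \<kappa> y)" for x y
    unfolding G_def bin_kernel_def K_def[symmetric] by (intro sum.cong refl) (simp add: \<phi>_def)
  have U: "test_stat \<kappa> n1 n2 X = U X" for X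
    using test_stat_quadratic[OF n(1) n'(1), of \<kappa> X] unfolding U_def G I_def[symmetric] w_def[symmetric] .
  have mu: "\<mu> a k = (if a \<le> n1 then p k else q k)" if "k \<in> K" for a k
  proof -
    have "M a = (if a \<le> n1 then PY else PZ)" "k \<in> bin_indices \<kappa>" using that by (simp_all add: M_def K_def)
    then show ?thesis using that p[of k] q[of k] unfolding \<mu>_def by (simp add: \<phi>_def)
  qed
  have S: "(\<Sum>a\<in>I. \<Sum>b\<in>I. (w a b)\<^sup>2) \<le> 6 / (real n1)\<^sup>2"
    unfolding I_def w_def by (rule sum_pair_weight_square_le[OF n])
  have mu_le: "\<mu> a k \<le> Mx" if "k \<in> K" for a k using that Mx mu by (auto simp: K_def)
  have split: "(\<Sum>a\<in>I. f a) = (\<Sum>i\<in>{1..n1}. f i) + (\<Sum>j\<in>{1..n2}. f (n1 + j))" for f :: "nat \<Rightarrow> real"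
    unfolding I_def by (rule sum_pooled)
  \<comment> \<open>In each row the weights on the two samples have opposite sums, so
    \<open>v\<close> is a multiple of the difference of the bin probabilities.\<close>
  have v: "v a k = (if a \<le> n1 then (p k - q k) / real n1 else (q k - p k) / real n2)"
    if "k \<in> K" "a \<in> I" for a k
  proof -
    have row: "(\<Sum>b\<in>I. w a b) = 0" by (rule w_row[OF that(2)])
    have A: "(\<Sum>i\<in>{1..n1}. w a i) + (\<Sum>j\<in>{1..n2}. w a (n1 + j)) = 0" using row unfolding split .
    have "v a k = (\<Sum>i\<in>{1..n1}. w a i * p k) + (\<Sum>j\<in>{1..n2}. w a (n1 + j) * q k)"
      unfolding v_def split using that(1) by (intro arg_cong2[where f = "(+)"] sum.cong refl) (auto simp: mu)
    also have "\<dots> = (\<Sum>i\<in>{1..n1}. w a i) * p k + (\<Sum>j\<in>{1..n2}. w a (n1 + j)) * q k"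
      by (simp add: sum_distrib_right)
    finally have v: "v a k = (\<Sum>i\<in>{1..n1}. w a i) * p k + (\<Sum>j\<in>{1..n2}. w a (n1 + j)) * q k" .
    show ?thesis
    proof (cases "a \<le> n1")
      case True
      have "(\<Sum>j\<in>{1..n2}. w a (n1 + j)) = (\<Sum>j\<in>{1..n2}. - 1 / (real n1 * real n2))"
        using True by (intro sum.cong refl) (auto simp: w_def pair_weight_def)
      also have "\<dots> = - 1 / real n1" using n' by simp
      finally have 1: "(\<Sum>j\<in>{1..n2}. w a (n1 + j)) = - 1 / real n1" .
      then have "(\<Sum>i\<in>{1..n1}. w a i) = 1 / real n1" using A by simp
      then show ?thesis using True unfolding v 1 by (simp add: diff_divide_distrib)
    next
      case False
      have "(\<Sum>i\<in>{1..n1}. w a i) = (\<Sum>i\<in>{1..n1}. - 1 / (real n1 * real n2))"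
        using False by (intro sum.cong refl) (auto simp: w_def pair_weight_def)
      also have "\<dots> = - 1 / real n2" using n' by simp
      finally have 1: "(\<Sum>i\<in>{1..n1}. w a i) = - 1 / real n2" .
      then have "(\<Sum>j\<in>{1..n2}. w a (n1 + j)) = 1 / real n2" using A by simp
      then show ?thesis using False unfolding v 1 by (simp add: diff_divide_distrib)
    qed
  qed
  have D_eq: "binned_sample.D I w M K \<phi> = D"
  proof -
    have "binned_sample.D I w M K \<phi> = (\<Sum>k\<in>K. \<Sum>a\<in>I. \<mu> a k * v a k)" unfolding D_def by (rule sum.swap)
    also have "\<dots> = (\<Sum>k\<in>K. (p k - q k)\<^sup>2)"
    proof (rule sum.cong[OF refl])
      fix k assume k: "k \<in> K"
      have "(\<Sum>a\<in>I. \<mu> a k * v a k)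
          = (\<Sum>a\<in>I. if a \<le> n1 then p k * ((p k - q k) / real n1) else q k * ((q k - p k) / real n2))"
        using k by (intro sum.cong refl) (simp add: mu v)
      also have "\<dots> = p k * (p k - q k) + q k * (q k - p k)"
        unfolding split using n' by simp
      finally show "(\<Sum>a\<in>I. \<mu> a k * v a k) = (p k - q k)\<^sup>2" by (simp add: power2_eq_square algebra_simps)
    qed
    finally show ?thesis by (simp add: D(1) K_def)
  qed
  have m_le: "m a b \<le> Mx" for a b
  proof -
    have "m a b \<le> (\<Sum>k\<in>K. Mx * \<mu> b k)"
      unfolding m_def by (intro sum_mono mult_right_mono mu_bounds mu_le)
    also have "\<dots> = Mx * (\<Sum>k\<in>K. \<mu> b k)" by (simp add: sum_distrib_left)
    also have "\<dots> \<le> Mx"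
    proof -
      have "\<exists>k. k \<in> K" using bin_cover[of 0 \<kappa>] \<kappa> by (auto simp: K_def unit_cube_def)
      then have "Mx \<ge> 0" using mu_le mu_bounds by (meson order_trans)
      then show ?thesis using sum_mu_le[of b] by (simp add: mult_left_le)
    qed
    finally show ?thesis .
  qed
  have Mx0: "Mx \<ge> 0" using m_le[of 0 0] m_bounds(1)[of 0 0] by linarith
  have lin: "(\<Sum>a\<in>I. \<Sum>k\<in>K. \<mu> a k * (v a k)\<^sup>2) \<le> 2 * Mx * D / real n1"
  proof -
    have "(\<Sum>a\<in>I. \<Sum>k\<in>K. \<mu> a k * (v a k)\<^sup>2) \<le> (\<Sum>a\<in>I. \<Sum>k\<in>K. Mx * (v a k)\<^sup>2)"
      by (intro sum_mono mult_right_mono mu_le) auto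
    also have "\<dots> = (\<Sum>k\<in>K. \<Sum>a\<in>I. Mx * (v a k)\<^sup>2)" by (rule sum.swap)
    also have "\<dots> = (\<Sum>k\<in>K. Mx * (1 / real n1 + 1 / real n2) * (p k - q k)\<^sup>2)"
    proof (rule sum.cong[OF refl])
      fix k assume k: "k \<in> K"
      have "(\<Sum>a\<in>I. Mx * (v a k)\<^sup>2)
          = (\<Sum>a\<in>I. if a \<le> n1 then Mx * ((p k - q k) / real n1)\<^sup>2 else Mx * ((q k - p k) / real n2)\<^sup>2)"
        using k by (intro sum.cong refl) (simp add: v)
      also have "\<dots> = real n1 * (Mx * ((p k - q k) / real n1)\<^sup>2) + real n2 * (Mx * ((q k - p k) / real n2)\<^sup>2)"
        unfolding split by simp
      also have "\<dots> = Mx * (1 / real n1 + 1 / real n2) * (p k - q k)\<^sup>2"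
        using n' by (simp add: power_divide power2_commute[of "q k"] distrib_left distrib_right power2_eq_square[of "real _"])
      finally show "(\<Sum>a\<in>I. Mx * (v a k)\<^sup>2) = Mx * (1 / real n1 + 1 / real n2) * (p k - q k)\<^sup>2" .
    qed
    also have "\<dots> = Mx * (1 / real n1 + 1 / real n2) * D"
      by (simp add: sum_distrib_left[symmetric] D(1) K_def)
    also have "\<dots> \<le> Mx * (2 / real n1) * D"
    proof (intro mult_right_mono mult_left_mono)
      have "1 / real n2 \<le> 1 / real n1" using n' by (intro frac_le) auto
      then show "1 / real n1 + 1 / real n2 \<le> 2 / real n1" by simp
    qed (use Mx0 D in auto)
    finally show ?thesis by (simp add: mult.commute[of Mx 2])
  qed
  have crit: "crit_value \<kappa> n1 n2 \<alpha> X \<le> sqrt (V X / \<alpha>)" for X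
  proof -
    let ?f = "fact (n1 + n2) :: real"
    have cI: "card I = n1 + n2" by (simp add: I_def)
    \<comment> \<open>Permuting the observations amounts to permuting the weights by the inverse,
      and a sum over all permutations does not see the inversion.\<close>
    have "(\<Sum>\<pi> | \<pi> permutes I. (perm_stat \<kappa> n1 n2 X \<pi>)\<^sup>2)
        = (\<Sum>\<pi> | \<pi> permutes I. (\<Sum>a\<in>I. \<Sum>b\<in>I. w (inv \<pi> a) (inv \<pi> b) * G (X a) (X b))\<^sup>2)"
    proof (rule sum.cong[OF refl], safe)
      fix \<pi> assume p: "\<pi> permutes I"
      have inv: "inv \<pi> (\<pi> i) = i" for i using p by (simp add: permutes_inverses)
      have "perm_stat \<kappa> n1 n2 X \<pi> = (\<Sum>a\<in>I. \<Sum>b\<in>I. w (inv \<pi> (\<pi> a)) (inv \<pi> (\<pi> b)) * G (X (\<pi> a)) (X (\<pi> b)))"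
        unfolding perm_stat_eq_test_stat U U_def inv ..
      also have "\<dots> = (\<Sum>a\<in>I. \<Sum>b\<in>I. w (inv \<pi> (\<pi> a)) (inv \<pi> b) * G (X (\<pi> a)) (X b))"
      proof (rule sum.cong[OF refl])
        fix a
        show "(\<Sum>b\<in>I. w (inv \<pi> (\<pi> a)) (inv \<pi> (\<pi> b)) * G (X (\<pi> a)) (X (\<pi> b)))
            = (\<Sum>b\<in>I. w (inv \<pi> (\<pi> a)) (inv \<pi> b) * G (X (\<pi> a)) (X b))"
          using sum.permute[OF p, of "\<lambda>b. w (inv \<pi> (\<pi> a)) (inv \<pi> b) * G (X (\<pi> a)) (X b)"]
          by (simp only: comp_def)
      qed
      also have "\<dots> = (\<Sum>a\<in>I. \<Sum>b\<in>I. w (inv \<pi> a) (inv \<pi> b) * G (X a) (X b))"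
        using sum.permute[OF p, of "\<lambda>a. \<Sum>b\<in>I. w (inv \<pi> a) (inv \<pi> b) * G (X a) (X b)"]
        by (simp only: comp_def)
      finally show "(perm_stat \<kappa> n1 n2 X \<pi>)\<^sup>2 = (\<Sum>a\<in>I. \<Sum>b\<in>I. w (inv \<pi> a) (inv \<pi> b) * G (X a) (X b))\<^sup>2" by simp
    qed
    also have "\<dots> = (\<Sum>\<pi> | \<pi> permutes I. (\<Sum>a\<in>I. \<Sum>b\<in>I. w (\<pi> a) (\<pi> b) * G (X a) (X b))\<^sup>2)"
      by (rule sum_permutations_inverse[symmetric])
    finally have sums: "(\<Sum>\<pi> | \<pi> permutes I. (perm_stat \<kappa> n1 n2 X \<pi>)\<^sup>2) = \<dots>" .
    have "real (card I) * (real (card I) - 1) * (\<Sum>\<pi> | \<pi> permutes I. (perm_stat \<kappa> n1 n2 X \<pi>)\<^sup>2)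
        \<le> 4 * ?f * (\<Sum>a\<in>I. \<Sum>b\<in>I. (w a b)\<^sup>2) * (\<Sum>a\<in>I. \<Sum>b\<in>I - {a}. G (X a) (X b))"
      unfolding sums using sum_permuted_squares_le[of "\<lambda>a b. G (X a) (X b)"] G_bounds by (simp add: cI)
    moreover have "real (card I) * (real (card I) - 1) > 0" using n' by (simp add: cI)
    ultimately have "(\<Sum>\<pi> | \<pi> permutes I. (perm_stat \<kappa> n1 n2 X \<pi>)\<^sup>2) / ?f \<le> V X"
      unfolding V_def by (simp add: field_simps)
    then have "sqrt ((\<Sum>\<pi> | \<pi> permutes I. (perm_stat \<kappa> n1 n2 X \<pi>)\<^sup>2) / ?f / \<alpha>) \<le> sqrt (V X / \<alpha>)"
      using alpha by (intro real_sqrt_le_mono divide_right_mono) auto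
    moreover have "crit_value \<kappa> n1 n2 \<alpha> X \<le> sqrt ((\<Sum>\<pi> | \<pi> permutes I. (perm_stat \<kappa> n1 n2 X \<pi>)\<^sup>2) / ?f / \<alpha>)"
      unfolding crit_value_quantile(2)[OF alpha] I_def
      by (rule empirical_quantile.Inf_T_le_sqrt[OF crit_value_quantile(1)[OF alpha]])
    ultimately show ?thesis by linarith
  qed
  let ?S = "\<Sum>a\<in>I. \<Sum>b\<in>I. (w a b)\<^sup>2"
  have SM: "?S * Mx \<le> 6 * Mx / (real n1)\<^sup>2" using mult_right_mono[OF S Mx0] by simp
  have "emeasure (PiM I M) {X \<in> space (PiM I M). test_stat \<kappa> n1 n2 X \<le> crit_value \<kappa> n1 n2 \<alpha> X}
      \<le> ennreal (4 * (8 * (\<Sum>a\<in>I. \<Sum>k\<in>K. \<mu> a k * (v a k)\<^sup>2) + 8 * ?S * Mx) / D\<^sup>2 + 16 * ?S * Mx / (\<alpha> * D\<^sup>2))"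
    unfolding U using acceptance_probability_le[OF m_le _ alpha(1) crit] D(2) unfolding D_eq by blast
  also have "\<dots> \<le> ennreal (4 * (8 * (2 * Mx * D / real n1) + 8 * (6 * Mx / (real n1)\<^sup>2)) / D\<^sup>2
      + 16 * (6 * Mx / (real n1)\<^sup>2) / (\<alpha> * D\<^sup>2))"
    using lin SM alpha D(2) by (intro ennreal_leI add_mono divide_right_mono) auto
  also have "4 * (8 * (2 * Mx * D / real n1) + 8 * (6 * Mx / (real n1)\<^sup>2)) / D\<^sup>2 + 16 * (6 * Mx / (real n1)\<^sup>2) / (\<alpha> * D\<^sup>2)
      = 64 * Mx / (real n1 * D) + 192 * Mx / ((real n1)\<^sup>2 * D\<^sup>2) + 96 * Mx / ((real n1)\<^sup>2 * (\<alpha> * D\<^sup>2))"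
    using D(2) n' alpha by (simp add: divide_simps power2_eq_square)
  finally show ?thesis unfolding law .
qed

section \<open>Increments of smooth functions from distant values\<close>

text \<open>Induction on the order: the remainder of order \<open>Suc m\<close> has as derivative
  the remainder of order \<open>m\<close> for \<open>D 1\<close>, and the mean value inequality adds
  one power of the distance. No factorial is gained, which affects constants only.\<close>

lemma taylor_remainder_le:
  fixes D :: "nat \<Rightarrow> real \<Rightarrow> real"
  assumes S: "convex S" and L: "L \<ge> 0" and \<gamma>: "\<gamma> \<ge> 0"
    and deriv: "\<And>k u. k < m \<Longrightarrow> u \<in> S \<Longrightarrow> (D k has_real_derivative D (Suc k) u) (at u within S)"
    and hoelder: "\<And>u v. u \<in> S \<Longrightarrow> v \<in> S \<Longrightarrow> \<bar>D m u - D m v\<bar> \<le> L * \<bar>u - v\<bar> powr \<gamma>"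
    and xy: "x \<in> S" "y \<in> S"
  shows "\<bar>D 0 y - (\<Sum>k\<le>m. D k x * (y - x) ^ k / fact k)\<bar> \<le> L * \<bar>y - x\<bar> powr (real m + \<gamma>)"
  using deriv hoelder xy
proof (induction m arbitrary: D y)
  case 0
  then show ?case using 0(2)[OF 0(4) 0(3)] by simp
next
  case (Suc m)
  define R where "R z = D 0 z - (\<Sum>k\<le>Suc m. D k x * (z - x) ^ k / fact k)" for z
  define R' where "R' z = D 1 z - (\<Sum>k\<le>m. D (Suc k) x * (z - x) ^ k / fact k)" for z
  \<comment> \<open>Derivatives are taken within the segment, as they may be one-sided at the ends
    of \<open>S\<close>.\<close>
  let ?T = "closed_segment x y"
  have TS: "?T \<subseteq> S" using S Suc.prems(3,4) by (simp add: closed_segment_subset)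
  have R'_le: "\<bar>R' z\<bar> \<le> L * \<bar>z - x\<bar> powr (real m + \<gamma>)" if "z \<in> S" for z
    unfolding R'_def using Suc.IH[of "\<lambda>k. D (Suc k)" z] Suc.prems that by auto
  have R_deriv: "(R has_real_derivative R' z) (at z within ?T)" if "z \<in> ?T" for z
  proof -
    have "(D 0 has_real_derivative D 1 z) (at z within ?T)"
      using Suc.prems(1)[of 0 z] TS that by (auto intro: has_field_derivative_subset)
    moreover have "((\<lambda>z. \<Sum>k\<le>m. D (Suc k) x * (z - x) ^ Suc k / fact (Suc k)) has_real_derivative
        (\<Sum>k\<le>m. D (Suc k) x * (z - x) ^ k / fact k)) (at z within ?T)"
    proof (rule DERIV_sum)
      fix k
      have "((\<lambda>z. D (Suc k) x * (z - x) ^ Suc k / fact (Suc k)) has_real_derivative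
          D (Suc k) x * (real (Suc k) * (z - x) ^ k) / fact (Suc k)) (at z within ?T)"
      proof -
        have "((\<lambda>z. z - x) has_real_derivative 1) (at z within ?T)"
          by (auto intro!: derivative_eq_intros)
        from DERIV_power[OF this, of "Suc k"]
        have "((\<lambda>z. (z - x) ^ Suc k) has_real_derivative real (Suc k) * (z - x) ^ k) (at z within ?T)"
          by (simp del: power_Suc of_nat_Suc)
        then show ?thesis by (intro DERIV_cdivide DERIV_cmult)
      qed
      moreover have "D (Suc k) x * (real (Suc k) * (z - x) ^ k) / fact (Suc k) = D (Suc k) x * (z - x) ^ k / fact k"
        unfolding fact_Suc by (simp del: of_nat_Suc)
      ultimately show "((\<lambda>z. D (Suc k) x * (z - x) ^ Suc k / fact (Suc k)) has_real_derivative
          D (Suc k) x * (z - x) ^ k / fact k) (at z within ?T)" by simp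
    qed
    ultimately have "((\<lambda>z. D 0 z - (D 0 x + (\<Sum>k\<le>m. D (Suc k) x * (z - x) ^ Suc k / fact (Suc k))))
        has_real_derivative (D 1 z - (0 + (\<Sum>k\<le>m. D (Suc k) x * (z - x) ^ k / fact k)))) (at z within ?T)"
      by (intro DERIV_diff DERIV_add DERIV_const)
    moreover have "R = (\<lambda>z. D 0 z - (D 0 x + (\<Sum>k\<le>m. D (Suc k) x * (z - x) ^ Suc k / fact (Suc k))))"
      unfolding R_def sum.atMost_Suc_shift by simp
    ultimately show ?thesis by (simp add: R'_def)
  qed
  have "norm (R y - R x) \<le> (L * \<bar>y - x\<bar> powr (real m + \<gamma>)) * norm (y - x)"
  proof (rule field_differentiable_bound[OF _ R_deriv])
    fix z assume z: "z \<in> ?T"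
    have "\<bar>z - x\<bar> \<le> \<bar>y - x\<bar>" using z by (auto simp: closed_segment_eq_real_ivl split: if_splits)
    then have "L * \<bar>z - x\<bar> powr (real m + \<gamma>) \<le> L * \<bar>y - x\<bar> powr (real m + \<gamma>)"
      using L \<gamma> by (intro mult_left_mono powr_mono2) auto
    then show "norm (R' z) \<le> L * \<bar>y - x\<bar> powr (real m + \<gamma>)" using R'_le[of z] z TS by auto
  qed auto
  moreover have "R x = 0" unfolding R_def sum.atMost_Suc_shift by simp
  moreover have "\<bar>y - x\<bar> powr (real m + \<gamma>) * \<bar>y - x\<bar> = \<bar>y - x\<bar> powr (real (Suc m) + \<gamma>)"
  proof (cases "y = x")
    case False
    then show ?thesis by (simp add: powr_add mult_ac)
  qed simp
  ultimately show ?case by (simp add: R_def mult.assoc)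
qed

section \<open>Extrapolation weights from polynomials modulo a power of X - 1\<close>

definition theta :: "real poly \<Rightarrow> real poly" where "theta p = pCons 0 (pderiv p)"

text \<open>\<open>theta\<close> is the Euler operator X d/dX, which multiplies the coefficient of
  X^j by j. Evaluating its powers at 1 yields the moments of the signed measure with mass
  \<open>coeff p j\<close> at \<open>j\<close>.\<close>

definition moment :: "nat \<Rightarrow> real poly \<Rightarrow> real" where
  "moment k p = poly ((theta ^^ k) p) 1"

lemma coeff_theta_power: "coeff ((theta ^^ k) p) j = real j ^ k * coeff p j"
proof (induction k)
  case (Suc k)
  then show ?case by (cases j) (simp_all add: theta_def coeff_pderiv)
qed simp

lemma moment_altdef:
  assumes "degree p \<le> n"
  shows "moment k p = (\<Sum>j\<le>n. coeff p j * real j ^ k)"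
proof -
  have "degree ((theta ^^ k) p) \<le> n"
    using assms by (intro degree_le) (auto simp: coeff_theta_power coeff_eq_0)
  then have "poly ((theta ^^ k) p) 1 = (\<Sum>j\<le>n. coeff ((theta ^^ k) p) j * 1 ^ j)"
    unfolding poly_altdef by (intro sum.mono_neutral_left) (auto simp: coeff_eq_0)
  then show ?thesis by (simp add: moment_def coeff_theta_power mult.commute)
qed

lemma theta_power_add: "(theta ^^ k) (p + q) = (theta ^^ k) p + (theta ^^ k) q"
  by (rule poly_eqI) (simp add: coeff_theta_power distrib_left)

text \<open>The Euler operator lowers the order of the zero at 1 by at most one, so a zero is left
  after \<open>k\<close> applications.\<close>

lemma moment_eq_0:
  assumes "[:-1, 1:] ^ Suc k dvd p"
  shows "moment k p = 0"
  using assms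
proof (induction k arbitrary: p)
  case 0
  then show ?case by (simp add: moment_def poly_eq_0_iff_dvd)
next
  case (Suc k)
  let ?z = "[:-1, 1:] :: real poly"
  obtain q where q: "p = ?z ^ Suc (Suc k) * q" using Suc.prems by (elim dvdE)
  have pderiv_power: "pderiv (z ^ Suc (Suc k) * q) = z ^ Suc k * (z * pderiv q + smult (real (Suc (Suc k))) q)"
    if "pderiv z = 1" for z :: "real poly"
    unfolding pderiv_mult pderiv_power_Suc that by (simp add: algebra_simps)
  have "pderiv p = ?z ^ Suc k * (?z * pderiv q + smult (real (Suc (Suc k))) q)"
    unfolding q by (rule pderiv_power) (simp add: pderiv_pCons one_pCons)
  then have "?z ^ Suc k dvd pCons 0 (pderiv p)"
    by (metis dvd_mult dvd_triv_left mult_pCons_left add_0 smult_0_left mult_1 pCons_one)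
  then have "moment k (theta p) = 0" unfolding theta_def by (rule Suc.IH)
  then show ?case by (simp add: moment_def funpow_swap1)
qed

text \<open>A bound for the l1 norm of the coefficients, stated for all truncations to avoid
  bookkeeping of degrees.\<close>

definition l1_le :: "real poly \<Rightarrow> real \<Rightarrow> bool" where
  "l1_le p c \<longleftrightarrow> (\<forall>n. (\<Sum>j\<le>n. \<bar>coeff p j\<bar>) \<le> c)"

lemma l1_le_add: "l1_le p c \<Longrightarrow> l1_le q d \<Longrightarrow> l1_le (p + q) (c + d)"
  unfolding l1_le_def
proof
  fix n assume *: "\<forall>n. (\<Sum>j\<le>n. \<bar>coeff p j\<bar>) \<le> c" "\<forall>n. (\<Sum>j\<le>n. \<bar>coeff q j\<bar>) \<le> d"
  have "(\<Sum>j\<le>n. \<bar>coeff (p + q) j\<bar>) \<le> (\<Sum>j\<le>n. \<bar>coeff p j\<bar> + \<bar>coeff q j\<bar>)"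
    by (intro sum_mono) simp
  also have "\<dots> \<le> c + d" using * by (simp add: sum.distrib add_mono)
  finally show "(\<Sum>j\<le>n. \<bar>coeff (p + q) j\<bar>) \<le> c + d" .
qed

lemma l1_le_smult: "l1_le p c \<Longrightarrow> l1_le (smult r p) (\<bar>r\<bar> * c)"
  by (simp add: l1_le_def abs_mult sum_distrib_left[symmetric] mult_left_mono)

lemma l1_le_monom_mult:
  assumes "l1_le p c"
  shows "l1_le (monom 1 J * p) c"
  unfolding l1_le_def
proof
  fix n
  have "(\<Sum>j\<le>n. \<bar>coeff (monom 1 J * p) j\<bar>) = (\<Sum>j\<in>{J..n}. \<bar>coeff p (j - J)\<bar>)"
    unfolding coeff_monom_mult by (intro sum.mono_neutral_cong_right) auto
  also have "\<dots> \<le> (\<Sum>j\<le>n. \<bar>coeff p j\<bar>)"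
  proof -
    have "(\<Sum>j\<in>{J..n}. \<bar>coeff p (j - J)\<bar>) = (\<Sum>i\<in>(\<lambda>j. j - J) ` {J..n}. \<bar>coeff p i\<bar>)"
      by (subst sum.reindex) (auto simp: inj_on_def)
    also have "\<dots> \<le> (\<Sum>j\<le>n. \<bar>coeff p j\<bar>)" by (intro sum_mono2) auto
    finally show ?thesis .
  qed
  also have "\<dots> \<le> c" using assms by (simp add: l1_le_def)
  finally show "(\<Sum>j\<le>n. \<bar>coeff (monom 1 J * p) j\<bar>) \<le> c" .
qed

text \<open>Multiplication by X^J - 1 combines a shifted copy and a negated copy, so it at most
  doubles the norm.\<close>

lemma l1_le_difference_power: "l1_le ((monom 1 J - 1) ^ r) (2 ^ r)"
proof (induction r)
  case 0
  have "(\<Sum>j\<le>n. \<bar>coeff (1 :: real poly) j\<bar>) = 1" for n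
    by (simp add: coeff_pCons' one_pCons if_distrib cong: if_cong)
  then show ?case by (simp add: l1_le_def)
next
  case (Suc r)
  have "(monom 1 J - 1 :: real poly) ^ Suc r = monom 1 J * (monom 1 J - 1) ^ r + smult (- 1) ((monom 1 J - 1) ^ r)"
    by (simp add: algebra_simps)
  moreover have "l1_le (monom 1 J * (monom 1 J - 1) ^ r + smult (- 1) ((monom 1 J - 1) ^ r)) (2 ^ r + \<bar>- 1\<bar> * 2 ^ r)"
    by (intro l1_le_add l1_le_monom_mult l1_le_smult Suc.IH)
  ultimately show ?case by simp
qed

text \<open>Modulo \<open>(X - 1)\<^sup>m\<close>, the power \<open>(X - 1)\<^sup>r\<close> may be traded for \<open>(X\<^sup>J - 1)\<^sup>r / J\<^sup>r\<close>, which is small.\<close>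

lemma small_representative:
  assumes "\<delta> > 0"
  shows "\<exists>A Q. [:-1, 1:] = A + Q * [:-1, 1:] ^ Suc m \<and> l1_le A \<delta>"
  using assms
proof (induction m arbitrary: \<delta>)
  case 0
  have "[:-1, 1:] = 0 + 1 * [:-1, 1 :: real:] ^ Suc 0 \<and> l1_le 0 \<delta>" using 0 by (simp add: l1_le_def)
  then show ?case by blast
next
  case (Suc m)
  let ?z = "[:-1, 1:] :: real poly"
  obtain A Q where AQ: "?z = A + Q * ?z ^ Suc m" "l1_le A (\<delta> / 2)"
    using Suc.IH[of "\<delta> / 2"] Suc.prems by auto
  \<comment> \<open>Modulo the next power of X - 1 only the value of \<open>Q\<close> at 1
    matters.\<close>
  define q where "q = poly Q 1"
  have "poly (Q - [:q:]) 1 = 0" by (simp add: q_def)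
  then obtain Q1 where Q1: "Q - [:q:] = ?z * Q1" unfolding poly_eq_0_iff_dvd by (elim dvdE)
  \<comment> \<open>Large enough that \<open>\<bar>q\<bar> * 2 ^ Suc m / real J ^ Suc m\<close> is
    at most the other half of the budget \<delta>.\<close>
  define J where "J = Suc (nat \<lceil>2 * \<bar>q\<bar> * 2 ^ Suc m / \<delta>\<rceil>)"
  have J: "real J \<ge> 1" "real J \<ge> 2 * \<bar>q\<bar> * 2 ^ Suc m / \<delta>" unfolding J_def by linarith+
  define g where "g = (\<Sum>i<J. [:0, 1 :: real:] ^ i)"
  have g1: "poly g 1 = real J" by (simp add: g_def poly_sum)
  have XJ: "monom 1 J - 1 = ?z * g"
    using power_diff_1_eq[of "[:0, 1 :: real:]" J] by (simp add: g_def monom_altdef one_pCons)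
  \<comment> \<open>As \<open>g\<close> has the value \<open>J\<close> at 1,
    \<open>smult c (g ^ Suc m)\<close> agrees there with \<open>q\<close>; multiplied by (X - 1)^(m
    + 1) it becomes \<open>c\<close> times (X^J - 1)^(m + 1).\<close>
  define c where "c = q / real J ^ Suc m"
  have "poly ([:q:] - smult c (g ^ Suc m)) 1 = 0" using J by (simp add: g1 c_def)
  then obtain Q2 where Q2: "[:q:] - smult c (g ^ Suc m) = ?z * Q2" unfolding poly_eq_0_iff_dvd by (elim dvdE)
  define A' where "A' = A + smult c ((monom 1 J - 1) ^ Suc m)"
  have "?z = A' + (Q1 + Q2) * ?z ^ Suc (Suc m)"
  proof -
    have "Q = ([:q:] - smult c (g ^ Suc m)) + smult c (g ^ Suc m) + (Q - [:q:])" by simp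
    also have "\<dots> = smult c (g ^ Suc m) + ?z * (Q1 + Q2)" unfolding Q1 Q2 by (simp add: distrib_left)
    finally have "Q * ?z ^ Suc m = smult c (g ^ Suc m) * ?z ^ Suc m + ?z * (Q1 + Q2) * ?z ^ Suc m"
      by (metis distrib_right)
    moreover have "smult c (g ^ Suc m) * ?z ^ Suc m = smult c ((monom 1 J - 1) ^ Suc m)"
      unfolding XJ power_mult_distrib by (simp only: mult_smult_left mult.commute)
    moreover have "?z * (Q1 + Q2) * ?z ^ Suc m = (Q1 + Q2) * ?z ^ Suc (Suc m)"
      by (simp only: power_Suc mult_ac)
    ultimately show ?thesis using AQ(1) unfolding A'_def by (metis add.assoc)
  qed
  moreover have "l1_le A' \<delta>"
  proof -
    have "\<bar>c\<bar> * 2 ^ Suc m \<le> \<delta> / 2"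
    proof -
      have "2 * \<bar>q\<bar> * 2 ^ Suc m \<le> \<delta> * real J" using J(2) Suc.prems by (simp add: field_simps)
      also have "\<dots> \<le> \<delta> * real J ^ Suc m"
        using J(1) Suc.prems self_le_power[OF J(1), of "Suc m"] by (intro mult_left_mono) auto
      finally show ?thesis using J(1) by (simp add: c_def abs_divide divide_simps del: power_Suc)
    qed
    then have "l1_le A' (\<delta> / 2 + \<bar>c\<bar> * 2 ^ Suc m) \<and> \<delta> / 2 + \<bar>c\<bar> * 2 ^ Suc m \<le> \<delta>"
      unfolding A'_def by (auto intro!: l1_le_add AQ(2) l1_le_smult l1_le_difference_power simp del: power_Suc)
    then show ?thesis unfolding l1_le_def by (meson order_trans)
  qed
  ultimately show ?case by blast
qed

text \<open>The moments of X - 1 are 1^k - 0^k. Its small representative has the same ones up to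
  order \<open>m\<close>, because multiples of (X - 1)^(m + 1) have vanishing moments of these
  orders.\<close>

lemma small_extrapolation_weights:
  assumes "\<delta> > 0"
  shows "\<exists>J a. J \<ge> 1 \<and> (\<Sum>j\<le>J. \<bar>a j\<bar>) \<le> \<delta> \<and>
    (\<forall>k\<le>m. (\<Sum>j\<le>J. a j * real j ^ k) = (if k = 0 then 0 else 1))"
proof -
  let ?z = "[:-1, 1:] :: real poly"
  obtain A Q where A: "?z = A + Q * ?z ^ Suc m" "l1_le A \<delta>" using small_representative[OF assms] by blast
  \<comment> \<open>The successor guarantees \<open>J \<ge> 1\<close>.\<close>
  define J where "J = Suc (degree A)"
  have "(\<Sum>j\<le>J. coeff A j * real j ^ k) = (if k = 0 then 0 else 1)" if "k \<le> m" for k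
  proof -
    have "?z ^ Suc k dvd Q * ?z ^ Suc m" using that by (intro dvd_mult le_imp_power_dvd) simp
    then have "moment k (Q * ?z ^ Suc m) = 0" by (rule moment_eq_0)
    moreover have "moment k ?z = moment k A + moment k (Q * ?z ^ Suc m)"
      using arg_cong[OF A(1), of "moment k"] by (simp only: moment_def theta_power_add poly_add)
    moreover have "moment k ?z = (if k = 0 then 0 else 1)"
      by (subst moment_altdef[where n = 1]) (auto simp: numeral_eq_Suc)
    moreover have "moment k A = (\<Sum>j\<le>J. coeff A j * real j ^ k)"
      by (rule moment_altdef) (simp add: J_def)
    ultimately show ?thesis by simp
  qed
  moreover have "(\<Sum>j\<le>J. \<bar>coeff A j\<bar>) \<le> \<delta>" using A(2) by (simp add: l1_le_def)
  ultimately show ?thesis by (intro exI[of _ J] exI[of _ "coeff A"]) (simp add: J_def)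
qed

text \<open>The moment conditions make the weights exact on the Taylor polynomial at
  \<open>x\<close>. What remains is the Taylor remainder at \<open>x + t\<close> and the weighted
  remainders at the points \<open>x + real j * t\<close>, together at most
  \<open>1 + \<delta>\<close> times the bound for the farthest point.\<close>

lemma increment_le_distant_values:
  fixes D :: "nat \<Rightarrow> real \<Rightarrow> real"
  assumes S: "convex S" and L: "L \<ge> 0" and \<gamma>: "\<gamma> \<ge> 0"
    and deriv: "\<And>k u. k < m \<Longrightarrow> u \<in> S \<Longrightarrow> (D k has_real_derivative D (Suc k) u) (at u within S)"
    and hoelder: "\<And>u v. u \<in> S \<Longrightarrow> v \<in> S \<Longrightarrow> \<bar>D m u - D m v\<bar> \<le> L * \<bar>u - v\<bar> powr \<gamma>"
    and J: "J \<ge> 1" and a: "(\<Sum>j\<le>J. \<bar>a j\<bar>) \<le> \<delta>"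
    and moments: "\<And>k. k \<le> m \<Longrightarrow> (\<Sum>j\<le>J. a j * real j ^ k) = (if k = 0 then 0 else 1)"
    and inS: "\<And>j. j \<le> J \<Longrightarrow> x + real j * t \<in> S"
  shows "\<bar>D 0 (x + t) - D 0 x\<bar> \<le> (\<Sum>j\<le>J. \<bar>a j\<bar> * \<bar>D 0 (x + real j * t)\<bar>)
    + L * (1 + \<delta>) * real J powr (real m + \<gamma>) * \<bar>t\<bar> powr (real m + \<gamma>)"
proof -
  define s where "s = real m + \<gamma>"
  have s: "s \<ge> 0" using \<gamma> by (simp add: s_def)
  define T where "T z = (\<Sum>k\<le>m. D k x * (z - x) ^ k / fact k)" for z
  define r where "r j = D 0 (x + real j * t) - T (x + real j * t)" for j
  define E where "E = L * real J powr s * \<bar>t\<bar> powr s"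
  have E0: "E \<ge> 0" using L by (simp add: E_def)
  have r: "\<bar>r j\<bar> \<le> E" if "j \<le> J" for j
  proof -
    have "\<bar>r j\<bar> \<le> L * \<bar>real j * t\<bar> powr s"
      unfolding r_def T_def s_def
      using taylor_remainder_le[OF S L \<gamma> deriv hoelder, of x "x + real j * t"] inS[of 0] inS[OF that] by simp
    also have "\<dots> \<le> L * (real J * \<bar>t\<bar>) powr s"
      using that s L by (intro mult_left_mono powr_mono2) (auto simp: abs_mult mult_right_mono)
    finally show ?thesis by (simp add: E_def powr_mult mult.assoc)
  qed
  have "(\<Sum>j\<le>J. a j * T (x + real j * t)) = (\<Sum>j\<le>J. \<Sum>k\<le>m. (D k x * t ^ k / fact k) * (a j * real j ^ k))"
    unfolding T_def sum_distrib_left by (intro sum.cong refl) (simp add: power_mult_distrib)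
  also have "\<dots> = (\<Sum>k\<le>m. (D k x * t ^ k / fact k) * (\<Sum>j\<le>J. a j * real j ^ k))"
    unfolding sum_distrib_left by (rule sum.swap)
  also have "\<dots> = (\<Sum>k\<le>m. D k x * t ^ k / fact k - (if k = 0 then D 0 x else 0))"
    by (intro sum.cong refl) (simp add: moments)
  also have "\<dots> = T (x + t) - D 0 x" by (simp add: sum_subtractf T_def)
  finally have "D 0 (x + t) - D 0 x = (\<Sum>j\<le>J. a j * T (x + real j * t)) + r 1" by (simp add: r_def)
  also have "(\<Sum>j\<le>J. a j * T (x + real j * t)) = (\<Sum>j\<le>J. a j * D 0 (x + real j * t)) - (\<Sum>j\<le>J. a j * r j)"
    unfolding sum_subtractf[symmetric] r_def by (intro sum.cong refl) (simp add: algebra_simps)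
  finally have "\<bar>D 0 (x + t) - D 0 x\<bar> \<le> \<bar>\<Sum>j\<le>J. a j * D 0 (x + real j * t)\<bar> + \<bar>\<Sum>j\<le>J. a j * r j\<bar> + \<bar>r 1\<bar>"
    by linarith
  also have "\<dots> \<le> (\<Sum>j\<le>J. \<bar>a j\<bar> * \<bar>D 0 (x + real j * t)\<bar>) + \<delta> * E + E"
  proof (intro add_mono)
    show "\<bar>\<Sum>j\<le>J. a j * D 0 (x + real j * t)\<bar> \<le> (\<Sum>j\<le>J. \<bar>a j\<bar> * \<bar>D 0 (x + real j * t)\<bar>)"
      using sum_abs[of "\<lambda>j. a j * D 0 (x + real j * t)" "{..J}"] by (simp add: abs_mult)
    have "\<bar>\<Sum>j\<le>J. a j * r j\<bar> \<le> (\<Sum>j\<le>J. \<bar>a j * r j\<bar>)" by (rule sum_abs)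
    also have "\<dots> \<le> (\<Sum>j\<le>J. \<bar>a j\<bar> * E)" unfolding abs_mult using r by (intro sum_mono mult_left_mono) auto
    also have "\<dots> \<le> \<delta> * E" using a E0 by (simp add: sum_distrib_right[symmetric] mult_right_mono)
    finally show "\<bar>\<Sum>j\<le>J. a j * r j\<bar> \<le> \<delta> * E" .
    show "\<bar>r 1\<bar> \<le> E" using r J by simp
  qed
  finally show ?thesis by (simp add: E_def s_def algebra_simps)
qed

section \<open>Hoelder functions on the cube\<close>

lemma axis_nth: "(x + t *\<^sub>R axis i 1) $ j = x $ j + (if j = i then t else (0::real))"
  by (simp add: axis_def)

lemma cube_line_eq:
  assumes "x \<in> unit_cube"
  shows "cube_line x i = {- x $ i .. 1 - x $ i}"
proof (intro set_eqI iffI)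
  fix t assume "t \<in> cube_line x i"
  then have "0 \<le> (x + t *\<^sub>R axis i 1) $ i \<and> (x + t *\<^sub>R axis i 1) $ i \<le> 1"
    by (simp only: cube_line_def unit_cube_def mem_Collect_eq)
  then show "t \<in> {- x $ i .. 1 - x $ i}" unfolding axis_nth by simp
next
  fix t assume "t \<in> {- x $ i .. 1 - x $ i}"
  then show "t \<in> cube_line x i"
    using assms unfolding cube_line_def unit_cube_def mem_Collect_eq axis_nth by auto
qed

text \<open>\<open>cube_partial\<close> differentiates at parameter 0 of the line through the
  current point. Translating the parameter by \<open>u\<close> turns repeated partials in one
  direction into successive derivatives along one fixed line.\<close>

lemma partial_along_line:
  assumes f: "partials_exist m f" and k: "k < m" and x: "x \<in> unit_cube" and u: "u \<in> cube_line x i"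
  shows "((\<lambda>u. iter_partial f (replicate k i) (x + u *\<^sub>R axis i 1)) has_real_derivative
    iter_partial f (replicate (Suc k) i) (x + u *\<^sub>R axis i 1)) (at u within cube_line x i)"
proof -
  let ?y = "x + u *\<^sub>R axis i 1"
  let ?h = "\<lambda>t. iter_partial f (replicate k i) (?y + t *\<^sub>R axis i 1)"
  have y: "?y \<in> unit_cube" using u by (simp add: cube_line_def)
  have "?h differentiable (at 0 within cube_line ?y i)"
    using f k y unfolding partials_exist_def by simp
  then have "(?h has_vector_derivative vector_derivative ?h (at 0 within cube_line ?y i)) (at 0 within cube_line ?y i)"
    by (simp add: vector_derivative_works)
  then have "(?h has_real_derivative iter_partial f (replicate (Suc k) i) ?y) (at 0 within cube_line ?y i)"
    by (simp add: has_real_derivative_iff_has_vector_derivative cube_partial_def)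
  moreover have "?h = (\<lambda>t. iter_partial f (replicate k i) (x + (u + t) *\<^sub>R axis i 1))"
    by (simp add: scaleR_add_left add.assoc)
  moreover have "cube_line x i = (+) u ` cube_line ?y i"
  proof (intro equalityI subsetI)
    fix t assume "t \<in> cube_line x i"
    then have "t - u \<in> cube_line ?y i"
      by (simp add: cube_line_def scaleR_diff_left)
    then show "t \<in> (+) u ` cube_line ?y i" by (intro image_eqI[of _ _ "t - u"]) auto
  qed (auto simp: cube_line_def scaleR_add_left add.assoc)
  ultimately show ?thesis
    using DERIV_at_within_shift[of "\<lambda>u. iter_partial f (replicate k i) (x + u *\<^sub>R axis i 1)"
      "iter_partial f (replicate (Suc k) i) ?y" u 0 "cube_line ?y i"] by simp
qed

lemma component_le_array_norm:
  fixes ks :: "'d::finite list"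
  assumes "length ks = k"
  shows "\<bar>a ks\<bar> \<le> array_norm k a"
proof -
  have "finite {ks :: 'd list. length ks = k}" using finite_lists_length_eq[of "UNIV :: 'd set" k] by simp
  then have "norm (a ks) \<le> L2_set (\<lambda>i. a i) {ks. length ks = k}"
    using member_le_L2_set[of "{ks :: 'd list. length ks = k}" "ks" "\<lambda>i. \<bar>a i\<bar>"] assms
    by (simp add: L2_set_def)
  then show ?thesis by (simp add: array_norm_def)
qed

lemma holder_classD:
  assumes "f \<in> holder_class s L"
  defines "m \<equiv> nat \<lfloor>s\<rfloor>"
  shows "partials_exist m f"
    and "x \<in> unit_cube \<Longrightarrow> x' \<in> unit_cube \<Longrightarrow> length ks = m \<Longrightarrow>
      \<bar>iter_partial f ks x - iter_partial f ks x'\<bar> \<le> L * norm (x - x') powr (s - real_of_int \<lfloor>s\<rfloor>)"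
    and "x \<in> unit_cube \<Longrightarrow> length ks \<in> {1..m} \<Longrightarrow> \<bar>iter_partial f ks x\<bar> \<le> L"
proof -
  show "partials_exist m f" using assms by (simp add: holder_class_def Let_def)
  show "\<bar>iter_partial f ks x - iter_partial f ks x'\<bar> \<le> L * norm (x - x') powr (s - real_of_int \<lfloor>s\<rfloor>)"
    if "x \<in> unit_cube" "x' \<in> unit_cube" "length ks = m"
    using that assms component_le_array_norm[OF that(3), of "\<lambda>ks. iter_partial f ks x - iter_partial f ks x'"]
    by (force simp: holder_class_def Let_def)
  show "\<bar>iter_partial f ks x\<bar> \<le> L" if "x \<in> unit_cube" "length ks \<in> {1..m}"
    using that assms component_le_array_norm[OF refl, of "\<lambda>ks. iter_partial f ks x" "ks"]
    by (force simp: holder_class_def Let_def)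
qed

text \<open>The one-dimensional estimate on a line parallel to an axis, where only pure partial
  derivatives occur. The factor 2 is there because the difference of two functions of the class has
  Hoelder constant \<open>2 * L\<close>.\<close>

lemma holder_increment_le:
  fixes f g :: "real ^ 'd::finite \<Rightarrow> real"
  assumes s: "s > 0" and L: "L > 0" and f: "f \<in> holder_class s L" and g: "g \<in> holder_class s L"
    and J: "J \<ge> 1" and a: "(\<Sum>j\<le>J. \<bar>a j\<bar>) \<le> \<delta>"
    and moments: "\<And>k. k \<le> nat \<lfloor>s\<rfloor> \<Longrightarrow> (\<Sum>j\<le>J. a j * real j ^ k) = (if k = 0 then 0 else 1)"
    and cube: "\<And>j. j \<le> J \<Longrightarrow> x + (real j * t) *\<^sub>R axis i 1 \<in> unit_cube"
  shows "\<bar>(f (x + t *\<^sub>R axis i 1) - g (x + t *\<^sub>R axis i 1)) - (f x - g x)\<bar>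
    \<le> (\<Sum>j\<le>J. \<bar>a j\<bar> * \<bar>f (x + (real j * t) *\<^sub>R axis i 1) - g (x + (real j * t) *\<^sub>R axis i 1)\<bar>)
      + 2 * L * (1 + \<delta>) * real J powr s * \<bar>t\<bar> powr s"
proof -
  define m where "m = nat \<lfloor>s\<rfloor>"
  define \<gamma> where "\<gamma> = s - real_of_int \<lfloor>s\<rfloor>"
  have \<gamma>: "\<gamma> \<ge> 0" "real m + \<gamma> = s" using s by (auto simp: m_def \<gamma>_def)
  have x: "x \<in> unit_cube" using cube[of 0] by simp
  let ?p = "\<lambda>u. x + u *\<^sub>R axis i (1::real)"
  define D where "D k u = iter_partial f (replicate k i) (?p u) - iter_partial g (replicate k i) (?p u)" for k u
  have "\<bar>D 0 (0 + t) - D 0 0\<bar> \<le> (\<Sum>j\<le>J. \<bar>a j\<bar> * \<bar>D 0 (0 + real j * t)\<bar>)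
    + (2 * L) * (1 + \<delta>) * real J powr (real m + \<gamma>) * \<bar>t\<bar> powr (real m + \<gamma>)"
  proof (rule increment_le_distant_values[where S = "cube_line x i"])
    show "convex (cube_line x i)" by (simp add: cube_line_eq[OF x])
    show "(D k has_real_derivative D (Suc k) u) (at u within cube_line x i)" if "k < m" "u \<in> cube_line x i" for k u
      unfolding D_def using that holder_classD(1)[OF f] holder_classD(1)[OF g] x
      by (intro DERIV_diff partial_along_line) (auto simp: m_def)
    show "\<bar>D m u - D m v\<bar> \<le> (2 * L) * \<bar>u - v\<bar> powr \<gamma>" if "u \<in> cube_line x i" "v \<in> cube_line x i" for u v
    proof -
      have p: "?p u \<in> unit_cube" "?p v \<in> unit_cube" using that by (auto simp: cube_line_def)
      have "norm (?p u - ?p v) = \<bar>u - v\<bar>"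
        by (simp add: scaleR_diff_left[symmetric] norm_axis_1)
      then have "\<bar>iter_partial f (replicate m i) (?p u) - iter_partial f (replicate m i) (?p v)\<bar> \<le> L * \<bar>u - v\<bar> powr \<gamma>"
          "\<bar>iter_partial g (replicate m i) (?p u) - iter_partial g (replicate m i) (?p v)\<bar> \<le> L * \<bar>u - v\<bar> powr \<gamma>"
        using holder_classD(2)[OF f p, of "replicate m i"] holder_classD(2)[OF g p, of "replicate m i"]
        by (simp_all add: m_def \<gamma>_def)
      then show ?thesis unfolding D_def by linarith
    qed
    show "0 + real j * t \<in> cube_line x i" if "j \<le> J" for j using cube[OF that] by (simp add: cube_line_def)
  qed (use L J a moments \<gamma> in \<open>auto simp: m_def\<close>)
  then show ?thesis unfolding \<gamma>(2) by (simp add: D_def)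
qed

text \<open>The class bounds increments or derivatives, not values. For \<open>s < 1\<close> the
  Hoelder condition is combined with a bound for the diameter of the cube; otherwise the first
  partials are at most \<open>L\<close>, and the path from \<open>x\<close> to \<open>y\<close>
  changes one coordinate at a time.\<close>

lemma holder_oscillation_le:
  fixes f :: "real ^ 'd::finite \<Rightarrow> real"
  assumes s: "s > 0" and L: "L > 0" and f: "f \<in> holder_class s L"
    and x: "x \<in> unit_cube" and y: "y \<in> unit_cube"
  shows "\<bar>f x - f y\<bar> \<le> L * real CARD('d)"
proof (cases "s < 1")
  case True
  then have fl: "\<lfloor>s\<rfloor> = 0" using s by linarith
  have "\<bar>f x - f y\<bar> \<le> L * norm (x - y) powr s"
    using holder_classD(2)[OF f x y, of "[]"] fl by simp
  also have "norm (x - y) powr s \<le> real CARD('d)"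
  proof -
    have "norm (x - y) \<le> (\<Sum>i\<in>UNIV. \<bar>(x - y) $ i\<bar>)" by (rule norm_le_l1_cart)
    also have "\<dots> \<le> (\<Sum>i\<in>(UNIV :: 'd set). 1)"
    proof (intro sum_mono)
      fix i :: 'd
      have "0 \<le> x $ i" "x $ i \<le> 1" "0 \<le> y $ i" "y $ i \<le> 1" using x y by (auto simp: unit_cube_def)
      then show "\<bar>(x - y) $ i\<bar> \<le> 1" by (simp add: abs_le_iff)
    qed
    finally have "norm (x - y) \<le> real CARD('d)" by simp
    then have "norm (x - y) powr s \<le> real CARD('d) powr s" using s by (intro powr_mono2) auto
    also have "\<dots> \<le> real CARD('d) powr 1" using True by (intro powr_mono) auto
    finally show ?thesis by simp
  qed
  finally show ?thesis using L by simp
next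
  case False
  then have m: "nat \<lfloor>s\<rfloor> \<ge> 1" by (simp add: le_nat_iff le_floor_iff)
  have step: "\<bar>f (z + t *\<^sub>R axis i 1) - f z\<bar> \<le> L"
    if z: "z \<in> unit_cube" "z + t *\<^sub>R axis i 1 \<in> unit_cube" for z t i
  proof -
    let ?S = "cube_line z i"
    have S: "0 \<in> ?S" "t \<in> ?S" using z by (auto simp: cube_line_def)
    have "norm (f (z + t *\<^sub>R axis i 1) - f (z + 0 *\<^sub>R axis i 1)) \<le> L * norm (t - 0)"
    proof (rule field_differentiable_bound[where S = ?S and f = "\<lambda>u. f (z + u *\<^sub>R axis i 1)"
          and f' = "\<lambda>u. iter_partial f [i] (z + u *\<^sub>R axis i 1)"])
      show "convex ?S" by (simp add: cube_line_eq[OF z(1)])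
      show "((\<lambda>u. f (z + u *\<^sub>R axis i 1)) has_real_derivative iter_partial f [i] (z + u *\<^sub>R axis i 1)) (at u within ?S)"
        if "u \<in> ?S" for u
        using partial_along_line[OF holder_classD(1)[OF f] _ z(1) that, of 0] m False by simp
      show "norm (iter_partial f [i] (z + u *\<^sub>R axis i 1)) \<le> L" if "u \<in> ?S" for u
        using holder_classD(3)[OF f, of "z + u *\<^sub>R axis i 1" "[i]"] that m by (simp add: cube_line_def)
    qed (use S in auto)
    moreover have "\<bar>t\<bar> \<le> 1"
    proof -
      have "0 \<le> z $ i" "z $ i \<le> 1" using z(1) by (auto simp: unit_cube_def)
      then show ?thesis using S(2) unfolding cube_line_eq[OF z(1)] by auto
    qed
    moreover have "L * \<bar>t\<bar> \<le> L" using \<open>\<bar>t\<bar> \<le> 1\<close> L by (simp add: mult_left_le)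
    ultimately show ?thesis by simp
  qed
  \<comment> \<open>Intermediate points of the path: the coordinates in \<open>A\<close> have
    already been moved to those of \<open>y\<close>.\<close>
  define w where "w A = (\<chi> i. if i \<in> A then y $ i else x $ i)" for A :: "'d set"
  have w: "w A \<in> unit_cube" for A using x y by (auto simp: w_def unit_cube_def)
  have "\<bar>f (w A) - f x\<bar> \<le> L * real (card A)" if "finite A" for A
    using that
  proof (induction A)
    case empty
    have "w {} = x" by (simp add: w_def)
    then show ?case by simp
  next
    case (insert i A)
    have eq: "w (insert i A) = w A + (y $ i - x $ i) *\<^sub>R axis i 1"
      unfolding vec_eq_iff axis_nth using insert by (auto simp: w_def)
    have "\<bar>f (w (insert i A)) - f (w A)\<bar> \<le> L"
      unfolding eq using w[of "insert i A"] unfolding eq by (intro step w)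
    then have "\<bar>f (w (insert i A)) - f x\<bar> \<le> L + L * real (card A)" using insert.IH by linarith
    then show ?case using insert by (simp add: algebra_simps)
  qed
  from this[of UNIV] have "\<bar>f (w UNIV) - f x\<bar> \<le> L * real CARD('d)" by simp
  moreover have "w UNIV = y" by (simp add: w_def)
  ultimately show ?thesis by (simp add: abs_minus_commute)
qed

section \<open>Volumes of cubes and the uniform bound for the densities\<close>

lemma unit_cube_cbox: "unit_cube = cbox (0 :: real ^ 'd::finite) 1"
  by (auto simp: unit_cube_def mem_box_cart)

lemma emeasure_cbox_cube:
  assumes "h \<ge> 0" "\<And>i. u $ i = l $ i + h"
  shows "emeasure lborel (cbox l (u :: real ^ 'd::finite)) = ennreal (h ^ CARD('d))"
    "emeasure lborel (box l u) = ennreal (h ^ CARD('d))"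
proof -
  have b: "l \<bullet> b \<le> u \<bullet> b" "(u - l) \<bullet> b = h" if "b \<in> Basis" for b
    using that assms by (auto simp: Basis_vec_def inner_axis)
  have "(\<Prod>b\<in>Basis. (u - l) \<bullet> b) = (\<Prod>b\<in>(Basis :: (real ^ 'd) set). h)"
    by (intro prod.cong refl b)
  then have "(\<Prod>b\<in>Basis. (u - l) \<bullet> b) = h ^ CARD('d)" by simp
  then show "emeasure lborel (cbox l u) = ennreal (h ^ CARD('d))"
    "emeasure lborel (box l u) = ennreal (h ^ CARD('d))"
    using b by (simp_all add: emeasure_lborel_cbox emeasure_lborel_box)
qed

lemma emeasure_unit_cube: "emeasure lborel (unit_cube :: (real ^ 'd::finite) set) = 1"
  unfolding unit_cube_cbox by (subst emeasure_cbox_cube(1)[where h = 1]) auto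

text \<open>On a cube of volume 1, a density of mass 1 cannot exceed 1 everywhere; bounded
  oscillation does the rest.\<close>

lemma holder_density_le:
  fixes f :: "real ^ 'd::finite \<Rightarrow> real"
  assumes s: "s > 0" and L: "L > 0" and f: "holder_density s L P f" and x: "x \<in> unit_cube"
  shows "0 \<le> f x" "f x \<le> 1 + L * real CARD('d)"
proof -
  have cd: "cube_density P f" and hc: "f \<in> holder_class s L" using f by (auto simp: holder_density_def)
  show "0 \<le> f x" using cd x by (simp add: cube_density_def)
  have meas: "(\<lambda>x. ennreal (f x) * indicator unit_cube x) \<in> borel_measurable lborel"
  proof -
    have "(\<lambda>x. ennreal (indicator unit_cube x *\<^sub>R f x)) \<in> borel_measurable lborel"
      using cd by (intro measurable_compose[OF _ measurable_ennreal]) (simp add: cube_density_def set_borel_measurable_def)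
    moreover have "(\<lambda>x. ennreal (indicator unit_cube x *\<^sub>R f x)) = (\<lambda>x. ennreal (f x) * indicator unit_cube x)"
      by (auto simp: indicator_def)
    ultimately show ?thesis by simp
  qed
  have "prob_space P" "P = density lborel (\<lambda>x. ennreal (f x) * indicator unit_cube x)"
    using cd by (auto simp: cube_density_def)
  then have "(\<integral>\<^sup>+x. ennreal (f x) * indicator unit_cube x \<partial>lborel) = 1"
    using prob_space.emeasure_space_1[of P] meas by (simp add: emeasure_density)
  moreover have "(\<integral>\<^sup>+y. ennreal (f x - L * real CARD('d)) * indicator unit_cube (y :: real ^ 'd) \<partial>lborel)
      \<le> (\<integral>\<^sup>+x. ennreal (f x) * indicator unit_cube x \<partial>lborel)"
  proof (rule nn_integral_mono)
    fix y :: "real ^ 'd"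
    show "ennreal (f x - L * real CARD('d)) * indicator unit_cube y \<le> ennreal (f y) * indicator unit_cube y"
      using holder_oscillation_le[OF s L hc x, of y] by (auto simp: indicator_def intro!: ennreal_leI)
  qed
  moreover have "(\<integral>\<^sup>+y. ennreal (f x - L * real CARD('d)) * indicator unit_cube (y :: real ^ 'd) \<partial>lborel) = ennreal (f x - L * real CARD('d))"
  proof -
    have "unit_cube \<in> sets (lborel :: (real ^ 'd) measure)" by (simp add: unit_cube_cbox)
    then show ?thesis by (simp add: nn_integral_cmult_indicator emeasure_unit_cube)
  qed
  ultimately have "ennreal (f x - L * real CARD('d)) \<le> 1" by simp
  then show "f x \<le> 1 + L * real CARD('d)" by simp
qed

section \<open>Binned integrals and translations\<close>

lemma nn_integral_lborel_translate:
  fixes f :: "'a::euclidean_space \<Rightarrow> ennreal"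
  assumes "f \<in> borel_measurable borel"
  shows "(\<integral>\<^sup>+x. f (x + c) \<partial>lborel) = (\<integral>\<^sup>+x. f x \<partial>lborel)"
proof -
  have "(\<integral>\<^sup>+x. f x \<partial>lborel) = (\<integral>\<^sup>+x. f x \<partial>distr lborel borel ((+) c))"
    by (simp add: lborel_distr_plus)
  also have "\<dots> = (\<integral>\<^sup>+x. f (c + x) \<partial>lborel)"
    using assms by (intro nn_integral_distr) auto
  finally show ?thesis by (simp add: add.commute)
qed

text \<open>Squared L2 norm of the increment by \<open>v\<close>. The indicator keeps both end
  points in the cube, so that the jump of a zero extension at the boundary does not count.\<close>

definition shift_energy :: "(real ^ 'd::finite \<Rightarrow> real) \<Rightarrow> real ^ 'd \<Rightarrow> ennreal" where
  "shift_energy g v = (\<integral>\<^sup>+x. ennreal ((g (x + v) - g x)\<^sup>2)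
     * indicator {x. x \<in> unit_cube \<and> x + v \<in> unit_cube} x \<partial>lborel)"

text \<open>Cauchy-Schwarz with \<open>\<bar>a j\<bar>\<close> split into two square roots, so that
  the small total mass appears as a factor.\<close>

lemma weighted_square_le:
  fixes a y :: "nat \<Rightarrow> real"
  assumes "(\<Sum>j\<le>J. \<bar>a j\<bar>) \<le> \<delta>" "\<bar>z\<bar> \<le> (\<Sum>j\<le>J. \<bar>a j\<bar> * \<bar>y j\<bar>) + c" "c \<ge> 0"
  shows "z\<^sup>2 \<le> (\<Sum>j\<le>J. 2 * \<delta> * \<bar>a j\<bar> * (y j)\<^sup>2) + 2 * c\<^sup>2"
proof -
  define S where "S = (\<Sum>j\<le>J. \<bar>a j\<bar> * \<bar>y j\<bar>)"
  have S0: "S \<ge> 0" by (simp add: S_def sum_nonneg)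
  have "S\<^sup>2 = (\<Sum>j\<le>J. sqrt \<bar>a j\<bar> * (sqrt \<bar>a j\<bar> * \<bar>y j\<bar>))\<^sup>2"
    unfolding S_def by (simp add: mult.assoc[symmetric] flip: real_sqrt_mult)
  also have "\<dots> \<le> (\<Sum>j\<le>J. (sqrt \<bar>a j\<bar>)\<^sup>2) * (\<Sum>j\<le>J. (sqrt \<bar>a j\<bar> * \<bar>y j\<bar>)\<^sup>2)"
    by (rule Cauchy_Schwarz_ineq_sum)
  also have "\<dots> = (\<Sum>j\<le>J. \<bar>a j\<bar>) * (\<Sum>j\<le>J. \<bar>a j\<bar> * (y j)\<^sup>2)" by (simp add: power_mult_distrib)
  also have "\<dots> \<le> \<delta> * (\<Sum>j\<le>J. \<bar>a j\<bar> * (y j)\<^sup>2)"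
    using assms(1) by (intro mult_right_mono sum_nonneg) auto
  finally have S2: "S\<^sup>2 \<le> \<delta> * (\<Sum>j\<le>J. \<bar>a j\<bar> * (y j)\<^sup>2)" .
  have "z\<^sup>2 = \<bar>z\<bar>\<^sup>2" by simp
  also have "\<dots> \<le> (S + c)\<^sup>2" using assms(2) by (intro power_mono) (auto simp: S_def)
  also have "\<dots> \<le> 2 * S\<^sup>2 + 2 * c\<^sup>2"
    using zero_le_power2[of "S - c"] by (simp add: power2_eq_square algebra_simps)
  also have "\<dots> \<le> 2 * (\<delta> * (\<Sum>j\<le>J. \<bar>a j\<bar> * (y j)\<^sup>2)) + 2 * c\<^sup>2" using S2 by simp
  also have "2 * (\<delta> * (\<Sum>j\<le>J. \<bar>a j\<bar> * (y j)\<^sup>2)) = (\<Sum>j\<le>J. 2 * \<delta> * \<bar>a j\<bar> * (y j)\<^sup>2)"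
    by (simp add: sum_distrib_left mult.assoc)
  finally show ?thesis .
qed

text \<open>The extrapolation points span a length of at most 1/2, and they fit on the side where
  the coordinate has that much room: forward from \<open>x\<close>, or backward from
  \<open>x + t *\<^sub>R axis i 1\<close> with the step reversed.\<close>

lemma line_room:
  fixes x :: "real ^ 'd"
  assumes x: "x \<in> unit_cube" "x + t *\<^sub>R axis i 1 \<in> unit_cube" and t: "\<bar>t\<bar> * real J \<le> 1 / 2"
  shows "(\<forall>j\<le>J. x + (real j * t) *\<^sub>R axis i 1 \<in> unit_cube)
    \<or> (\<forall>j\<le>J. x + (t - real j * t) *\<^sub>R axis i 1 \<in> unit_cube)"
proof -
  define c where "c = x $ i"
  have line: "x + u *\<^sub>R axis i 1 \<in> unit_cube \<longleftrightarrow> 0 \<le> c + u \<and> c + u \<le> 1" for u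
  proof -
    have "x + u *\<^sub>R axis i 1 \<in> unit_cube \<longleftrightarrow> u \<in> cube_line x i" by (simp add: cube_line_def)
    then show ?thesis unfolding cube_line_eq[OF x(1)] c_def by auto
  qed
  have c: "0 \<le> c" "c \<le> 1" using x(1) by (auto simp: unit_cube_def c_def)
  have ct: "0 \<le> c + t" "c + t \<le> 1" using x(2) line by auto
  have jt: "\<bar>real j * t\<bar> \<le> 1 / 2" "real j * t \<ge> 0 \<longleftrightarrow> j = 0 \<or> t \<ge> 0" "real j * t \<le> 0 \<longleftrightarrow> j = 0 \<or> t \<le> 0" if "j \<le> J" for j
  proof -
    have "\<bar>real j * t\<bar> \<le> \<bar>t\<bar> * real J" using that by (simp add: abs_mult mult.commute mult_left_mono)
    then show "\<bar>real j * t\<bar> \<le> 1 / 2" using t by linarith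
  qed (auto simp: zero_le_mult_iff mult_le_0_iff)
  show ?thesis
  proof (cases "(t \<ge> 0) = (c \<le> 1 / 2)")
    case True
    have "0 \<le> c + real j * t \<and> c + real j * t \<le> 1" if "j \<le> J" for j
      using jt[OF that] True c by (cases "t \<ge> 0"; cases "j = 0") auto
    then show ?thesis unfolding line by blast
  next
    case False
    have "0 \<le> c + (t - real j * t) \<and> c + (t - real j * t) \<le> 1" if "j \<le> J" for j
      using jt[OF that] False c ct by (cases "t \<ge> 0"; cases "j = 0") auto
    then show ?thesis unfolding line by blast
  qed
qed

text \<open>The direction of extrapolation that fits depends on the point, so the sums for both
  directions are added. All translates of the squared function have the same integral
  \<open>E\<close>, which gives \<open>E + E\<close> for each weight.\<close>

lemma axis_shift_energy_le:
  fixes g :: "real ^ 'd::finite \<Rightarrow> real"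
  assumes g [measurable]: "g \<in> borel_measurable borel"
    and E: "(\<integral>\<^sup>+x. ennreal ((g x)\<^sup>2) \<partial>lborel) = ennreal E" "E \<ge> 0"
    and a: "(\<Sum>j\<le>J. \<bar>a j\<bar>) \<le> \<delta>" and c: "c \<ge> 0" and t: "\<bar>t\<bar> * real J \<le> 1 / 2"
    and increment: "\<And>x t'. \<bar>t'\<bar> = \<bar>t\<bar> \<Longrightarrow> (\<And>j. j \<le> J \<Longrightarrow> x + (real j * t') *\<^sub>R axis i 1 \<in> unit_cube) \<Longrightarrow>
      \<bar>g (x + t' *\<^sub>R axis i 1) - g x\<bar> \<le> (\<Sum>j\<le>J. \<bar>a j\<bar> * \<bar>g (x + (real j * t') *\<^sub>R axis i 1)\<bar>) + c"
  shows "shift_energy g (t *\<^sub>R axis i 1) \<le> ennreal (4 * \<delta>\<^sup>2 * E + 2 * c\<^sup>2)"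
proof -
  have \<delta>: "\<delta> \<ge> 0" using a by (meson order_trans sum_nonneg abs_ge_zero)
  let ?p = "\<lambda>x u. x + u *\<^sub>R axis i (1::real)"
  let ?w = "\<lambda>j. ennreal (2 * \<delta> * \<bar>a j\<bar>)"
  let ?e = "\<lambda>x. ennreal ((g x)\<^sup>2)"
  have pointwise: "ennreal ((g (?p x t) - g x)\<^sup>2) * indicator {x. x \<in> unit_cube \<and> ?p x t \<in> unit_cube} x
      \<le> (\<Sum>j\<le>J. ?w j * (?e (?p x (real j * t)) + ?e (?p x (t - real j * t)))) + ennreal (2 * c\<^sup>2) * indicator unit_cube x"
    for x
  proof (cases "x \<in> unit_cube \<and> ?p x t \<in> unit_cube")
    case True
    have "(g (?p x t) - g x)\<^sup>2
        \<le> (\<Sum>j\<le>J. 2 * \<delta> * \<bar>a j\<bar> * ((g (?p x (real j * t)))\<^sup>2 + (g (?p x (t - real j * t)))\<^sup>2)) + 2 * c\<^sup>2"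
    proof -
      consider "\<forall>j\<le>J. ?p x (real j * t) \<in> unit_cube" | "\<forall>j\<le>J. ?p x (t - real j * t) \<in> unit_cube"
        using line_room[of x t i J] True t by blast
      then show ?thesis
      proof cases
        case 1
        have "(g (?p x t) - g x)\<^sup>2 \<le> (\<Sum>j\<le>J. 2 * \<delta> * \<bar>a j\<bar> * (g (?p x (real j * t)))\<^sup>2) + 2 * c\<^sup>2"
          using 1 by (intro weighted_square_le a c increment) auto
        also have "(\<Sum>j\<le>J. 2 * \<delta> * \<bar>a j\<bar> * (g (?p x (real j * t)))\<^sup>2)
            \<le> (\<Sum>j\<le>J. 2 * \<delta> * \<bar>a j\<bar> * ((g (?p x (real j * t)))\<^sup>2 + (g (?p x (t - real j * t)))\<^sup>2))"
          using \<delta> by (intro sum_mono mult_left_mono) auto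
        finally show ?thesis by simp
      next
        case 2
        have q: "?p (?p x t) (real j * (- t)) = ?p x (t - real j * t)" for j
          by (simp add: scaleR_diff_left add.assoc)
        have "\<bar>g (?p (?p x t) (- t)) - g (?p x t)\<bar> \<le> (\<Sum>j\<le>J. \<bar>a j\<bar> * \<bar>g (?p (?p x t) (real j * (- t)))\<bar>) + c"
          using 2 by (intro increment) (simp_all only: q abs_minus)
        then have "\<bar>g x - g (?p x t)\<bar> \<le> (\<Sum>j\<le>J. \<bar>a j\<bar> * \<bar>g (?p x (t - real j * t))\<bar>) + c"
          unfolding q by simp
        then have "(g x - g (?p x t))\<^sup>2 \<le> (\<Sum>j\<le>J. 2 * \<delta> * \<bar>a j\<bar> * (g (?p x (t - real j * t)))\<^sup>2) + 2 * c\<^sup>2"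
          by (intro weighted_square_le a c)
        also have "(\<Sum>j\<le>J. 2 * \<delta> * \<bar>a j\<bar> * (g (?p x (t - real j * t)))\<^sup>2)
            \<le> (\<Sum>j\<le>J. 2 * \<delta> * \<bar>a j\<bar> * ((g (?p x (real j * t)))\<^sup>2 + (g (?p x (t - real j * t)))\<^sup>2))"
          using \<delta> by (intro sum_mono mult_left_mono) auto
        finally show ?thesis by (simp add: power2_commute)
      qed
    qed
    then have "ennreal ((g (?p x t) - g x)\<^sup>2)
        \<le> ennreal ((\<Sum>j\<le>J. 2 * \<delta> * \<bar>a j\<bar> * ((g (?p x (real j * t)))\<^sup>2 + (g (?p x (t - real j * t)))\<^sup>2)) + 2 * c\<^sup>2)"
      by (rule ennreal_leI)
    also have "\<dots> = (\<Sum>j\<le>J. ?w j * (?e (?p x (real j * t)) + ?e (?p x (t - real j * t)))) + ennreal (2 * c\<^sup>2)"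
      using \<delta> by (simp add: ennreal_plus sum_nonneg sum_ennreal[symmetric] ennreal_mult)
    finally show ?thesis using True by simp
  qed simp
  have "shift_energy g (t *\<^sub>R axis i 1) \<le> (\<integral>\<^sup>+x. (\<Sum>j\<le>J. ?w j * (?e (?p x (real j * t)) + ?e (?p x (t - real j * t))))
      + ennreal (2 * c\<^sup>2) * indicator unit_cube x \<partial>lborel)"
    unfolding shift_energy_def by (intro nn_integral_mono pointwise)
  also have "\<dots> = (\<Sum>j\<le>J. ?w j * ((\<integral>\<^sup>+x. ?e (?p x (real j * t)) \<partial>lborel) + (\<integral>\<^sup>+x. ?e (?p x (t - real j * t)) \<partial>lborel)))
      + ennreal (2 * c\<^sup>2) * emeasure lborel (unit_cube :: (real ^ 'd) set)"
    by (simp add: nn_integral_add nn_integral_sum nn_integral_cmult nn_integral_cmult_indicator unit_cube_cbox)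
  also have "\<dots> = (\<Sum>j\<le>J. ?w j * (ennreal E + ennreal E)) + ennreal (2 * c\<^sup>2)"
    by (simp add: nn_integral_lborel_translate[of ?e] E emeasure_unit_cube)
  also have "\<dots> = ennreal ((\<Sum>j\<le>J. 2 * \<delta> * \<bar>a j\<bar> * (E + E)) + 2 * c\<^sup>2)"
  proof -
    have "?w j * (ennreal E + ennreal E) = ennreal (2 * \<delta> * \<bar>a j\<bar> * (E + E))" for j
      using \<delta> E(2) by (subst ennreal_plus[symmetric], simp, simp, subst ennreal_mult[symmetric]) auto
    then show ?thesis using \<delta> E(2) by (simp only: ) (subst sum_ennreal, simp, subst ennreal_plus, auto intro!: sum_nonneg)
  qed
  also have "\<dots> \<le> ennreal (4 * \<delta>\<^sup>2 * E + 2 * c\<^sup>2)"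
  proof (intro ennreal_leI add_right_mono)
    have "(\<Sum>j\<le>J. 2 * \<delta> * \<bar>a j\<bar> * (E + E)) = 4 * \<delta> * E * (\<Sum>j\<le>J. \<bar>a j\<bar>)"
      by (simp add: sum_distrib_left mult_ac)
    also have "\<dots> \<le> 4 * \<delta> * E * \<delta>" using a \<delta> E(2) by (intro mult_left_mono) auto
    finally show "(\<Sum>j\<le>J. 2 * \<delta> * \<bar>a j\<bar> * (E + E)) \<le> 4 * \<delta>\<^sup>2 * E" by (simp add: power2_eq_square mult_ac)
  qed
  finally show ?thesis .
qed

text \<open>The coordinates of \<open>v\<close> are switched on one at a time. By (p + q)^2 <= 2 p^2
  + 2 q^2 the factor obeys r' = 2 r + 2, whose solution starting from 0 is
  \<open>2 ^ (card A + 1) - 2\<close>.\<close>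

lemma shift_energy_le:
  fixes g :: "real ^ 'd::finite \<Rightarrow> real"
  assumes g [measurable]: "g \<in> borel_measurable borel" and b: "b \<ge> 0"
    and axis: "\<And>i t. \<bar>t\<bar> \<le> h \<Longrightarrow> shift_energy g (t *\<^sub>R axis i 1) \<le> ennreal b"
    and v: "\<And>i. \<bar>v $ i\<bar> \<le> h"
  shows "shift_energy g v \<le> ennreal (2 ^ (CARD('d) + 1) * b)"
proof -
  define u where "u A = (\<chi> i. if i \<in> A then v $ i else 0)" for A
  have "shift_energy g (u A) \<le> ennreal ((2 ^ (card A + 1) - 2) * b)" if "finite A" for A
    using that
  proof (induction A)
    case empty
    have "u {} = 0" by (simp add: u_def vec_eq_iff)
    then show ?case by (simp add: shift_energy_def)
  next
    case (insert i A)
    let ?e = "(v $ i) *\<^sub>R axis i (1::real)"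
    have u: "u (insert i A) = u A + ?e"
      unfolding vec_eq_iff axis_nth using insert by (auto simp: u_def)
    let ?F = "\<lambda>x. ennreal ((g (x + u A) - g x)\<^sup>2) * indicator {x. x \<in> unit_cube \<and> x + u A \<in> unit_cube} x"
    let ?H = "\<lambda>x. ennreal ((g (x + ?e) - g x)\<^sup>2) * indicator {x. x \<in> unit_cube \<and> x + ?e \<in> unit_cube} x"
    have "shift_energy g (u (insert i A)) \<le> (\<integral>\<^sup>+x. 2 * ?F x + 2 * ?H (x + u A) \<partial>lborel)"
      unfolding shift_energy_def
    proof (rule nn_integral_mono)
      fix x
      show "ennreal ((g (x + u (insert i A)) - g x)\<^sup>2)
          * indicator {x. x \<in> unit_cube \<and> x + u (insert i A) \<in> unit_cube} x \<le> 2 * ?F x + 2 * ?H (x + u A)"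
      proof (cases "x \<in> unit_cube \<and> x + u (insert i A) \<in> unit_cube")
        case True
        \<comment> \<open>Each coordinate of this point is that of one of the two end points, and
          the cube is a product.\<close>
        have "x + u A \<in> unit_cube"
          unfolding unit_cube_def
        proof (intro CollectI allI)
          fix j
          have "0 \<le> x $ j \<and> x $ j \<le> 1" "0 \<le> x $ j + u (insert i A) $ j \<and> x $ j + u (insert i A) $ j \<le> 1"
            using True by (auto simp: unit_cube_def)
          then show "0 \<le> (x + u A) $ j \<and> (x + u A) $ j \<le> 1" by (auto simp: u_def split: if_splits)
        qed
        moreover have "x + u A + ?e \<in> unit_cube" using True unfolding u by (simp add: add.assoc)
        moreover have "ennreal ((g (x + u A + ?e) - g x)\<^sup>2)
            \<le> 2 * ennreal ((g (x + u A) - g x)\<^sup>2) + 2 * ennreal ((g (x + u A + ?e) - g (x + u A))\<^sup>2)"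
        proof -
          have "(g (x + u A + ?e) - g x)\<^sup>2 \<le> 2 * (g (x + u A) - g x)\<^sup>2 + 2 * (g (x + u A + ?e) - g (x + u A))\<^sup>2"
            using zero_le_power2[of "(g (x + u A) - g x) - (g (x + u A + ?e) - g (x + u A))"]
            by (simp add: power2_eq_square algebra_simps)
          then have "ennreal ((g (x + u A + ?e) - g x)\<^sup>2)
            \<le> ennreal (2 * (g (x + u A) - g x)\<^sup>2 + 2 * (g (x + u A + ?e) - g (x + u A))\<^sup>2)"
            by (rule ennreal_leI)
          also have "\<dots> = 2 * ennreal ((g (x + u A) - g x)\<^sup>2) + 2 * ennreal ((g (x + u A + ?e) - g (x + u A))\<^sup>2)"
            by (simp add: ennreal_plus ennreal_mult)
          finally show ?thesis .
        qed
        ultimately show ?thesis using True unfolding u by (simp add: add.assoc)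
      qed simp
    qed
    also have "\<dots> = 2 * (\<integral>\<^sup>+x. ?F x \<partial>lborel) + 2 * (\<integral>\<^sup>+x. ?H (x + u A) \<partial>lborel)"
      by (subst nn_integral_add; (measurable; fail)?) (simp add: nn_integral_cmult)
    also have "(\<integral>\<^sup>+x. ?H (x + u A) \<partial>lborel) = (\<integral>\<^sup>+x. ?H x \<partial>lborel)"
      by (rule nn_integral_lborel_translate) measurable
    also have "2 * (\<integral>\<^sup>+x. ?F x \<partial>lborel) + 2 * (\<integral>\<^sup>+x. ?H x \<partial>lborel)
        = 2 * shift_energy g (u A) + 2 * shift_energy g ?e"
      by (simp only: shift_energy_def)
    also have "\<dots> \<le> 2 * ennreal ((2 ^ (card A + 1) - 2) * b) + 2 * ennreal b"
      using insert.IH axis[OF v] by (intro add_mono mult_left_mono) auto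
    also have "\<dots> = ennreal (2 * ((2 ^ (card A + 1) - 2) * b) + 2 * b)"
      using b by (subst ennreal_plus) (auto simp: ennreal_mult)
    also have "2 * ((2 ^ (card A + 1) - 2) * b) + 2 * b = (2 ^ (card (insert i A) + 1) - 2) * b"
      using insert by (simp add: algebra_simps)
    finally show ?case .
  qed
  from this[of UNIV] have "shift_energy g (u UNIV) \<le> ennreal ((2 ^ (CARD('d) + 1) - 2) * b)" by simp
  also have "\<dots> \<le> ennreal (2 ^ (CARD('d) + 1) * b)" using b by (intro ennreal_leI mult_right_mono) auto
  also have "u UNIV = v" by (simp add: u_def vec_eq_iff)
  finally show ?thesis .
qed

text \<open>A bin lies between an open and a closed box of the same volume, whichever of its faces
  it contains.\<close>

lemma emeasure_bin:
  assumes "\<kappa> \<ge> 1" and k: "k \<in> (bin_indices \<kappa> :: (nat ^ 'd::finite) set)"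
  shows "emeasure lborel (bin \<kappa> k) = ennreal ((1 / real \<kappa>) ^ CARD('d))"
proof -
  define l u :: "real ^ 'd" where "l = (\<chi> i. real (k $ i) / real \<kappa>)" and "u = (\<chi> i. real (k $ i + 1) / real \<kappa>)"
  have lu: "u $ i = l $ i + 1 / real \<kappa>" "0 \<le> l $ i" "u $ i \<le> 1" "k $ i + 1 = \<kappa> \<Longrightarrow> u $ i = 1" for i
  proof -
    show "u $ i = l $ i + 1 / real \<kappa>" by (simp add: l_def u_def add_divide_distrib)
    have "k $ i + 1 \<le> \<kappa>" using k by (simp add: bin_indices_def Suc_leI)
    then have "real (k $ i + 1) \<le> real \<kappa>" by (simp only: of_nat_le_iff)
    then show "u $ i \<le> 1" unfolding u_def using assms(1) by simp
    show "u $ i = 1" if "k $ i + 1 = \<kappa>" unfolding u_def using assms(1) that by simp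
  qed (simp add: l_def)
  have bin: "bin \<kappa> k = {x \<in> unit_cube. \<forall>i. l $ i \<le> x $ i \<and> (x $ i < u $ i \<or> k $ i + 1 = \<kappa>)}"
    by (simp add: bin_def l_def u_def)
  have "box l u \<subseteq> bin \<kappa> k"
  proof
    fix x assume "x \<in> box l u"
    then have x: "l $ i < x $ i" "x $ i < u $ i" for i by (auto simp: mem_box_cart)
    have "0 \<le> x $ i \<and> x $ i \<le> 1" for i using x[of i] lu(2,3)[of i] by linarith
    then show "x \<in> bin \<kappa> k" unfolding bin using x by (auto simp: unit_cube_def less_imp_le)
  qed
  moreover have "bin \<kappa> k \<subseteq> cbox l u"
  proof
    fix x assume x: "x \<in> bin \<kappa> k"
    have "l $ i \<le> x $ i \<and> x $ i \<le> u $ i" for i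
    proof -
      have "l $ i \<le> x $ i \<and> (x $ i < u $ i \<or> k $ i + 1 = \<kappa>)" "x $ i \<le> 1"
        using x unfolding bin unit_cube_def by blast+
      then show ?thesis using lu(4)[of i] by auto
    qed
    then show "x \<in> cbox l u" by (simp add: mem_box_cart)
  qed
  ultimately have "emeasure lborel (box l u) \<le> emeasure lborel (bin \<kappa> k)"
      "emeasure lborel (bin \<kappa> k) \<le> emeasure lborel (cbox l u)"
    using bin_borel[of \<kappa> k] by (auto intro!: emeasure_mono)
  moreover have "emeasure lborel (box l u) = ennreal ((1 / real \<kappa>) ^ CARD('d))"
    by (rule emeasure_cbox_cube(2)) (simp_all add: lu(1))
  moreover have "emeasure lborel (cbox l u) = ennreal ((1 / real \<kappa>) ^ CARD('d))"
    by (rule emeasure_cbox_cube(1)) (simp_all add: lu(1))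
  ultimately show ?thesis by (metis antisym)
qed

section \<open>Bin integrals and the energy of shifts\<close>

lemma integrable_bounded_on:
  fixes \<phi> :: "'a::euclidean_space \<Rightarrow> real"
  assumes "\<phi> \<in> borel_measurable borel" "\<And>x. \<bar>\<phi> x\<bar> \<le> c" "B \<in> sets borel" "emeasure lborel B < \<infinity>"
  shows "integrable lborel (\<lambda>y. \<phi> y * indicator B y)"
proof (rule Bochner_Integration.integrable_bound)
  show "integrable lborel (\<lambda>y. c * indicator B y)"
    using assms by (intro integrable_mult_right integrable_real_indicator) auto
  have c: "0 \<le> c" using assms(2) by (meson abs_ge_zero order_trans)
  show "AE x in lborel. norm (\<phi> x * indicator B x) \<le> norm (c * indicator B x)"
    using assms(2) c by (intro AE_I2) (auto simp: indicator_def)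
qed (use assms in measurable)

text \<open>The variance identity on \<open>B\<close>, with a nonnegative integral on the left so
  that it can be summed and its order of integration exchanged freely.\<close>

lemma double_integral_square_difference:
  fixes g :: "'a::euclidean_space \<Rightarrow> real"
  assumes g [measurable]: "g \<in> borel_measurable borel" and gc: "\<And>x. \<bar>g x\<bar> \<le> c"
    and B [measurable]: "B \<in> sets borel" and \<beta>: "emeasure lborel B = ennreal \<beta>" "\<beta> \<ge> 0"
  defines "I \<equiv> \<integral>x. g x * indicator B x \<partial>lborel" and "Q \<equiv> \<integral>x. (g x)\<^sup>2 * indicator B x \<partial>lborel"
  shows "(\<integral>\<^sup>+x. \<integral>\<^sup>+y. ennreal ((g x - g y)\<^sup>2) * indicator B x * indicator B y \<partial>lborel \<partial>lborel)
    = ennreal (2 * \<beta> * Q - 2 * I\<^sup>2)"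
proof -
  have fin: "emeasure lborel B < \<infinity>" using \<beta> by simp
  have g2: "\<bar>(g x)\<^sup>2\<bar> \<le> c\<^sup>2" for x using gc[of x] power_mono[of "\<bar>g x\<bar>" c 2] by simp
  have int_g: "integrable lborel (\<lambda>y. g y * indicator B y)"
    by (rule integrable_bounded_on[OF g gc B fin])
  have int_g2: "integrable lborel (\<lambda>y. (g y)\<^sup>2 * indicator B y)"
    by (rule integrable_bounded_on[OF _ g2 B fin]) measurable
  have int_1: "integrable lborel (indicator B :: 'a \<Rightarrow> real)"
    using fin by (intro integrable_real_indicator) auto
  have cB: "measure lborel B = \<beta>" using \<beta> by (simp add: measure_def)
  then have mB: "(\<integral>y. indicator B y \<partial>lborel) = \<beta>" by simp
  have eq: "(g x - g y)\<^sup>2 * indicator B y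
      = (g x)\<^sup>2 * indicator B y - 2 * g x * (g y * indicator B y) + (g y)\<^sup>2 * indicator B y" for x y
    by (simp add: power2_eq_square algebra_simps)
  have int_diff: "integrable lborel (\<lambda>y. (g x - g y)\<^sup>2 * indicator B y)" for x
    unfolding eq by (intro Bochner_Integration.integrable_add Bochner_Integration.integrable_diff
        integrable_mult_right int_1 int_g int_g2)
  have diff: "(\<integral>y. (g x - g y)\<^sup>2 * indicator B y \<partial>lborel) = \<beta> * (g x)\<^sup>2 - 2 * I * g x + Q" for x
    unfolding eq I_def Q_def mB[symmetric] by (simp add: int_1 int_g int_g2)
  have inner: "(\<integral>\<^sup>+y. ennreal ((g x - g y)\<^sup>2) * indicator B x * indicator B y \<partial>lborel)
      = ennreal ((\<beta> * (g x)\<^sup>2 - 2 * I * g x + Q) * indicator B x)" for x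
  proof (cases "x \<in> B")
    case True
    then have "(\<integral>\<^sup>+y. ennreal ((g x - g y)\<^sup>2) * indicator B x * indicator B y \<partial>lborel)
        = (\<integral>\<^sup>+y. ennreal ((g x - g y)\<^sup>2 * indicator B y) \<partial>lborel)"
      by (intro nn_integral_cong) (auto simp: indicator_def)
    also have "\<dots> = ennreal (\<integral>y. (g x - g y)\<^sup>2 * indicator B y \<partial>lborel)"
      by (rule nn_integral_eq_integral[OF int_diff]) auto
    finally show ?thesis using True by (simp add: diff)
  qed simp
  let ?q = "\<lambda>x. (\<beta> * (g x)\<^sup>2 - 2 * I * g x + Q) * indicator B x"
  have q_eq: "?q x = \<beta> * ((g x)\<^sup>2 * indicator B x) - 2 * I * (g x * indicator B x) + Q * indicator B x" for x
    by (simp add: algebra_simps)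
  have int: "integrable lborel ?q"
    unfolding q_eq by (intro Bochner_Integration.integrable_add Bochner_Integration.integrable_diff
        integrable_mult_right int_1 int_g int_g2)
  have nonneg: "0 \<le> ?q x" for x
    unfolding diff[symmetric] by (intro mult_nonneg_nonneg Bochner_Integration.integral_nonneg) auto
  have "(\<integral>\<^sup>+x. ennreal (?q x) \<partial>lborel) = ennreal (\<integral>x. ?q x \<partial>lborel)"
    by (rule nn_integral_eq_integral[OF int]) (simp add: nonneg)
  also have "(\<integral>x. ?q x \<partial>lborel) = \<beta> * Q - 2 * I * I + Q * \<beta>"
    unfolding q_eq by (simp add: int_1 int_g int_g2 cB flip: I_def Q_def)
  also have "\<beta> * Q - 2 * I * I + Q * \<beta> = 2 * \<beta> * Q - 2 * I\<^sup>2" by (simp add: power2_eq_square)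
  finally show ?thesis unfolding inner .
qed

text \<open>\<open>ennreal\<close> truncates negative terms to 0, which can only enlarge the
  right-hand side.\<close>

lemma ennreal_sum_le: "ennreal (\<Sum>k\<in>A. f k) \<le> (\<Sum>k\<in>A. ennreal (f k))"
proof -
  have "ennreal (\<Sum>k\<in>A. f k) \<le> ennreal (\<Sum>k\<in>A. max 0 (f k))"
    by (intro ennreal_leI sum_mono) simp
  also have "\<dots> = (\<Sum>k\<in>A. ennreal (max 0 (f k)))" by (rule sum_ennreal[symmetric]) simp
  also have "\<dots> = (\<Sum>k\<in>A. ennreal (f k))" by (intro sum.cong refl) (simp add: max_def ennreal_neg)
  finally show ?thesis .
qed

lemma sum_indicator_bins:
  assumes "\<kappa> \<ge> 1"
  shows "(\<Sum>k\<in>bin_indices \<kappa>. indicator (bin \<kappa> k) x) = (indicator (unit_cube :: (real ^ 'd::finite) set) x :: real)"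
proof (cases "x \<in> unit_cube")
  case True
  then obtain k where k: "k \<in> bin_indices \<kappa>" "x \<in> bin \<kappa> k" using bin_cover assms by blast
  have "(\<Sum>l\<in>bin_indices \<kappa>. indicator (bin \<kappa> l) x) = (\<Sum>l\<in>bin_indices \<kappa>. if l = k then 1 else (0::real))"
    using k bin_unique by (intro sum.cong refl) (auto simp: indicator_def)
  then show ?thesis using k True by (simp add: finite_bin_indices)
next
  case False
  then have "x \<notin> bin \<kappa> k" for k by (simp add: bin_def)
  then show ?thesis using False by simp
qed

lemma same_bin_close:
  assumes "x \<in> bin \<kappa> k" "y \<in> bin \<kappa> k" "\<kappa> \<ge> 1"
  shows "\<bar>y $ i - x $ i\<bar> \<le> 1 / real \<kappa>"
proof -
  have "real (k $ i) / real \<kappa> \<le> z $ i \<and> z $ i \<le> real (k $ i) / real \<kappa> + 1 / real \<kappa>" if "z \<in> bin \<kappa> k" for z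
  proof -
    have "z $ i \<le> 1" "real (k $ i) / real \<kappa> \<le> z $ i" using that by (auto simp: bin_def unit_cube_def)
    moreover have "z $ i < real (k $ i + 1) / real \<kappa> \<or> k $ i + 1 = \<kappa>" using that by (simp add: bin_def)
    moreover have "real (k $ i + 1) / real \<kappa> = real (k $ i) / real \<kappa> + 1 / real \<kappa>" by (simp add: add_divide_distrib)
    moreover have "k $ i + 1 = \<kappa> \<Longrightarrow> real (k $ i + 1) / real \<kappa> = 1" using assms(3) by simp
    ultimately show ?thesis by auto
  qed
  from this[OF assms(1)] this[OF assms(2)] show ?thesis by linarith
qed

text \<open>On each bin \<open>B\<close> of volume \<open>h\<^sup>d\<close>, the square of \<open>\<integral>\<^sub>B g\<close> is \<open>h\<^sup>d \<integral>\<^sub>B g\<^sup>2\<close> minus half the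
  double integral of \<open>(g x - g y)\<^sup>2\<close> over \<open>B \<times> B\<close>; the sum of these double integrals only involves
  shifts of \<open>g\<close> by vectors in \<open>[-h, h]\<^sup>d\<close>.\<close>

lemma sum_bin_integrals_ge:
  fixes g :: "real ^ 'd::finite \<Rightarrow> real"
  assumes g [measurable]: "g \<in> borel_measurable borel" and gc: "\<And>x. \<bar>g x\<bar> \<le> c"
    and zero: "\<And>x. x \<notin> unit_cube \<Longrightarrow> g x = 0"
    and \<kappa>: "\<kappa> \<ge> 1" and b: "b \<ge> 0"
    and axis: "\<And>i t. \<bar>t\<bar> \<le> 1 / real \<kappa> \<Longrightarrow> shift_energy g (t *\<^sub>R axis i 1) \<le> ennreal b"
  shows "(\<Sum>k\<in>bin_indices \<kappa>. (\<integral>x. g x * indicator (bin \<kappa> k) x \<partial>lborel)\<^sup>2)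
    \<ge> (1 / real \<kappa>) ^ CARD('d) * ((\<integral>x. (g x)\<^sup>2 \<partial>lborel) - 4 ^ CARD('d) * b)"
proof -
  let ?K = "bin_indices \<kappa> :: (nat ^ 'd) set"
  define h where "h = 1 / real \<kappa>"
  have h: "h \<ge> 0" by (simp add: h_def)
  define \<beta> where "\<beta> = h ^ CARD('d)"
  have \<beta>: "\<beta> \<ge> 0" using h by (simp add: \<beta>_def)
  define I where "I k = (\<integral>x. g x * indicator (bin \<kappa> k) x \<partial>lborel)" for k
  define Q where "Q k = (\<integral>x. (g x)\<^sup>2 * indicator (bin \<kappa> k) x \<partial>lborel)" for k
  have vol: "emeasure lborel (bin \<kappa> k) = ennreal \<beta>" if "k \<in> ?K" for k
    using emeasure_bin[OF \<kappa> that] by (simp add: \<beta>_def h_def)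
  have g2: "\<bar>(g x)\<^sup>2\<bar> \<le> c\<^sup>2" for x using gc[of x] power_mono[of "\<bar>g x\<bar>" c 2] by simp
  have Q: "(\<Sum>k\<in>?K. Q k) = (\<integral>x. (g x)\<^sup>2 \<partial>lborel)"
  proof -
    have "(\<Sum>k\<in>?K. Q k) = (\<integral>x. (\<Sum>k\<in>?K. (g x)\<^sup>2 * indicator (bin \<kappa> k) x) \<partial>lborel)"
      unfolding Q_def
    proof (rule Bochner_Integration.integral_sum[symmetric])
      show "integrable lborel (\<lambda>x. (g x)\<^sup>2 * indicator (bin \<kappa> k) x)" if "k \<in> ?K" for k
        by (rule integrable_bounded_on[OF _ g2 bin_borel]) (measurable, simp add: vol[OF that])
    qed
    also have "\<dots> = (\<integral>x. (g x)\<^sup>2 \<partial>lborel)"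
      unfolding sum_distrib_left[symmetric] sum_indicator_bins[OF \<kappa>]
      using zero by (intro Bochner_Integration.integral_cong refl) (auto simp: indicator_def)
    finally show ?thesis .
  qed
  \<comment> \<open>Differences of two points of one bin lie in this box of volume (2 h)^d.\<close>
  let ?V = "cbox (\<chi> i. - h) (\<chi> i. h) :: (real ^ 'd) set"
  have V: "emeasure lborel ?V = ennreal ((2 * h) ^ CARD('d))"
    by (rule emeasure_cbox_cube(1)) (use h in auto)
  let ?f = "\<lambda>x v. ennreal ((g (x + v) - g x)\<^sup>2) * indicator {x. x \<in> unit_cube \<and> x + v \<in> unit_cube} x * indicator ?V v"
  have f_meas: "case_prod ?f \<in> borel_measurable (lborel \<Otimes>\<^sub>M lborel)"
    "(\<lambda>(v, x). ?f x v) \<in> borel_measurable (lborel \<Otimes>\<^sub>M lborel)"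
    unfolding indicator_def by measurable
  have "ennreal (\<Sum>k\<in>?K. 2 * \<beta> * Q k - 2 * (I k)\<^sup>2) \<le> (\<Sum>k\<in>?K. ennreal (2 * \<beta> * Q k - 2 * (I k)\<^sup>2))"
    by (rule ennreal_sum_le)
  also have "\<dots> = (\<Sum>k\<in>?K. \<integral>\<^sup>+x. \<integral>\<^sup>+y. ennreal ((g x - g y)\<^sup>2) * indicator (bin \<kappa> k) x * indicator (bin \<kappa> k) y \<partial>lborel \<partial>lborel)"
    unfolding I_def Q_def
    by (intro sum.cong refl double_integral_square_difference[symmetric, OF g gc bin_borel] vol \<beta>)
  also have "\<dots> = (\<integral>\<^sup>+x. \<integral>\<^sup>+y. (\<Sum>k\<in>?K. ennreal ((g x - g y)\<^sup>2) * indicator (bin \<kappa> k) x * indicator (bin \<kappa> k) y) \<partial>lborel \<partial>lborel)"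
  proof -
    let ?q = "\<lambda>k x y. ennreal ((g x - g y)\<^sup>2) * indicator (bin \<kappa> k) x * indicator (bin \<kappa> k) y"
    have "(\<Sum>k\<in>?K. \<integral>\<^sup>+x. \<integral>\<^sup>+y. ?q k x y \<partial>lborel \<partial>lborel) = (\<integral>\<^sup>+x. (\<Sum>k\<in>?K. \<integral>\<^sup>+y. ?q k x y \<partial>lborel) \<partial>lborel)"
      by (rule nn_integral_sum[symmetric]) measurable
    also have "\<dots> = (\<integral>\<^sup>+x. \<integral>\<^sup>+y. (\<Sum>k\<in>?K. ?q k x y) \<partial>lborel \<partial>lborel)"
      by (rule nn_integral_cong, rule nn_integral_sum[symmetric]) measurable
    finally show ?thesis .
  qed
  \<comment> \<open>Two points share at most one bin, so the sum has at most one nonzero term. The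
    bins are then forgotten, and only \<open>y - x \<in> ?V\<close> is kept.\<close>
  also have "\<dots> \<le> (\<integral>\<^sup>+x. \<integral>\<^sup>+y. ?f x (y - x) \<partial>lborel \<partial>lborel)"
  proof (intro nn_integral_mono)
    fix x y :: "real ^ 'd"
    show "(\<Sum>k\<in>?K. ennreal ((g x - g y)\<^sup>2) * indicator (bin \<kappa> k) x * indicator (bin \<kappa> k) y) \<le> ?f x (y - x)"
    proof (cases "\<exists>k\<in>?K. x \<in> bin \<kappa> k \<and> y \<in> bin \<kappa> k")
      case True
      then obtain k where k: "k \<in> ?K" "x \<in> bin \<kappa> k" "y \<in> bin \<kappa> k" by blast
      have cube: "x \<in> unit_cube" "y \<in> unit_cube" using k by (auto simp: bin_def)
      have "y - x \<in> ?V"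
      proof -
        have "- h \<le> (y - x) $ i \<and> (y - x) $ i \<le> h" for i
          using same_bin_close[OF k(2,3) \<kappa>, of i] unfolding h_def[symmetric] vector_minus_component by linarith
        then show ?thesis by (simp add: mem_box_cart)
      qed
      moreover have "(\<Sum>l\<in>?K. ennreal ((g x - g y)\<^sup>2) * indicator (bin \<kappa> l) x * indicator (bin \<kappa> l) y)
          = (\<Sum>l\<in>?K. if l = k then ennreal ((g x - g y)\<^sup>2) else 0)"
        using k bin_unique by (intro sum.cong refl) (auto simp: indicator_def)
      ultimately show ?thesis using cube k(1) by (simp add: finite_bin_indices power2_commute)
    next
      case False
      then have "(\<Sum>k\<in>?K. ennreal ((g x - g y)\<^sup>2) * indicator (bin \<kappa> k) x * indicator (bin \<kappa> k) y) = 0"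
        by (intro sum.neutral) (auto simp: indicator_def)
      then show ?thesis by simp
    qed
  qed
  also have "\<dots> = (\<integral>\<^sup>+x. \<integral>\<^sup>+v. ?f x v \<partial>lborel \<partial>lborel)"
  proof (rule nn_integral_cong)
    fix x :: "real ^ 'd"
    have "(\<lambda>v. ?f x v) \<in> borel_measurable borel" unfolding indicator_def by measurable
    from nn_integral_lborel_translate[OF this, of "- x"]
    show "(\<integral>\<^sup>+y. ?f x (y - x) \<partial>lborel) = (\<integral>\<^sup>+v. ?f x v \<partial>lborel)" by simp
  qed
  also have "\<dots> = (\<integral>\<^sup>+v. \<integral>\<^sup>+x. ?f x v \<partial>lborel \<partial>lborel)"
    by (rule lborel_pair.Fubini'[symmetric]) (rule f_meas)
  also have "\<dots> = (\<integral>\<^sup>+v. shift_energy g v * indicator ?V v \<partial>lborel)"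
    unfolding shift_energy_def by (intro nn_integral_cong nn_integral_multc) (unfold indicator_def, measurable)
  also have "\<dots> \<le> (\<integral>\<^sup>+v. ennreal (2 ^ (CARD('d) + 1) * b) * indicator ?V v \<partial>lborel)"
  proof (rule nn_integral_mono)
    fix v :: "real ^ 'd"
    show "shift_energy g v * indicator ?V v \<le> ennreal (2 ^ (CARD('d) + 1) * b) * indicator ?V v"
    proof (cases "v \<in> ?V")
      case True
      then have "- h \<le> v $ i \<and> v $ i \<le> h" for i by (simp add: mem_box_cart)
      then have "\<bar>v $ i\<bar> \<le> h" for i by (simp add: abs_le_iff minus_le_iff)
      then have "shift_energy g v \<le> ennreal (2 ^ (CARD('d) + 1) * b)"
        using axis by (intro shift_energy_le[OF g b, of h]) (auto simp: h_def)
      then show ?thesis using True by simp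
    qed simp
  qed
  also have "\<dots> = ennreal (2 ^ (CARD('d) + 1) * b) * ennreal ((2 * h) ^ CARD('d))"
    by (simp add: nn_integral_cmult_indicator V)
  \<comment> \<open>The factor 2^(d + 1) of \<open>shift_energy_le\<close> and the volume (2 h)^d
    combine to 2 * 4^d * h^d.\<close>
  also have "\<dots> = ennreal (2 * (4 ^ CARD('d) * b * \<beta>))"
  proof -
    have "(4::real) ^ CARD('d) = 2 ^ CARD('d) * 2 ^ CARD('d)" by (simp flip: power_mult_distrib)
    then show ?thesis using b h by (simp add: \<beta>_def power_mult_distrib mult_ac flip: ennreal_mult)
  qed
  finally have "(\<Sum>k\<in>?K. 2 * \<beta> * Q k - 2 * (I k)\<^sup>2) \<le> 2 * (4 ^ CARD('d) * b * \<beta>)"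
    using b \<beta> by (simp add: ennreal_le_iff)
  then have "2 * \<beta> * (\<integral>x. (g x)\<^sup>2 \<partial>lborel) - 2 * (\<Sum>k\<in>?K. (I k)\<^sup>2) \<le> 2 * (4 ^ CARD('d) * b * \<beta>)"
    by (simp add: sum_subtractf Q flip: sum_distrib_left)
  then have "\<beta> * ((\<integral>x. (g x)\<^sup>2 \<partial>lborel) - 4 ^ CARD('d) * b) \<le> (\<Sum>k\<in>?K. (I k)\<^sup>2)"
    by (simp add: algebra_simps)
  then show ?thesis by (simp add: I_def \<beta>_def h_def)
qed

section \<open>Consistency of the permutation test\<close>

text \<open>Densities are arbitrary outside the cube; the extension by 0 gives functions on the
  whole space to which translation invariance applies.\<close>

definition on_cube :: "(real ^ 'd \<Rightarrow> real) \<Rightarrow> real ^ 'd \<Rightarrow> real" where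
  "on_cube f x = indicator unit_cube x * f x"

lemma on_cube_measurable:
  assumes "cube_density P f"
  shows "on_cube f \<in> borel_measurable borel"
proof -
  have "on_cube f = (\<lambda>x. indicator unit_cube x *\<^sub>R f x)" by (rule ext) (simp add: on_cube_def)
  then show ?thesis using assms by (simp add: cube_density_def set_borel_measurable_def)
qed

lemma on_cube_bounds:
  fixes f :: "real ^ 'd::finite \<Rightarrow> real"
  assumes "s > 0" "L > 0" "holder_density s L P f"
  shows "0 \<le> on_cube f x" "on_cube f x \<le> 1 + L * real CARD('d)"
  using holder_density_le[OF assms, of x] assms(2) by (auto simp: on_cube_def indicator_def)

lemma cube_density_eq:
  "cube_density P f \<Longrightarrow> P = density lborel (\<lambda>x. ennreal (on_cube f x))"
proof -
  assume "cube_density P f"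
  moreover have "(\<lambda>x. ennreal (f x) * indicator unit_cube x) = (\<lambda>x. ennreal (on_cube f x))"
    by (rule ext) (simp add: on_cube_def indicator_def)
  ultimately show ?thesis by (simp add: cube_density_def)
qed

lemma bin_probability:
  fixes f :: "real ^ 'd::finite \<Rightarrow> real"
  assumes s: "s > 0" "L > 0" and f: "holder_density s L P f" and \<kappa>: "\<kappa> \<ge> 1" and k: "k \<in> bin_indices \<kappa>"
  shows "(\<integral>x. in_bin \<kappa> k x \<partial>P) = (\<integral>x. on_cube f x * indicator (bin \<kappa> k) x \<partial>lborel)"
    and "(\<integral>x. in_bin \<kappa> k x \<partial>P) \<le> (1 + L * real CARD('d)) * (1 / real \<kappa>) ^ CARD('d)"
    and "integrable lborel (\<lambda>x. on_cube f x * indicator (bin \<kappa> k) x)"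
proof -
  let ?B = "1 + L * real CARD('d)"
  have cd: "cube_density P f" using f by (simp add: holder_density_def)
  have meas: "on_cube f \<in> borel_measurable borel" by (rule on_cube_measurable[OF cd])
  have ind: "in_bin \<kappa> k = indicat_real {x. bin_of \<kappa> x = k}" by (auto simp: indicator_def)
  have "in_bin \<kappa> k \<in> borel_measurable lborel"
    unfolding ind using bin_of_borel[OF \<kappa> k] by simp
  then have "(\<integral>x. in_bin \<kappa> k x \<partial>P) = (\<integral>x. on_cube f x *\<^sub>R in_bin \<kappa> k x \<partial>lborel)"
    unfolding cube_density_eq[OF cd] using meas on_cube_bounds(1)[OF s f] by (intro integral_density) auto
  \<comment> \<open>Outside the cube \<open>bin_of\<close> may return \<open>k\<close> by accident,
    but \<open>on_cube f\<close> vanishes there.\<close>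
  also have "\<dots> = (\<integral>x. on_cube f x * indicator (bin \<kappa> k) x \<partial>lborel)"
    using bin_of_eq_iff[OF _ k \<kappa>] by (intro Bochner_Integration.integral_cong refl) (auto simp: on_cube_def indicator_def)
  finally show eq: "(\<integral>x. in_bin \<kappa> k x \<partial>P) = (\<integral>x. on_cube f x * indicator (bin \<kappa> k) x \<partial>lborel)" .
  have abs: "\<bar>on_cube f x\<bar> \<le> ?B" for x using on_cube_bounds[OF s f, of x] by simp
  have fin: "emeasure lborel (bin \<kappa> k) < \<infinity>" by (simp add: emeasure_bin[OF \<kappa> k])
  show int: "integrable lborel (\<lambda>x. on_cube f x * indicator (bin \<kappa> k) x)"
    by (rule integrable_bounded_on[OF meas abs bin_borel fin])
  have "(\<integral>x. on_cube f x * indicator (bin \<kappa> k) x \<partial>lborel) \<le> (\<integral>x. ?B * indicator (bin \<kappa> k) x \<partial>lborel)"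
  proof (rule integral_mono[OF int])
    show "integrable lborel (\<lambda>x. ?B * indicator (bin \<kappa> k) x)"
      using fin by (intro integrable_mult_right integrable_real_indicator) auto
    show "on_cube f x * indicator (bin \<kappa> k) x \<le> ?B * indicator (bin \<kappa> k) x" for x
      using on_cube_bounds(2)[OF s f, of x] by (intro mult_right_mono) auto
  qed
  also have "\<dots> = ?B * (1 / real \<kappa>) ^ CARD('d)"
    using emeasure_bin[OF \<kappa> k] by (simp add: measure_def)
  finally show "(\<integral>x. in_bin \<kappa> k x \<partial>P) \<le> ?B * (1 / real \<kappa>) ^ CARD('d)" unfolding eq .
qed

lemma L2_norm_cube_eq:
  "(L2_norm_cube (\<lambda>x. f x - g x))\<^sup>2 = (\<integral>x. (on_cube f x - on_cube g x)\<^sup>2 \<partial>lborel)"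
proof -
  have "(LINT x:unit_cube|lborel. (f x - g x)\<^sup>2) = (\<integral>x. (on_cube f x - on_cube g x)\<^sup>2 \<partial>lborel)"
    unfolding set_lebesgue_integral_def
    by (intro Bochner_Integration.integral_cong refl) (auto simp: on_cube_def indicator_def)
  then show ?thesis by (simp add: L2_norm_cube_def)
qed

text \<open>\<open>J\<close> and \<open>Cs\<close> are fixed before the distributions and the bin
  width. Shifts inside a bin are at most \<open>1 / real \<kappa>\<close> along each axis, so
  \<open>2 * J \<le> \<kappa>\<close> leaves room for \<open>J\<close> steps.\<close>

lemma binned_distance_ge:
  fixes s L :: real
  assumes s: "s > 0" and L: "L > 0"
  shows "\<exists>J Cs. J \<ge> 1 \<and> Cs \<ge> 0 \<and> (\<forall>(PY :: (real ^ 'd::finite) measure) PZ fY fZ \<kappa>.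
    holder_density s L PY fY \<longrightarrow> holder_density s L PZ fZ \<longrightarrow> 2 * J \<le> \<kappa> \<longrightarrow>
    (1 / real \<kappa>) ^ CARD('d) * ((L2_norm_cube (\<lambda>x. fY x - fZ x))\<^sup>2 / 2 - Cs * (1 / real \<kappa>) powr (2 * s))
    \<le> (\<Sum>k\<in>bin_indices \<kappa>. ((\<integral>x. in_bin \<kappa> k x \<partial>PY) - (\<integral>x. in_bin \<kappa> k x \<partial>PZ))\<^sup>2))"
proof -
  let ?d = "CARD('d)"
  \<comment> \<open>Chosen so that \<open>4 ^ ?d * (4 * \<delta>\<^sup>2 * E) = E / 4\<close>, which
    leaves at least half of \<open>E\<close>.\<close>
  define \<delta> :: real where "\<delta> = 1 / (4 * 2 ^ ?d)"
  obtain J and a :: "nat \<Rightarrow> real" where J: "J \<ge> 1" and a: "(\<Sum>j\<le>J. \<bar>a j\<bar>) \<le> \<delta>"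
    and moments: "\<And>k. k \<le> nat \<lfloor>s\<rfloor> \<Longrightarrow> (\<Sum>j\<le>J. a j * real j ^ k) = (if k = 0 then 0 else 1)"
    using small_extrapolation_weights[of \<delta> "nat \<lfloor>s\<rfloor>"] unfolding \<delta>_def by auto
  define C0 where "C0 = 2 * L * (1 + \<delta>) * real J powr s"
  have C0: "C0 \<ge> 0" using L by (simp add: C0_def \<delta>_def)
  define Cs where "Cs = 2 * 4 ^ ?d * C0\<^sup>2"
  have "(1 / real \<kappa>) ^ ?d * ((L2_norm_cube (\<lambda>x. fY x - fZ x))\<^sup>2 / 2 - Cs * (1 / real \<kappa>) powr (2 * s))
    \<le> (\<Sum>k\<in>bin_indices \<kappa>. ((\<integral>x. in_bin \<kappa> k x \<partial>PY) - (\<integral>x. in_bin \<kappa> k x \<partial>PZ))\<^sup>2)"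
    if Y: "holder_density s L PY fY" and Z: "holder_density s L PZ fZ" and \<kappa>J: "2 * J \<le> \<kappa>"
    for PY PZ :: "(real ^ 'd) measure" and fY fZ \<kappa>
  proof -
    define g where "g x = on_cube fY x - on_cube fZ x" for x
    define E where "E = (\<integral>x. (g x)\<^sup>2 \<partial>lborel)"
    define h where "h = 1 / real \<kappa>"
    define c where "c = C0 * h powr s"
    have \<kappa>: "\<kappa> \<ge> 1" using \<kappa>J J by linarith
    have h: "h \<ge> 0" by (simp add: h_def)
    have c: "c \<ge> 0" using C0 by (simp add: c_def)
    have g_meas: "g \<in> borel_measurable borel"
      unfolding g_def using Y Z by (intro borel_measurable_diff on_cube_measurable) (auto simp: holder_density_def)
    have g_le: "\<bar>g x\<bar> \<le> 1 + L * real ?d" for x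
      using on_cube_bounds[OF s L Y, of x] on_cube_bounds[OF s L Z, of x] by (simp add: g_def abs_le_iff)
    have g_zero: "g x = 0" if "x \<notin> unit_cube" for x using that by (simp add: g_def on_cube_def)
    have E: "(\<integral>\<^sup>+x. ennreal ((g x)\<^sup>2) \<partial>lborel) = ennreal E" "E \<ge> 0"
    proof -
      have g2: "\<bar>(g x)\<^sup>2\<bar> \<le> (1 + L * real ?d)\<^sup>2" for x
        using g_le[of x] power_mono[of "\<bar>g x\<bar>" "1 + L * real ?d" 2] by simp
      have "integrable lborel (\<lambda>x. (g x)\<^sup>2 * indicator (unit_cube :: (real ^ 'd) set) x)"
        by (rule integrable_bounded_on[OF borel_measurable_power[OF g_meas] g2 unit_cube_borel])
          (simp add: emeasure_unit_cube)
      moreover have "(g x)\<^sup>2 * indicator unit_cube x = (g x)\<^sup>2" for x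
        using g_zero[of x] by (auto simp: indicator_def)
      ultimately have "integrable lborel (\<lambda>x. (g x)\<^sup>2)" by simp
      then show "(\<integral>\<^sup>+x. ennreal ((g x)\<^sup>2) \<partial>lborel) = ennreal E"
        unfolding E_def by (rule nn_integral_eq_integral) simp
      show "E \<ge> 0" unfolding E_def by (intro Bochner_Integration.integral_nonneg) simp
    qed
    have axis: "shift_energy g (t *\<^sub>R axis i 1) \<le> ennreal (4 * \<delta>\<^sup>2 * E + 2 * c\<^sup>2)" if t: "\<bar>t\<bar> \<le> 1 / real \<kappa>" for t i
    proof (rule axis_shift_energy_le[OF g_meas E a c])
      have "\<bar>t\<bar> * real J \<le> 1 / real \<kappa> * real J" using t by (intro mult_right_mono) auto
      also have "\<dots> \<le> 1 / 2" using \<kappa>J \<kappa> by (simp add: divide_simps)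
      finally show "\<bar>t\<bar> * real J \<le> 1 / 2" .
    next
      fix x :: "real ^ 'd" and t'
      assume t': "\<bar>t'\<bar> = \<bar>t\<bar>" and cube: "\<And>j. j \<le> J \<Longrightarrow> x + (real j * t') *\<^sub>R axis i 1 \<in> unit_cube"
      have g_eq: "g y = fY y - fZ y" if "y \<in> unit_cube" for y using that by (simp add: g_def on_cube_def)
      have in_cube: "x \<in> unit_cube" "x + t' *\<^sub>R axis i 1 \<in> unit_cube" using cube[of 0] cube[of 1] J by auto
      have "\<bar>(fY (x + t' *\<^sub>R axis i 1) - fZ (x + t' *\<^sub>R axis i 1)) - (fY x - fZ x)\<bar>
        \<le> (\<Sum>j\<le>J. \<bar>a j\<bar> * \<bar>fY (x + (real j * t') *\<^sub>R axis i 1) - fZ (x + (real j * t') *\<^sub>R axis i 1)\<bar>)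
          + 2 * L * (1 + \<delta>) * real J powr s * \<bar>t'\<bar> powr s"
        using Y Z cube by (intro holder_increment_le[OF s L _ _ J a moments]) (auto simp: holder_density_def)
      also have "2 * L * (1 + \<delta>) * real J powr s * \<bar>t'\<bar> powr s \<le> c"
        unfolding c_def C0_def[symmetric] using C0 t t' s by (intro mult_left_mono powr_mono2) (auto simp: h_def)
      finally show "\<bar>g (x + t' *\<^sub>R axis i 1) - g x\<bar> \<le> (\<Sum>j\<le>J. \<bar>a j\<bar> * \<bar>g (x + (real j * t') *\<^sub>R axis i 1)\<bar>) + c"
        by (simp add: g_eq in_cube cube)
    qed
    have diff: "(\<integral>x. in_bin \<kappa> k x \<partial>PY) - (\<integral>x. in_bin \<kappa> k x \<partial>PZ) = (\<integral>x. g x * indicator (bin \<kappa> k) x \<partial>lborel)"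
      if "k \<in> bin_indices \<kappa>" for k
      unfolding bin_probability(1)[OF s L Y \<kappa> that] bin_probability(1)[OF s L Z \<kappa> that]
      by (subst Bochner_Integration.integral_diff[symmetric])
        (auto simp: g_def left_diff_distrib intro!: bin_probability(3)[OF s L Y \<kappa> that] bin_probability(3)[OF s L Z \<kappa> that])
    have "(1 / real \<kappa>) ^ ?d * (E - 4 ^ ?d * (4 * \<delta>\<^sup>2 * E + 2 * c\<^sup>2))
        \<le> (\<Sum>k\<in>bin_indices \<kappa>. (\<integral>x. g x * indicator (bin \<kappa> k) x \<partial>lborel)\<^sup>2)"
      unfolding E_def
      by (rule sum_bin_integrals_ge[OF g_meas g_le g_zero \<kappa> _ axis[unfolded E_def]]) (use E(2) in \<open>simp_all add: E_def\<close>)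
    also have "\<dots> = (\<Sum>k\<in>bin_indices \<kappa>. ((\<integral>x. in_bin \<kappa> k x \<partial>PY) - (\<integral>x. in_bin \<kappa> k x \<partial>PZ))\<^sup>2)"
      using diff by (intro sum.cong refl) simp
    finally have bins: "(1 / real \<kappa>) ^ ?d * (E - 4 ^ ?d * (4 * \<delta>\<^sup>2 * E + 2 * c\<^sup>2)) \<le> \<dots>" .
    have "E / 2 - Cs * h powr (2 * s) \<le> E - 4 ^ ?d * (4 * \<delta>\<^sup>2 * E + 2 * c\<^sup>2)"
    proof -
      have four: "(4::real) ^ ?d = (2 ^ ?d)\<^sup>2" by (simp add: power2_eq_square flip: power_mult_distrib)
      have "4 ^ ?d * (4 * \<delta>\<^sup>2 * E) = E / 4"
        unfolding four \<delta>_def by (simp add: power2_eq_square)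
      moreover have "4 ^ ?d * (2 * c\<^sup>2) = Cs * h powr (2 * s)"
      proof -
        have "(h powr s)\<^sup>2 = h powr (2 * s)" by (simp add: power2_eq_square flip: powr_add)
        then show ?thesis by (simp add: c_def Cs_def power_mult_distrib)
      qed
      ultimately have "E - 4 ^ ?d * (4 * \<delta>\<^sup>2 * E + 2 * c\<^sup>2) = E - E / 4 - Cs * h powr (2 * s)"
        by (simp only: distrib_left)
      then show ?thesis using E(2) by simp
    qed
    then have le: "(1 / real \<kappa>) ^ ?d * (E / 2 - Cs * (1 / real \<kappa>) powr (2 * s))
        \<le> (1 / real \<kappa>) ^ ?d * (E - 4 ^ ?d * (4 * \<delta>\<^sup>2 * E + 2 * c\<^sup>2))"
      unfolding h_def by (intro mult_left_mono) auto
    have norm: "(L2_norm_cube (\<lambda>x. fY x - fZ x))\<^sup>2 = E"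
      by (simp add: L2_norm_cube_eq E_def g_def)
    show ?thesis unfolding norm by (rule order_trans[OF le bins])
  qed
  then show ?thesis using J by (intro exI[of _ J] exI[of _ Cs]) (simp add: Cs_def)
qed

text \<open>Excludes small samples later on: the alternative is empty as soon as \<epsilon> exceeds
  this bound for the distance.\<close>

lemma L2_norm_cube_le:
  fixes fY fZ :: "real ^ 'd::finite \<Rightarrow> real"
  assumes s: "s > 0" and L: "L > 0" and Y: "holder_density s L PY fY" and Z: "holder_density s L PZ fZ"
  shows "(L2_norm_cube (\<lambda>x. fY x - fZ x))\<^sup>2 \<le> (1 + L * real CARD('d))\<^sup>2"
proof -
  let ?B = "1 + L * real CARD('d)"
  let ?g = "\<lambda>x. on_cube fY x - on_cube fZ x"
  have g_le: "(?g x)\<^sup>2 \<le> ?B\<^sup>2" for x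
  proof -
    have "\<bar>?g x\<bar> \<le> ?B"
      using on_cube_bounds[OF s L Y, of x] on_cube_bounds[OF s L Z, of x] by (simp add: abs_le_iff)
    then show ?thesis using power_mono[of "\<bar>?g x\<bar>" ?B 2] by simp
  qed
  have meas: "(\<lambda>x. (?g x)\<^sup>2) \<in> borel_measurable borel"
    using Y Z by (intro borel_measurable_power borel_measurable_diff on_cube_measurable) (auto simp: holder_density_def)
  have fin: "emeasure lborel (unit_cube :: (real ^ 'd) set) < \<infinity>" by (simp add: emeasure_unit_cube)
  have "(\<integral>x. (?g x)\<^sup>2 \<partial>lborel) = (\<integral>x. (?g x)\<^sup>2 * indicator unit_cube x \<partial>lborel)"
    by (intro Bochner_Integration.integral_cong refl) (auto simp: on_cube_def indicator_def)
  also have "\<dots> \<le> (\<integral>x. ?B\<^sup>2 * indicator (unit_cube :: (real ^ 'd) set) x \<partial>lborel)"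
  proof (rule integral_mono)
    show "integrable lborel (\<lambda>x. (?g x)\<^sup>2 * indicator unit_cube x)"
      using g_le by (intro integrable_bounded_on[OF meas _ unit_cube_borel fin, of "?B\<^sup>2"]) simp
    show "integrable lborel (\<lambda>x. ?B\<^sup>2 * indicator (unit_cube :: (real ^ 'd) set) x)"
      using fin by (intro integrable_mult_right integrable_real_indicator) auto
    show "(?g x)\<^sup>2 * indicator unit_cube x \<le> ?B\<^sup>2 * indicator unit_cube x" for x
      using g_le[of x] by (intro mult_right_mono) auto
  qed
  also have "\<dots> = ?B\<^sup>2 * measure lborel (unit_cube :: (real ^ 'd) set)" by simp
  also have "\<dots> = ?B\<^sup>2" by (simp add: measure_def emeasure_unit_cube)
  finally show ?thesis unfolding L2_norm_cube_eq .
qed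

text \<open>Here \<open>v\<close> stands for the bin volume, \<open>B * v\<close> for the bound on
  bin probabilities and \<open>W\<close> for the squared rate. With
  \<open>D \<ge> v * A * W\<close>, the three terms are governed by \<open>1 / A\<close>,
  \<open>1 / A\<^sup>2\<close> and \<open>1 / (\<alpha> * A\<^sup>2)\<close>; in the last one the
  root of \<alpha> contained in \<open>A\<close> cancels \<alpha>.\<close>

lemma error_bound_le:
  fixes B v n W R D \<alpha> \<beta> :: real
  assumes B: "B > 0" and v: "v > 0" and n: "n > 0" and W: "W > 0" and nW: "n * W \<ge> 1" "n\<^sup>2 * v * W\<^sup>2 \<ge> 1"
    and \<alpha>: "0 < \<alpha>" "\<alpha> < 1" and \<beta>: "0 < \<beta>" "\<beta> < 1" and R: "R \<ge> 5000 * B" "R \<ge> 1"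
    and D: "D \<ge> v * (R * W / (4 * (sqrt \<alpha> * \<beta>)))"
  shows "64 * (B * v) / (n * D) + 192 * (B * v) / (n\<^sup>2 * D\<^sup>2) + 96 * (B * v) / (n\<^sup>2 * (\<alpha> * D\<^sup>2)) \<le> \<beta>"
proof -
  define A where "A = R / (4 * (sqrt \<alpha> * \<beta>))"
  have A: "A > 0" using R \<alpha> \<beta> by (simp add: A_def)
  have D': "D \<ge> v * A * W" using D by (simp add: A_def mult_ac)
  have pos: "v * A * W > 0" using v A W by simp
  have sa: "sqrt \<alpha> \<le> 1" "sqrt \<alpha> > 0" "(sqrt \<alpha>)\<^sup>2 = \<alpha>" using \<alpha> by auto
  have nD: "n * D \<ge> v * A"
  proof -
    have "v * A * 1 \<le> v * A * (n * W)" using nW(1) v A by (intro mult_left_mono) auto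
    also have "\<dots> = n * (v * A * W)" by simp
    also have "\<dots> \<le> n * D" using D' n by (intro mult_left_mono) auto
    finally show ?thesis by simp
  qed
  have nD2: "n\<^sup>2 * D\<^sup>2 \<ge> v * A\<^sup>2"
  proof -
    have "v * A\<^sup>2 * 1 \<le> v * A\<^sup>2 * (n\<^sup>2 * v * W\<^sup>2)" using nW(2) v by (intro mult_left_mono) auto
    also have "\<dots> = n\<^sup>2 * (v * A * W)\<^sup>2" by (simp add: power2_eq_square)
    also have "\<dots> \<le> n\<^sup>2 * D\<^sup>2" using D' pos by (intro mult_left_mono power_mono) auto
    finally show ?thesis by simp
  qed
  have A1: "1 / A \<le> 4 * \<beta> / R"
  proof -
    have "1 / A = 4 * (sqrt \<alpha> * \<beta>) / R" by (simp add: A_def)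
    also have "\<dots> \<le> 4 * (1 * \<beta>) / R" using sa \<beta> R by (intro divide_right_mono mult_left_mono mult_right_mono) auto
    finally show ?thesis by simp
  qed
  have A2: "1 / (\<alpha> * A\<^sup>2) \<le> 16 * \<beta> / R"
  proof -
    have "1 / (\<alpha> * A\<^sup>2) = 16 * \<beta>\<^sup>2 / R\<^sup>2"
      using \<alpha> sa R \<beta> by (simp add: A_def power_divide power_mult_distrib)
    also have "\<dots> = (16 * \<beta> / R) * (\<beta> / R)" by (simp add: power2_eq_square)
    also have "\<dots> \<le> (16 * \<beta> / R) * 1" using \<beta> R by (intro mult_left_mono) auto
    finally show ?thesis by simp
  qed
  have A3: "1 / A\<^sup>2 \<le> 16 * \<beta> / R"
  proof -
    have "1 / A\<^sup>2 \<le> 1 / (\<alpha> * A\<^sup>2)"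
      using \<alpha> A by (intro frac_le) (auto simp: mult_left_le_one_le)
    then show ?thesis using A2 by linarith
  qed
  have "64 * (B * v) / (n * D) \<le> 64 * (B * v) / (v * A)"
    using nD B v A by (intro frac_le) auto
  also have "\<dots> = 64 * B * (1 / A)" using v by simp
  also have "\<dots> \<le> 64 * B * (4 * \<beta> / R)" using A1 B by (intro mult_left_mono) auto
  finally have t1: "64 * (B * v) / (n * D) \<le> 64 * B * (4 * \<beta> / R)" .
  have "192 * (B * v) / (n\<^sup>2 * D\<^sup>2) \<le> 192 * (B * v) / (v * A\<^sup>2)"
    using nD2 B v A by (intro frac_le) auto
  also have "\<dots> = 192 * B * (1 / A\<^sup>2)" using v by simp
  also have "\<dots> \<le> 192 * B * (16 * \<beta> / R)" using A3 B by (intro mult_left_mono) auto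
  finally have t2: "192 * (B * v) / (n\<^sup>2 * D\<^sup>2) \<le> 192 * B * (16 * \<beta> / R)" .
  have "96 * (B * v) / (n\<^sup>2 * (\<alpha> * D\<^sup>2)) = 96 * (B * v) / (\<alpha> * (n\<^sup>2 * D\<^sup>2))" by (simp add: mult_ac)
  also have "\<dots> \<le> 96 * (B * v) / (\<alpha> * (v * A\<^sup>2))"
    using nD2 B v A \<alpha> by (intro frac_le mult_left_mono) auto
  also have "\<dots> = 96 * B * (1 / (\<alpha> * A\<^sup>2))" using v by simp
  also have "\<dots> \<le> 96 * B * (16 * \<beta> / R)" using A2 B by (intro mult_left_mono) auto
  finally have t3: "96 * (B * v) / (n\<^sup>2 * (\<alpha> * D\<^sup>2)) \<le> 96 * B * (16 * \<beta> / R)" .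
  \<comment> \<open>4864 = 64 * 4 + 192 * 16 + 96 * 16, rounded up to 5000 in the assumption on
    \<open>R\<close>.\<close>
  have "64 * B * (4 * \<beta> / R) + 192 * B * (16 * \<beta> / R) + 96 * B * (16 * \<beta> / R) = (4864 * B / R) * \<beta>"
    using R by (simp add: field_simps)
  also have "\<dots> \<le> 1 * \<beta>" using R B \<beta> by (intro mult_right_mono) auto
  finally show ?thesis using t1 t2 t3 by linarith
qed

theorem proposition4p6:
  fixes s L :: real
  assumes "s > 0" and "L > 0"
  shows "\<exists>C>0. \<forall>(n1::nat) (n2::nat) (\<alpha>::real) (\<beta>::real) (\<epsilon>::real).
    2 \<le> n1 \<longrightarrow> n1 \<le> n2 \<longrightarrow> \<alpha> \<in> {0<..<1} \<longrightarrow> \<beta> \<in> {0<..<1 - \<alpha>} \<longrightarrow>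
    \<epsilon> \<ge> C / (\<alpha> powr (1/4) * \<beta> powr (1/2)) *
         (1 / real n1 + 1 / real n2) powr (2 * s / (4 * s + real CARD('d::finite))) \<longrightarrow>
    (let \<kappa> = bins_per_axis CARD('d) s n1 in
       (SUP (P\<^sub>Y, P\<^sub>Z) \<in> (null_class s L :: ((real ^ 'd) measure \<times> (real ^ 'd) measure) set).
          emeasure (sample_law n1 n2 P\<^sub>Y P\<^sub>Z)
            {X \<in> space (sample_law n1 n2 P\<^sub>Y P\<^sub>Z).
               test_stat \<kappa> n1 n2 X > crit_value \<kappa> n1 n2 \<alpha> X}) \<le> ennreal \<alpha> \<and>
       (SUP (P\<^sub>Y, P\<^sub>Z) \<in> (alt_class s L \<epsilon> :: ((real ^ 'd) measure \<times> (real ^ 'd) measure) set).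
          emeasure (sample_law n1 n2 P\<^sub>Y P\<^sub>Z)
            {X \<in> space (sample_law n1 n2 P\<^sub>Y P\<^sub>Z).
               test_stat \<kappa> n1 n2 X \<le> crit_value \<kappa> n1 n2 \<alpha> X}) \<le> ennreal \<beta>)"
proof -
  note s = \<open>s > 0\<close> and L = \<open>L > 0\<close>
  let ?d = "CARD('d)"
  define B where "B = 1 + L * real ?d"
  have B: "B \<ge> 1" using L by (simp add: B_def)
  obtain J :: nat and Cs where J: "J \<ge> 1" and Cs: "Cs \<ge> 0"
    and distance: "\<And>(PY :: (real ^ 'd) measure) PZ fY fZ \<kappa>.
      holder_density s L PY fY \<Longrightarrow> holder_density s L PZ fZ \<Longrightarrow> 2 * J \<le> \<kappa> \<Longrightarrow>
      (1 / real \<kappa>) ^ ?d * ((L2_norm_cube (\<lambda>x. fY x - fZ x))\<^sup>2 / 2 - Cs * (1 / real \<kappa>) powr (2 * s))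
      \<le> (\<Sum>k\<in>bin_indices \<kappa>. ((\<integral>x. in_bin \<kappa> k x \<partial>PY) - (\<integral>x. in_bin \<kappa> k x \<partial>PZ))\<^sup>2)"
    using binned_distance_ge[OF s L] by blast
  \<comment> \<open>The summands serve in turn the error bound, the bias bound \<open>E / 4\<close>
    and the exclusion of \<open>\<kappa> < 2 * J\<close>. The constant C is \<open>sqrt R\<close>,
    because \<epsilon> enters squared.\<close>
  define R where "R = 5000 * B + 4 * (2 powr (2 * s) * Cs) + (B\<^sup>2 + 1) * (2 * real J) powr (2 * s)"
  have R: "R \<ge> 5000 * B" "R \<ge> 4 * (2 powr (2 * s) * Cs)" "R \<ge> (B\<^sup>2 + 1) * (2 * real J) powr (2 * s)"
    using B Cs by (auto simp: R_def)
  then have R1: "R \<ge> 1" using B by linarith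
  have null: "emeasure (sample_law n1 n2 PY PZ) {X \<in> space (sample_law n1 n2 PY PZ).
      test_stat \<kappa> n1 n2 X > crit_value \<kappa> n1 n2 \<alpha> X} \<le> ennreal \<alpha>"
    if P: "(PY, PZ) \<in> null_class s L" and \<alpha>: "0 < \<alpha>" "\<alpha> < 1" for PY PZ :: "(real ^ 'd) measure" and \<alpha> \<kappa> n1 n2
  proof -
    obtain fY fZ where Y: "holder_density s L PY fY" and Z: "holder_density s L PZ fZ"
      and eq: "\<forall>x\<in>unit_cube. fY x = fZ x" using P by (auto simp: null_class_def)
    have "on_cube fY = on_cube fZ" using eq by (auto simp: on_cube_def indicator_def)
    then have "PY = PZ"
      using cube_density_eq[of PY fY] cube_density_eq[of PZ fZ] Y Z by (simp add: holder_density_def)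
    moreover have "prob_space PY" using Y unfolding holder_density_def cube_density_def by blast
    ultimately show ?thesis using type_one_error[OF _ \<alpha>] by simp
  qed
  have alt: "emeasure (sample_law n1 n2 PY PZ) {X \<in> space (sample_law n1 n2 PY PZ).
      test_stat \<kappa> n1 n2 X \<le> crit_value \<kappa> n1 n2 \<alpha> X} \<le> ennreal \<beta>"
    if n: "2 \<le> n1" "n1 \<le> n2" and \<alpha>: "0 < \<alpha>" "\<alpha> < 1" and \<beta>: "0 < \<beta>" "\<beta> < 1"
      and \<epsilon>: "\<epsilon> \<ge> sqrt R / (\<alpha> powr (1/4) * \<beta> powr (1/2)) *
         (1 / real n1 + 1 / real n2) powr (2 * s / (4 * s + real ?d))"
      and \<kappa>_def: "\<kappa> = bins_per_axis ?d s n1" and P: "(PY, PZ) \<in> alt_class s L \<epsilon>"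
    for PY PZ :: "(real ^ 'd) measure" and \<alpha> \<beta> \<epsilon> \<kappa> n1 n2
  proof -
    obtain fY fZ where Y: "holder_density s L PY fY" and Z: "holder_density s L PZ fZ"
      and norm: "L2_norm_cube (\<lambda>x. fY x - fZ x) \<ge> \<epsilon>" using P by (auto simp: alt_class_def)
    define E where "E = (L2_norm_cube (\<lambda>x. fY x - fZ x))\<^sup>2"
    define e where "e = 4 * s + real ?d"
    have e: "e > 0" using s by (simp add: e_def add_pos_nonneg)
    have n1: "real n1 \<ge> 2" using n by simp
    \<comment> \<open>The number of bins per axis before rounding; rounding down costs at most a
      factor 2.\<close>
    define x where "x = real n1 powr (2 / e)"
    have x1: "x \<ge> 1" using n1 e by (simp add: x_def ge_one_powr_ge_zero)
    have \<kappa>: "\<kappa> = nat \<lfloor>x\<rfloor>" by (simp add: \<kappa>_def bins_per_axis_def x_def e_def)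
    have \<kappa>1: "\<kappa> \<ge> 1" using x1 by (simp add: \<kappa> le_nat_iff le_floor_iff)
    have "real \<kappa> = of_int \<lfloor>x\<rfloor>" using x1 by (simp add: \<kappa>)
    then have \<kappa>x: "real \<kappa> \<le> x" "x < real \<kappa> + 1" by linarith+
    have \<kappa>2: "x \<le> 2 * real \<kappa>" using \<kappa>x \<kappa>1 by linarith
    define W where "W = x powr (- 2 * s)"
    have W: "W > 0" using x1 by (simp add: W_def)
    have E_ge: "E \<ge> R * W / (sqrt \<alpha> * \<beta>)"
    proof -
      define t where "t = \<alpha> powr (1/4) * \<beta> powr (1/2)"
      have t: "t > 0" using \<alpha> \<beta> by (simp add: t_def)
      have t2: "t\<^sup>2 = sqrt \<alpha> * \<beta>"
      proof -
        have "(\<alpha> powr (1/4))\<^sup>2 = sqrt \<alpha>" using \<alpha> by (simp add: power2_eq_square powr_half_sqrt flip: powr_add)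
        moreover have "(\<beta> powr (1/2))\<^sup>2 = \<beta>" using \<beta> by (simp add: powr_half_sqrt)
        ultimately show ?thesis by (simp add: t_def power_mult_distrib)
      qed
      have "x powr (- s) = (1 / real n1) powr (2 * s / e)"
      proof -
        have "x powr (- s) = real n1 powr (- (2 * s / e))" unfolding x_def powr_powr by (simp add: mult.commute)
        also have "\<dots> = 1 / real n1 powr (2 * s / e)" by (rule powr_minus_divide)
        also have "\<dots> = (1 / real n1) powr (2 * s / e)" using n1 by (simp add: powr_divide)
        finally show ?thesis .
      qed
      \<comment> \<open>The term of the second sample only increases the rate, so the separation may
        be measured by \<open>n1\<close> alone.\<close>
      also have "\<dots> \<le> (1 / real n1 + 1 / real n2) powr (2 * s / e)"
        using n1 s e by (intro powr_mono2) auto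
      finally have "sqrt R / t * x powr (- s) \<le> sqrt R / t * (1 / real n1 + 1 / real n2) powr (2 * s / e)"
        using R1 t by (intro mult_left_mono) auto
      then have "sqrt R / t * x powr (- s) \<le> L2_norm_cube (\<lambda>x. fY x - fZ x)"
        using \<epsilon> norm unfolding t_def e_def by linarith
      then have "(sqrt R / t * x powr (- s))\<^sup>2 \<le> E"
        unfolding E_def using R1 t by (intro power_mono) auto
      moreover have "(sqrt R / t * x powr (- s))\<^sup>2 = R * W / (sqrt \<alpha> * \<beta>)"
      proof -
        have "(x powr (- s))\<^sup>2 = W" by (simp add: W_def power2_eq_square flip: powr_add)
        then show ?thesis using R1 by (simp add: power_mult_distrib power_divide t2)
      qed
      ultimately show ?thesis by simp
    qed
    have ab: "0 < sqrt \<alpha> * \<beta>" "sqrt \<alpha> * \<beta> \<le> 1"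
      using \<alpha> \<beta> by (auto intro!: mult_le_one)
    have E_RW: "E \<ge> R * W"
    proof -
      have "R * W / 1 \<le> R * W / (sqrt \<alpha> * \<beta>)" using ab R1 W by (intro divide_left_mono) auto
      then show ?thesis using E_ge by simp
    qed
    \<comment> \<open>With fewer bins the third summand of \<open>R\<close> would push
      \<open>E\<close> to at least \<open>B\<^sup>2 + 1\<close>, more than the densities
      allow.\<close>
    have \<kappa>J: "2 * J \<le> \<kappa>"
    proof (rule ccontr)
      assume "\<not> ?thesis"
      then have "real \<kappa> + 1 \<le> 2 * real J" by linarith
      then have "x \<le> 2 * real J" using \<kappa>x by linarith
      then have "x powr (2 * s) \<le> (2 * real J) powr (2 * s)" using x1 s by (intro powr_mono2) auto
      then have "(B\<^sup>2 + 1) * x powr (2 * s) \<le> R"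
        using R(3) by (meson mult_left_mono add_nonneg_nonneg order_trans zero_le_one zero_le_power2)
      then have "(B\<^sup>2 + 1) * x powr (2 * s) * W \<le> R * W" using W by (intro mult_right_mono) auto
      moreover have "x powr (2 * s) * W = 1" using x1 by (simp add: W_def flip: powr_add)
      ultimately have "B\<^sup>2 + 1 \<le> E" using E_RW by (simp add: mult.assoc)
      moreover have "E \<le> B\<^sup>2" unfolding E_def B_def by (rule L2_norm_cube_le[OF s L Y Z])
      ultimately show False by simp
    qed
    define v where "v = (1 / real \<kappa>) ^ ?d"
    have v: "v > 0" using \<kappa>1 by (simp add: v_def)
    define D where "D = (\<Sum>k\<in>bin_indices \<kappa>. ((\<integral>x. in_bin \<kappa> k x \<partial>PY) - (\<integral>x. in_bin \<kappa> k x \<partial>PZ))\<^sup>2)"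
    have hW: "(1 / real \<kappa>) powr (2 * s) \<le> 2 powr (2 * s) * W"
    proof -
      have "1 / real \<kappa> \<le> 2 / x" using \<kappa>2 \<kappa>1 x1 by (simp add: field_simps)
      then have "(1 / real \<kappa>) powr (2 * s) \<le> (2 / x) powr (2 * s)" using s by (intro powr_mono2) auto
      also have "\<dots> = 2 powr (2 * s) * W"
        using x1 powr_minus_divide[of x "2 * s"] by (simp add: W_def powr_divide)
      finally show ?thesis .
    qed
    have D_ge: "D \<ge> v * (R * W / (4 * (sqrt \<alpha> * \<beta>)))"
    proof -
      \<comment> \<open>The bias consumes at most a quarter of \<open>E\<close> out of the available
        half, so a quarter remains.\<close>
      have "Cs * (1 / real \<kappa>) powr (2 * s) \<le> Cs * (2 powr (2 * s) * W)" using hW Cs by (intro mult_left_mono) auto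
      also have "\<dots> \<le> R / 4 * W" using mult_right_mono[OF R(2), of "W / 4"] W by (simp add: mult_ac)
      also have "\<dots> \<le> E / 4" using E_RW by simp
      finally have bias: "Cs * (1 / real \<kappa>) powr (2 * s) \<le> E / 4" .
      have "q / 4 \<le> E / 2 - r" if "r \<le> E / 4" "q \<le> E" for q r :: real
        using that by linarith
      from this[OF bias E_ge]
      have "R * W / (sqrt \<alpha> * \<beta>) / 4 \<le> E / 2 - Cs * (1 / real \<kappa>) powr (2 * s)" .
      moreover have "R * W / (4 * (sqrt \<alpha> * \<beta>)) = R * W / (sqrt \<alpha> * \<beta>) / 4" by simp
      ultimately have "R * W / (4 * (sqrt \<alpha> * \<beta>)) \<le> E / 2 - Cs * (1 / real \<kappa>) powr (2 * s)" by (simp only:)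
      then have "v * (R * W / (4 * (sqrt \<alpha> * \<beta>))) \<le> v * (E / 2 - Cs * (1 / real \<kappa>) powr (2 * s))"
        by (rule mult_left_mono) (use v in simp)
      also have "\<dots> \<le> D" unfolding v_def E_def D_def by (rule distance[OF Y Z \<kappa>J])
      finally show ?thesis .
    qed
    have D_pos: "D > 0"
    proof -
      have "0 < v * (R * W / (4 * (sqrt \<alpha> * \<beta>)))" using v R1 W \<alpha> \<beta> by (intro mult_pos_pos divide_pos_pos) auto
      then show ?thesis using D_ge by linarith
    qed
    have n_powr: "real n1 = x powr (e / 2)" using n1 e by (simp add: x_def powr_powr)
    have nW: "real n1 * W \<ge> 1"
    proof -
      have "real n1 * W = x powr (real ?d / 2)"
        unfolding n_powr W_def by (simp add: e_def field_simps flip: powr_add)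
      then show ?thesis using x1 by (simp add: ge_one_powr_ge_zero)
    qed
    \<comment> \<open>The balance that fixes the number of bins: with \<open>x\<close> in place of
      \<kappa> in \<open>v\<close>, this product is exactly 1.\<close>
    have nW2: "(real n1)\<^sup>2 * v * W\<^sup>2 \<ge> 1"
    proof -
      have "x powr (- real ?d) = (1 / x) ^ ?d"
        using x1 by (simp add: powr_minus powr_realpow power_one_over divide_inverse power_inverse)
      also have "\<dots> \<le> v" unfolding v_def using \<kappa>x \<kappa>1 x1 by (intro power_mono frac_le) auto
      finally have "(real n1)\<^sup>2 * x powr (- real ?d) * W\<^sup>2 \<le> (real n1)\<^sup>2 * v * W\<^sup>2"
        by (intro mult_left_mono mult_right_mono) auto
      moreover have "(real n1)\<^sup>2 * x powr (- real ?d) * W\<^sup>2 = 1"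
      proof -
        have "(real n1)\<^sup>2 = x powr e" unfolding n_powr by (simp add: power2_eq_square flip: powr_add)
        moreover have "W\<^sup>2 = x powr (- 4 * s)" by (simp add: W_def power2_eq_square flip: powr_add)
        ultimately show ?thesis using x1 by (simp add: e_def flip: powr_add)
      qed
      ultimately show ?thesis by simp
    qed
    have "emeasure (sample_law n1 n2 PY PZ) {X \<in> space (sample_law n1 n2 PY PZ).
        test_stat \<kappa> n1 n2 X \<le> crit_value \<kappa> n1 n2 \<alpha> X}
      \<le> ennreal (64 * (B * v) / (real n1 * D) + 192 * (B * v) / ((real n1)\<^sup>2 * D\<^sup>2) + 96 * (B * v) / ((real n1)\<^sup>2 * (\<alpha> * D\<^sup>2)))"
    proof (rule type_two_error[OF _ _ _ _ \<kappa>1 n \<alpha> refl refl])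
      show "prob_space PY" "prob_space PZ" using Y Z by (auto simp: holder_density_def cube_density_def)
      show "sets PY = sets borel" "sets PZ = sets borel"
        using Y Z cube_density_eq[of PY fY] cube_density_eq[of PZ fZ] by (metis holder_density_def sets_density sets_lborel)+
      show "(\<integral>x. in_bin \<kappa> k x \<partial>PY) \<le> B * v" "(\<integral>x. in_bin \<kappa> k x \<partial>PZ) \<le> B * v" if "k \<in> bin_indices \<kappa>" for k
        unfolding B_def v_def using bin_probability(2)[OF s L _ \<kappa>1 that] Y Z by blast+
    qed (use D_pos in \<open>simp_all add: D_def\<close>)
    also have "\<dots> \<le> ennreal \<beta>"
      using B v n1 W nW nW2 \<alpha> \<beta> R R1 D_ge by (intro ennreal_leI error_bound_le[where W = W and R = R]) auto
    finally show ?thesis .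
  qed
  show ?thesis
    unfolding Let_def
  proof (intro exI[of _ "sqrt R"] conjI allI impI SUP_least)
    show "sqrt R > 0" using R1 by simp
  next
    fix n1 n2 :: nat and \<alpha> \<beta> \<epsilon> :: real and P :: "(real ^ 'd) measure \<times> (real ^ 'd) measure"
    assume "\<alpha> \<in> {0<..<1}" "P \<in> null_class s L"
    then show "(case P of (P\<^sub>Y, P\<^sub>Z) \<Rightarrow> emeasure (sample_law n1 n2 P\<^sub>Y P\<^sub>Z)
            {X \<in> space (sample_law n1 n2 P\<^sub>Y P\<^sub>Z).
               test_stat (bins_per_axis ?d s n1) n1 n2 X > crit_value (bins_per_axis ?d s n1) n1 n2 \<alpha> X}) \<le> ennreal \<alpha>"
      using null by (cases P) auto
  next
    fix n1 n2 :: nat and \<alpha> \<beta> \<epsilon> :: real and P :: "(real ^ 'd) measure \<times> (real ^ 'd) measure"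
    assume n: "2 \<le> n1" "n1 \<le> n2" and "\<alpha> \<in> {0<..<1}" "\<beta> \<in> {0<..<1 - \<alpha>}"
      and \<epsilon>: "\<epsilon> \<ge> sqrt R / (\<alpha> powr (1/4) * \<beta> powr (1/2)) *
         (1 / real n1 + 1 / real n2) powr (2 * s / (4 * s + real ?d))" and P: "P \<in> alt_class s L \<epsilon>"
    then have \<alpha>\<beta>: "0 < \<alpha>" "\<alpha> < 1" "0 < \<beta>" "\<beta> < 1" by auto
    obtain PY PZ where PYZ: "P = (PY, PZ)" by (cases P)
    show "(case P of (P\<^sub>Y, P\<^sub>Z) \<Rightarrow> emeasure (sample_law n1 n2 P\<^sub>Y P\<^sub>Z)
            {X \<in> space (sample_law n1 n2 P\<^sub>Y P\<^sub>Z).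
               test_stat (bins_per_axis ?d s n1) n1 n2 X \<le> crit_value (bins_per_axis ?d s n1) n1 n2 \<alpha> X}) \<le> ennreal \<beta>"
      using alt[OF n \<alpha>\<beta> \<epsilon> refl P[unfolded PYZ]] by (simp only: PYZ prod.case)
  qed
qed

end
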